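(* Consider the setting, the primal inclusion (P), the dual inclusion (D), the parameter assumptions, and the iteration (Algorithm B) described in the context, and suppose that the dual inclusion (D) has a solution. Let $(\boldsymbol{x}_n)_{n\in\mathbb N}$, $(\boldsymbol{y}_n)_{n\in\mathbb N}$, $(\boldsymbol{z}_n)_{n\in\mathbb N}$, $(\boldsymbol{v}_n^* )_{n\in\mathbb N}$, $(a_{i,n})$, $(b_{k,n})$, $(d_{k,n})$, $(e^*_{k,n})$ be the sequences generated by Algorithm B. Then the following hold: (i) For every $i\in I$, $\sum_{n\in\mathbb N}\|x_{i,n+1}-x_{i,n}\|^2<+\infty$. (ii) For every $k\in K$, $\sum_{n\in\mathbb N}\|y_{k,n+1}-y_{k,n}\|^2<+\infty$, $\sum_{n\in\mathbb N}\|z_{k,n+1}-z_{k,n}\|^2<+\infty$, and $\sum_{n\in\mathbb N}\|v_{k,n+1}^*-v_{k,n}^*\|^2<+\infty$. (iii) For every $i\in I$ and every $k\in K$, $x_{i,n}-a_{i,n}\to 0$, $y_{k,n}-b_{k,n}\to 0$, $z_{k,n}-d_{k,n}\to 0$, and $v_{k,n}^*-e_{k,n}^*\to 0$ (strongly). (iv) There exist a solution $\overline{\boldsymbol{x}}$ to (P) and a solution $\overline{\boldsymbol{v}}^*$ to (D) such that, for every $i\in I$ and every $k\in K$, $x_{i,n}\to\overline{x}_i$, $a_{i,n}\to\overline{x}_i$, and $v_{k,n}^*\to\overline{v}_k^*$ (strong convergence). In addition, $(\overline{\boldsymbol{x}},\overline{\boldsymbol{v}}^* )$ belongs to the Kuhn--Tucker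 set $\mathsf{Z}$.
   Context: Notation. $\langle\cdot\mid\cdot\rangle$ is the scalar product and $\|\cdot\|$ the norm of a real Hilbert space. For a set-valued operator $A\colon\mathcal K\to 2^{\mathcal K}$, $A^{-1}$ is the set-valued inverse and $J_A=(\mathrm{Id}+A)^{-1}$ is the resolvent (single-valued with full domain if $A$ is maximally monotone). The parallel sum of $B,D\colon\mathcal K\to 2^{\mathcal K}$ is $B\,\square\,D=(B^{-1}+D^{-1})^{-1}$. $C\colon\mathcal K\to\mathcal K$ is cocoercive with constant $\alpha>0$ if $\langle x-y\mid Cx-Cy\rangle\geq\alpha\|Cx-Cy\|^2$ for all $x,y$. $\mathbb N=\{0,1,2,\dots\}$. Bold letters denote product space elements, e.g. $\boldsymbol{x}_n=(x_{i,n})_{i\in I}$. Setting. $(\mathcal H_i)_{i\in I}$ and $(\mathcal G_k)_{k\in K}$ are finite families of real Hilbert spaces, with Hilbert direct sums $\boldsymbol{\mathcal H}=\bigoplus_{i\in I}\mathcal H_i$ and $\boldsymbol{\mathcal G}=\bigoplus_{k\in K}\mathcal G_k$. For every $i\in I$ and $k\in K$, $s_i^*\in\mathcal H_i$, $r_k\in\mathcal G_k$, and: [a] $A_i\colon\mathcal H_i\to 2^{\mathcal H_i}$ is maximally monotone, $C_i\colon\mathcal H_i\to\mathcal H_i$ is cocoercive with constant $\alpha_i^{\rm c}\in(0,+\infty)$, $Q_i\colon\mathcal H_i\to\mathcal H_i$ is monotone and Lipschitzian with constant $\alpha_i^{\rm l}\in[0,+\infty)$, and $R_i\colon\boldsymbol{\mathcal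 H}\to\mathcal H_i$. [b] $B_k^{\rm m}\colon\mathcal G_k\to 2^{\mathcal G_k}$ is maximally monotone, $B_k^{\rm c}\colon\mathcal G_k\to\mathcal G_k$ is cocoercive with constant $\beta_k^{\rm c}\in(0,+\infty)$, $B_k^{\rm l}\colon\mathcal G_k\to\mathcal G_k$ is monotone and Lipschitzian with constant $\beta_k^{\rm l}\in[0,+\infty)$. [c] $D_k^{\rm m}\colon\mathcal G_k\to 2^{\mathcal G_k}$ is maximally monotone, $D_k^{\rm c}\colon\mathcal G_k\to\mathcal G_k$ is cocoercive with constant $\delta_k^{\rm c}\in(0,+\infty)$, $D_k^{\rm l}\colon\mathcal G_k\to\mathcal G_k$ is monotone and Lipschitzian with constant $\delta_k^{\rm l}\in[0,+\infty)$. [d] $L_{ki}\colon\mathcal H_i\to\mathcal G_k$ is linear and bounded. [e] $\boldsymbol R\colon\boldsymbol{\mathcal H}\to\boldsymbol{\mathcal H}\colon\boldsymbol x\mapsto(R_i\boldsymbol x)_{i\in I}$ is monotone and Lipschitzian with constant $\chi\in[0,+\infty)$. (P): find $\overline{\boldsymbol x}\in\boldsymbol{\mathcal H}$ such that, for every $i\in I$, $$s_i^*\in A_i\overline x_i+C_i\overline x_i+Q_i\overline x_i+R_i\overline{\boldsymbol x}+\sum_{k\in K}L_{ki}^*\Big(\big((B_k^{\rm m}+B_k^{\rm c}+B_k^{\rm l})\,\square\,(D_k^{\rm m}+D_k^{\rm c}+D_k^{\rm l})\big)\Big(\sum_{j\in I}L_{kj}\overline x_j-r_k\Big)\Big).$$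 (D): find $\overline{\boldsymbol v}^*\in\boldsymbol{\mathcal G}$ such that there exists $\boldsymbol x\in\boldsymbol{\mathcal H}$ with, for all $i\in I$, $k\in K$, $$s_i^*-\sum_{j\in K}L_{ji}^*\overline v_j^*\in A_ix_i+C_ix_i+Q_ix_i+R_i\boldsymbol x,\qquad \overline v_k^*\in\big((B_k^{\rm m}+B_k^{\rm c}+B_k^{\rm l})\,\square\,(D_k^{\rm m}+D_k^{\rm c}+D_k^{\rm l})\big)\Big(\sum_{j\in I}L_{kj}x_j-r_k\Big).$$ Kuhn--Tucker set: $\mathsf Z$ is the set of $(\overline{\boldsymbol x},\overline{\boldsymbol v}^* )\in\boldsymbol{\mathcal H}\oplus\boldsymbol{\mathcal G}$ such that, for all $i\in I$, $k\in K$, $s_i^*-\sum_{j\in K}L_{ji}^*\overline v_j^*\in A_i\overline x_i+C_i\overline x_i+Q_i\overline x_i+R_i\overline{\boldsymbol x}$ and $\sum_{j\in I}L_{kj}\overline x_j-r_k\in(B_k^{\rm m}+B_k^{\rm c}+B_k^{\rm l})^{-1}\overline v_k^*+(D_k^{\rm m}+D_k^{\rm c}+D_k^{\rm l})^{-1}\overline v_k^*$. Parameter assumptions. Set $\alpha=\min\{\alpha_i^{\rm c},\beta_k^{\rm c},\delta_k^{\rm c}\}_{i\in I,k\in K}$; $\sigma\in(0,+\infty)$ and $\varepsilon\in(0,1)$ satisfy $\sigma>1/(4\alpha)$ and $1/\varepsilon>\max\{\alpha_i^{\rm l}+\chi+\sigma,\ \beta_k^{\rm l}+\sigma,\ \delta_k^{\rm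 l}+\sigma\}_{i\in I,k\in K}$. For all $i\in I$, $k\in K$, $n\in\mathbb N$: $\gamma_{i,n}\in[\varepsilon,1/(\alpha_i^{\rm l}+\chi+\sigma)]$, $\mu_{k,n}\in[\varepsilon,1/(\beta_k^{\rm l}+\sigma)]$, $\nu_{k,n}\in[\varepsilon,1/(\delta_k^{\rm l}+\sigma)]$, $\sigma_{k,n}\in[\varepsilon,1/\varepsilon]$; $x_{i,0}\in\mathcal H_i$ and $y_{k,0},z_{k,0},v_{k,0}^*\in\mathcal G_k$. Block selection: $P\in\mathbb N$; $(I_n)_{n\in\mathbb N}$ are nonempty subsets of $I$ and $(K_n)_{n\in\mathbb N}$ nonempty subsets of $K$ with $I_0=I$, $K_0=K$, and, for every $n$, $\bigcup_{j=n}^{n+P}I_j=I$ and $\bigcup_{j=n}^{n+P}K_j=K$. Delays: $T\in\mathbb N$; for all $i\in I$, $k\in K$, $(\pi_i(n))_{n\in\mathbb N}$ and $(\omega_k(n))_{n\in\mathbb N}$ are sequences in $\mathbb N$ with $n-T\le\pi_i(n)\le n$ and $n-T\le\omega_k(n)\le n$ for every $n$. The function $\Xi\colon(0,+\infty)\times(0,+\infty)\times\mathbb R\times\mathbb R\to\mathbb R^2$ maps $(\Delta,\tau,\varsigma,\chi)$ (here $\chi$ is a dummy variable), with $\rho=\tau\varsigma-\chi^2$, to: $(1,\Delta/\tau)$ if $\rho=0$; $(0,(\Delta+\chi)/\tau)$ if $\rho\neq0$ and $\chi\Delta\geq\rho$; $(1-\chi\Delta/\rho,\ \varsigma\Delta/\rho)$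 if $\rho\neq 0$ and $\chi\Delta<\rho$. Algorithm B. For $n=0,1,\dots$: 1. For every $i\in I_n$, writing $\pi=\pi_i(n)$: $l_{i,n}^*=Q_ix_{i,\pi}+R_i\boldsymbol x_{\pi}+\sum_{k\in K}L_{ki}^*v_{k,\pi}^*$; $a_{i,n}=J_{\gamma_{i,\pi}A_i}\big(x_{i,\pi}+\gamma_{i,\pi}(s_i^*-l_{i,n}^*-C_ix_{i,\pi})\big)$; $a_{i,n}^*=\gamma_{i,\pi}^{-1}(x_{i,\pi}-a_{i,n})-l_{i,n}^*+Q_ia_{i,n}$; $\xi_{i,n}=\|a_{i,n}-x_{i,\pi}\|^2$. 2. For every $i\in I\smallsetminus I_n$: $a_{i,n}=a_{i,n-1}$, $a_{i,n}^*=a_{i,n-1}^*$, $\xi_{i,n}=\xi_{i,n-1}$. 3. For every $k\in K_n$, writing $\omega=\omega_k(n)$: $u_{k,n}^*=v_{k,\omega}^*-B_k^{\rm l}y_{k,\omega}$; $w_{k,n}^*=v_{k,\omega}^*-D_k^{\rm l}z_{k,\omega}$; $b_{k,n}=J_{\mu_{k,\omega}B_k^{\rm m}}\big(y_{k,\omega}+\mu_{k,\omega}(u_{k,n}^*-B_k^{\rm c}y_{k,\omega})\big)$; $d_{k,n}=J_{\nu_{k,\omega}D_k^{\rm m}}\big(z_{k,\omega}+\nu_{k,\omega}(w_{k,n}^*-D_k^{\rm c}z_{k,\omega})\big)$; $e_{k,n}^*=\sigma_{k,\omega}\big(\sum_{i\in I}L_{ki}x_{i,\omega}-y_{k,\omega}-z_{k,\omega}-r_k\big)+v_{k,\omega}^*$;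 $q_{k,n}^*=\mu_{k,\omega}^{-1}(y_{k,\omega}-b_{k,n})+u_{k,n}^*+B_k^{\rm l}b_{k,n}-e_{k,n}^*$; $t_{k,n}^*=\nu_{k,\omega}^{-1}(z_{k,\omega}-d_{k,n})+w_{k,n}^*+D_k^{\rm l}d_{k,n}-e_{k,n}^*$; $\eta_{k,n}=\|b_{k,n}-y_{k,\omega}\|^2+\|d_{k,n}-z_{k,\omega}\|^2$. 4. For every $k\in K\smallsetminus K_n$: $b_{k,n},d_{k,n},e_{k,n}^*,q_{k,n}^*,t_{k,n}^*,\eta_{k,n}$ are set equal to their values at index $n-1$. 5. For every $k\in K$: $e_{k,n}=r_k+b_{k,n}+d_{k,n}-\sum_{i\in I}L_{ki}a_{i,n}$. For every $i\in I$: $p_{i,n}^*=a_{i,n}^*+R_i\boldsymbol a_n+\sum_{k\in K}L_{ki}^*e_{k,n}^*$. 6. $\Delta_n=-(4\alpha)^{-1}\big(\sum_{i\in I}\xi_{i,n}+\sum_{k\in K}\eta_{k,n}\big)+\sum_{i\in I}\langle x_{i,n}-a_{i,n}\mid p_{i,n}^*\rangle+\sum_{k\in K}\big(\langle y_{k,n}-b_{k,n}\mid q_{k,n}^*\rangle+\langle z_{k,n}-d_{k,n}\mid t_{k,n}^*\rangle+\langle e_{k,n}\mid v_{k,n}^*-e_{k,n}^*\rangle\big)$. 7. If $\Delta_n>0$: $\tau_n=\sum_{i\in I}\|p_{i,n}^*\|^2+\sum_{k\in K}(\|q_{k,n}^*\|^2+\|t_{k,n}^*\|^2+\|e_{k,n}\|^2)$;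 $\varsigma_n=\sum_{i\in I}\|x_{i,0}-x_{i,n}\|^2+\sum_{k\in K}(\|y_{k,0}-y_{k,n}\|^2+\|z_{k,0}-z_{k,n}\|^2+\|v_{k,0}^*-v_{k,n}^*\|^2)$; $\chi_n=\sum_{i\in I}\langle x_{i,0}-x_{i,n}\mid p_{i,n}^*\rangle+\sum_{k\in K}(\langle y_{k,0}-y_{k,n}\mid q_{k,n}^*\rangle+\langle z_{k,0}-z_{k,n}\mid t_{k,n}^*\rangle+\langle e_{k,n}\mid v_{k,0}^*-v_{k,n}^*\rangle)$; $(\kappa_n,\lambda_n)=\Xi(\Delta_n,\tau_n,\varsigma_n,\chi_n)$; and, for all $i\in I$, $k\in K$, $x_{i,n+1}=(1-\kappa_n)x_{i,0}+\kappa_nx_{i,n}-\lambda_np_{i,n}^*$, $y_{k,n+1}=(1-\kappa_n)y_{k,0}+\kappa_ny_{k,n}-\lambda_nq_{k,n}^*$, $z_{k,n+1}=(1-\kappa_n)z_{k,0}+\kappa_nz_{k,n}-\lambda_nt_{k,n}^*$, $v_{k,n+1}^*=(1-\kappa_n)v_{k,0}^*+\kappa_nv_{k,n}^*-\lambda_ne_{k,n}$. Otherwise: $x_{i,n+1}=x_{i,n}$, $y_{k,n+1}=y_{k,n}$, $z_{k,n+1}=z_{k,n}$, $v_{k,n+1}^*=v_{k,n}^*$ for all $i\in I$, $k\in K$. *)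

theory Defs
  imports "HOL-Analysis.Analysis" "HOL-Library.Set_Algebras"
begin

text \<open>
  A finite family of real Hilbert spaces, possibly all different, is given by complete linear
  subspaces \<open>H i\<close> of one real inner product space \<open>'h\<close>. This is no restriction: any finite family
  of Hilbert spaces embeds isometrically in its Hilbert direct sum in this way. An element of the
  direct sum is a vector in \<open>'h ^ 'i\<close> with \<open>i\<close>-th component in \<open>H i\<close>; the inner product and norm
  of the library on \<open>'h ^ 'i\<close> are those of the Hilbert direct sum.
\<close>

definition hilbert_subspace :: "'a::real_inner set \<Rightarrow> bool" where
  "hilbert_subspace S \<longleftrightarrow> subspace S \<and> complete S"

definition direct_sum :: "('i::finite \<Rightarrow> 'a::real_inner set) \<Rightarrow> ('a ^ 'i) set" where
  "direct_sum H = {x. \<forall>i. x $ i \<in> H i}"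

text \<open>
  A set-valued operator on the Hilbert space \<open>S\<close> is a function \<open>'a \<Rightarrow> 'a set\<close> whose graph lies in
  \<open>S \<times> S\<close>; in particular it takes the value \<open>{}\<close> outside \<open>S\<close>. A single-valued map on \<open>S\<close> is a function
  on \<open>'a\<close> of which only the values on \<open>S\<close> matter.
\<close>

definition operator_on :: "'a set \<Rightarrow> ('a \<Rightarrow> 'a set) \<Rightarrow> bool" where
  "operator_on S A \<longleftrightarrow> (\<forall>x u. u \<in> A x \<longrightarrow> x \<in> S \<and> u \<in> S)"

definition monotone_operator :: "('a::real_inner \<Rightarrow> 'a set) \<Rightarrow> bool" where
  "monotone_operator A \<longleftrightarrow> (\<forall>x y. \<forall>u\<in>A x. \<forall>v\<in>A y. 0 \<le> inner (x - y) (u - v))"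

definition maximally_monotone_on :: "'a::real_inner set \<Rightarrow> ('a \<Rightarrow> 'a set) \<Rightarrow> bool" where
  "maximally_monotone_on S A \<longleftrightarrow>
     operator_on S A \<and> monotone_operator A \<and>
     (\<forall>B. operator_on S B \<and> monotone_operator B \<and> (\<forall>x. A x \<subseteq> B x) \<longrightarrow> B = A)"

definition set_inverse :: "('a \<Rightarrow> 'b set) \<Rightarrow> 'b \<Rightarrow> 'a set" where
  "set_inverse A u = {x. u \<in> A x}"

definition parallel_sum ::
    "('a::real_inner \<Rightarrow> 'a set) \<Rightarrow> ('a \<Rightarrow> 'a set) \<Rightarrow> 'a \<Rightarrow> 'a set" where
  "parallel_sum B D = set_inverse (\<lambda>u. set_inverse B u + set_inverse D u)"

definition scale_operator :: "real \<Rightarrow> ('a::real_inner \<Rightarrow> 'a set) \<Rightarrow> 'a \<Rightarrow> 'a set" where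
  "scale_operator c A x = (\<lambda>u. c *\<^sub>R u) ` A x"

text \<open>
  The resolvent is kept set-valued: for a maximally monotone operator it is single-valued, and
  \<open>p \<in> resolvent A x\<close> is then the equation \<open>p = J\<^sub>A x\<close>.
\<close>

definition resolvent :: "('a::real_inner \<Rightarrow> 'a set) \<Rightarrow> 'a \<Rightarrow> 'a set" where
  "resolvent A = set_inverse (\<lambda>x. {x} + A x)"

definition monotone_map_on :: "'a::real_inner set \<Rightarrow> ('a \<Rightarrow> 'a) \<Rightarrow> bool" where
  "monotone_map_on S Q \<longleftrightarrow> (\<forall>x\<in>S. \<forall>y\<in>S. 0 \<le> inner (x - y) (Q x - Q y))"

definition cocoercive_on :: "real \<Rightarrow> 'a::real_inner set \<Rightarrow> ('a \<Rightarrow> 'a) \<Rightarrow> bool" where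
  "cocoercive_on c S C \<longleftrightarrow>
     0 < c \<and> (\<forall>x\<in>S. \<forall>y\<in>S. inner (x - y) (C x - C y) \<ge> c * (norm (C x - C y))\<^sup>2)"

definition bounded_linear_between ::
    "'a::real_inner set \<Rightarrow> 'b::real_inner set \<Rightarrow> ('a \<Rightarrow> 'b) \<Rightarrow> bool" where
  "bounded_linear_between S T L \<longleftrightarrow>
     L \<in> S \<rightarrow> T \<and>
     (\<forall>x\<in>S. \<forall>y\<in>S. L (x + y) = L x + L y) \<and>
     (\<forall>c. \<forall>x\<in>S. L (c *\<^sub>R x) = c *\<^sub>R L x) \<and>
     (\<exists>M. \<forall>x\<in>S. norm (L x) \<le> M * norm x)"

text \<open>
  The adjoint of \<open>L\<close> as a map on the Hilbert space \<open>S\<close>. The library's \<open>adjoint\<close> does not apply: it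
  refers to the whole type instead of \<open>S\<close>. Existence and uniqueness of the described element are
  the Riesz representation theorem in \<open>S\<close>.
\<close>

definition adjoint_on ::
    "'a::real_inner set \<Rightarrow> ('a \<Rightarrow> 'b::real_inner) \<Rightarrow> 'b \<Rightarrow> 'a" where
  "adjoint_on S L v = (THE u. u \<in> S \<and> (\<forall>x\<in>S. inner (L x) v = inner x u))"

text \<open>The sum of a set-valued operator and two single-valued ones.\<close>

definition three_sum ::
    "('a::real_inner \<Rightarrow> 'a set) \<Rightarrow> ('a \<Rightarrow> 'a) \<Rightarrow> ('a \<Rightarrow> 'a) \<Rightarrow> 'a \<Rightarrow> 'a set" where
  "three_sum M C Q x = M x + {C x} + {Q x}"

text \<open>
  Below, sums of sets are Minkowski sums, in particular the sum over \<open>k\<close> in the primal inclusion.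
\<close>

definition primal_solution ::
  "('i::finite \<Rightarrow> 'h::real_inner set) \<Rightarrow> ('i \<Rightarrow> 'h) \<Rightarrow> ('k::finite \<Rightarrow> 'g::real_inner) \<Rightarrow>
   ('i \<Rightarrow> 'h \<Rightarrow> 'h set) \<Rightarrow> ('i \<Rightarrow> 'h \<Rightarrow> 'h) \<Rightarrow> ('i \<Rightarrow> 'h \<Rightarrow> 'h) \<Rightarrow> ('i \<Rightarrow> 'h ^ 'i \<Rightarrow> 'h) \<Rightarrow>
   ('k \<Rightarrow> 'g \<Rightarrow> 'g set) \<Rightarrow> ('k \<Rightarrow> 'g \<Rightarrow> 'g) \<Rightarrow> ('k \<Rightarrow> 'g \<Rightarrow> 'g) \<Rightarrow>
   ('k \<Rightarrow> 'g \<Rightarrow> 'g set) \<Rightarrow> ('k \<Rightarrow> 'g \<Rightarrow> 'g) \<Rightarrow> ('k \<Rightarrow> 'g \<Rightarrow> 'g) \<Rightarrow>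
   ('k \<Rightarrow> 'i \<Rightarrow> 'h \<Rightarrow> 'g) \<Rightarrow> 'h ^ 'i \<Rightarrow> bool" where
  "primal_solution H s r A C Q R Bm Bc Bl Dm Dc Dl L x \<longleftrightarrow>
     x \<in> direct_sum H \<and>
     (\<forall>i. s i \<in> A i (x $ i) + {C i (x $ i)} + {Q i (x $ i)} + {R i x} +
       (\<Sum>k\<in>UNIV. adjoint_on (H i) (L k i) `
          parallel_sum (three_sum (Bm k) (Bc k) (Bl k)) (three_sum (Dm k) (Dc k) (Dl k))
            ((\<Sum>j\<in>UNIV. L k j (x $ j)) - r k)))"

definition dual_solution ::
  "('i::finite \<Rightarrow> 'h::real_inner set) \<Rightarrow> ('k::finite \<Rightarrow> 'g::real_inner set) \<Rightarrow>
   ('i \<Rightarrow> 'h) \<Rightarrow> ('k \<Rightarrow> 'g) \<Rightarrow>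
   ('i \<Rightarrow> 'h \<Rightarrow> 'h set) \<Rightarrow> ('i \<Rightarrow> 'h \<Rightarrow> 'h) \<Rightarrow> ('i \<Rightarrow> 'h \<Rightarrow> 'h) \<Rightarrow> ('i \<Rightarrow> 'h ^ 'i \<Rightarrow> 'h) \<Rightarrow>
   ('k \<Rightarrow> 'g \<Rightarrow> 'g set) \<Rightarrow> ('k \<Rightarrow> 'g \<Rightarrow> 'g) \<Rightarrow> ('k \<Rightarrow> 'g \<Rightarrow> 'g) \<Rightarrow>
   ('k \<Rightarrow> 'g \<Rightarrow> 'g set) \<Rightarrow> ('k \<Rightarrow> 'g \<Rightarrow> 'g) \<Rightarrow> ('k \<Rightarrow> 'g \<Rightarrow> 'g) \<Rightarrow>
   ('k \<Rightarrow> 'i \<Rightarrow> 'h \<Rightarrow> 'g) \<Rightarrow> 'g ^ 'k \<Rightarrow> bool" where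
  "dual_solution H G s r A C Q R Bm Bc Bl Dm Dc Dl L v \<longleftrightarrow>
     v \<in> direct_sum G \<and>
     (\<exists>x\<in>direct_sum H.
        (\<forall>i. s i - (\<Sum>k\<in>UNIV. adjoint_on (H i) (L k i) (v $ k))
               \<in> A i (x $ i) + {C i (x $ i)} + {Q i (x $ i)} + {R i x}) \<and>
        (\<forall>k. v $ k \<in>
           parallel_sum (three_sum (Bm k) (Bc k) (Bl k)) (three_sum (Dm k) (Dc k) (Dl k))
             ((\<Sum>j\<in>UNIV. L k j (x $ j)) - r k)))"

definition kuhn_tucker_set ::
  "('i::finite \<Rightarrow> 'h::real_inner set) \<Rightarrow> ('k::finite \<Rightarrow> 'g::real_inner set) \<Rightarrow>
   ('i \<Rightarrow> 'h) \<Rightarrow> ('k \<Rightarrow> 'g) \<Rightarrow>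
   ('i \<Rightarrow> 'h \<Rightarrow> 'h set) \<Rightarrow> ('i \<Rightarrow> 'h \<Rightarrow> 'h) \<Rightarrow> ('i \<Rightarrow> 'h \<Rightarrow> 'h) \<Rightarrow> ('i \<Rightarrow> 'h ^ 'i \<Rightarrow> 'h) \<Rightarrow>
   ('k \<Rightarrow> 'g \<Rightarrow> 'g set) \<Rightarrow> ('k \<Rightarrow> 'g \<Rightarrow> 'g) \<Rightarrow> ('k \<Rightarrow> 'g \<Rightarrow> 'g) \<Rightarrow>
   ('k \<Rightarrow> 'g \<Rightarrow> 'g set) \<Rightarrow> ('k \<Rightarrow> 'g \<Rightarrow> 'g) \<Rightarrow> ('k \<Rightarrow> 'g \<Rightarrow> 'g) \<Rightarrow>
   ('k \<Rightarrow> 'i \<Rightarrow> 'h \<Rightarrow> 'g) \<Rightarrow> (('h ^ 'i) \<times> ('g ^ 'k)) set" where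
  "kuhn_tucker_set H G s r A C Q R Bm Bc Bl Dm Dc Dl L =
     {(x, v). x \<in> direct_sum H \<and> v \<in> direct_sum G \<and>
        (\<forall>i. s i - (\<Sum>k\<in>UNIV. adjoint_on (H i) (L k i) (v $ k))
               \<in> A i (x $ i) + {C i (x $ i)} + {Q i (x $ i)} + {R i x}) \<and>
        (\<forall>k. (\<Sum>j\<in>UNIV. L k j (x $ j)) - r k
               \<in> set_inverse (three_sum (Bm k) (Bc k) (Bl k)) (v $ k) +
                 set_inverse (three_sum (Dm k) (Dc k) (Dl k)) (v $ k))}"

definition Xi :: "real \<Rightarrow> real \<Rightarrow> real \<Rightarrow> real \<Rightarrow> real \<times> real" where
  "Xi \<Delta> \<tau> \<sigma> c =
     (let \<rho> = \<tau> * \<sigma> - c\<^sup>2 in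
      if \<rho> = 0 then (1, \<Delta> / \<tau>)
      else if c * \<Delta> \<ge> \<rho> then (0, (\<Delta> + c) / \<tau>)
      else (1 - c * \<Delta> / \<rho>, \<sigma> * \<Delta> / \<rho>))"

end

theory Submission
  imports Defs
begin

text \<open>
  In the product of the primal spaces and three copies of the dual spaces, consider the saddle
  operator \<open>M + B + C\<close> of a vector \<open>(x, y, z, v)\<close>: \<open>M\<close> is the product of the operators \<open>A i\<close>,
  \<open>Bm k\<close>, \<open>Dm k\<close> and 0, the map \<open>B\<close> collects the Lipschitzian monotone maps and the coupling
  through \<open>L\<close> and its adjoints, which is skew, and \<open>C\<close> collects the cocoercive maps. Its zeros are
  exactly the Kuhn--Tucker points together with a splitting \<open>y + z\<close> of the argument of the parallel
  sums (lemmas \<open>saddle_zero_imp_solutions\<close>, \<open>dual_solution_imp_saddle_zero\<close>).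

  When a value that is kept over several steps is traced back to its last update, a step of the
  algorithm becomes the following. There are a point \<open>a\<close> and a delayed version \<open>X'\<close> of the
  iterate \<open>X n\<close> such that \<open>g \<in> M a + B a + C X'\<close>. Monotonicity and cocoercivity put every zero into
  the half-space \<open>{h. \<Delta> n \<le> inner (X n - h) g}\<close> (lemma \<open>halfspace\<close>), and \<open>X (Suc n)\<close> is the
  projection of \<open>X 0\<close> onto the intersection of this half-space with the one that has \<open>X n\<close> as its
  projection of \<open>X 0\<close> (lemma \<open>Xi_update\<close>). Hence the distances to \<open>X 0\<close> increase, remain bounded by
  the distance to any zero, and the squared step lengths are summable.

  Since the steps tend to zero, bounded delays disappear in the limit, and up to a null sequence
  \<open>g = N X - N a\<close>, where \<open>N\<close> is the diagonal map of inverse step sizes minus \<open>B\<close>. The step size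
  bounds make \<open>N\<close> strongly monotone with a margin that covers \<open>C\<close>. Since also \<open>\<Delta> n\<close> is at most the
  step length times \<open>norm g\<close>, both \<open>X n - a\<close> and \<open>g\<close> tend to zero (lemma \<open>gap_null\<close>).

  Weak cluster points of the iterates are therefore zeros. The key is \<open>weak_demiclosed_sum\<close>: a
  pseudomonotonicity argument passes to the weak limit in \<open>M\<close> and in \<open>B + C\<close> separately, without
  maximal monotonicity of the sum. Finally a cluster point is no farther from \<open>X 0\<close> than any zero, and
  the iterates converge to it in norm as well, hence strongly (theorem \<open>strong_convergence\<close>).
  Weak compactness is Tychonoff's theorem combined with the Riesz representation theorem; finer
  filters replace subsequences.
\<close>

section \<open>Riesz representation and weak cluster points\<close>

text \<open>
  The representing vector is the minimiser over \<open>S\<close> of \<open>(norm x)\<^sup>2 / 2 - \<phi> x\<close>: by the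
  parallelogram law a minimising sequence is Cauchy, and the first-order condition at its limit is
  the claim.
\<close>

lemma riesz_on:
  fixes \<phi> :: "'a::real_inner \<Rightarrow> real"
  assumes S: "hilbert_subspace S"
    and add: "\<And>x y. x \<in> S \<Longrightarrow> y \<in> S \<Longrightarrow> \<phi> (x + y) = \<phi> x + \<phi> y"
    and scale: "\<And>c x. x \<in> S \<Longrightarrow> \<phi> (c *\<^sub>R x) = c * \<phi> x"
    and bounded: "\<And>x. x \<in> S \<Longrightarrow> \<bar>\<phi> x\<bar> \<le> M * norm x"
  obtains u where "u \<in> S" "\<And>x. x \<in> S \<Longrightarrow> \<phi> x = inner x u"
proof -
  have sub: "subspace S" and compl: "complete S"
    using S by (auto simp: hilbert_subspace_def)
  define J where "J x = (norm x)\<^sup>2 / 2 - \<phi> x" for x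
  have diff: "\<phi> (x - y) = \<phi> x - \<phi> y" if "x \<in> S" "y \<in> S" for x y
    using add[OF that(1), of "-1 *\<^sub>R y"] scale[OF that(2), of "-1"] subspace_scale[OF sub that(2), of "-1"]
    by simp
  have J_lower: "- M\<^sup>2 / 2 \<le> J x" if "x \<in> S" for x
  proof -
    have "0 \<le> (norm x - M)\<^sup>2" by simp
    then have "M * norm x \<le> (norm x)\<^sup>2 / 2 + M\<^sup>2 / 2"
      by (simp add: power2_diff algebra_simps)
    then show ?thesis using bounded[OF that] by (simp add: J_def)
  qed
  define m where "m = (INF x\<in>S. J x)"
  have bdd: "bdd_below (J ` S)" using J_lower by (auto simp: bdd_below_def)
  have ne: "S \<noteq> {}" using sub subspace_0 by blast
  have m_le: "m \<le> J x" if "x \<in> S" for x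
    unfolding m_def using bdd that by (rule cINF_lower)
  have "\<exists>x\<in>S. J x < m + 1 / real (Suc n)" for n
    using cINF_less_iff[OF ne bdd, of "m + 1 / real (Suc n)"] by (simp add: m_def)
  then obtain w where w: "\<And>n. w n \<in> S" "\<And>n. J (w n) < m + 1 / real (Suc n)"
    by metis
  have gap: "(norm (x - y))\<^sup>2 \<le> 4 * J x + 4 * J y - 8 * m" if "x \<in> S" "y \<in> S" for x y
  proof -
    have mid: "(1/2) *\<^sub>R (x + y) \<in> S" using sub that by (simp add: subspace_add subspace_scale)
    have "\<phi> ((1/2) *\<^sub>R (x + y)) = (\<phi> x + \<phi> y) / 2"
      using that by (simp add: scale add subspace_add[OF sub] del: scaleR_add_right)
    moreover have "(norm ((1/2) *\<^sub>R (x + y)))\<^sup>2 = (norm x)\<^sup>2 / 2 + (norm y)\<^sup>2 / 2 - (norm (x - y))\<^sup>2 / 4"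
      by (simp add: power2_norm_eq_inner inner_add inner_diff inner_commute power_mult_distrib power_divide field_simps)
    ultimately have "J ((1/2) *\<^sub>R (x + y)) = (J x + J y) / 2 - (norm (x - y))\<^sup>2 / 8"
      unfolding J_def by (simp add: field_simps)
    then show ?thesis using m_le[OF mid] by (simp add: field_simps)
  qed
  have "Cauchy w"
    unfolding Cauchy_def dist_norm
  proof (intro allI impI)
    fix e :: real assume "e > 0"
    then obtain N where N: "1 / real (Suc N) < e\<^sup>2 / 8"
      using reals_Archimedean[of "e\<^sup>2 / 8"] by (auto simp: inverse_eq_divide)
    have "norm (w p - w q) < e" if "p \<ge> N" "q \<ge> N" for p q
    proof -
      have "1 / real (Suc p) \<le> 1 / real (Suc N)" "1 / real (Suc q) \<le> 1 / real (Suc N)"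
        using that by (simp_all add: frac_le)
      then have "(norm (w p - w q))\<^sup>2 < e\<^sup>2"
        using gap[OF w(1) w(1), of p q] w(2)[of p] w(2)[of q] N by linarith
      then show ?thesis using \<open>e > 0\<close> by (simp add: power_less_imp_less_base)
    qed
    then show "\<exists>N. \<forall>p\<ge>N. \<forall>q\<ge>N. norm (w p - w q) < e" by blast
  qed
  then obtain u where u: "u \<in> S" "w \<longlonglongrightarrow> u"
    using compl w(1) by (auto simp: complete_def)
  have "(\<lambda>n. \<phi> (w n - u)) \<longlonglongrightarrow> 0"
  proof (rule Lim_null_comparison)
    show "\<forall>\<^sub>F n in sequentially. norm (\<phi> (w n - u)) \<le> M * norm (w n - u)"
      using bounded subspace_diff[OF sub] w(1) u(1) by (auto intro!: always_eventually)
    show "(\<lambda>n. M * norm (w n - u)) \<longlonglongrightarrow> 0"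
      using u(2) by (auto intro!: tendsto_eq_intros)
  qed
  then have "(\<lambda>n. \<phi> (w n - u) + \<phi> u) \<longlonglongrightarrow> 0 + \<phi> u" by (intro tendsto_intros)
  then have "(\<lambda>n. \<phi> (w n)) \<longlonglongrightarrow> \<phi> u" using diff w(1) u(1) by simp
  then have "(\<lambda>n. J (w n)) \<longlonglongrightarrow> J u" unfolding J_def using u(2) by (intro tendsto_intros) auto
  moreover have "(\<lambda>n. m + 1 / real (Suc n)) \<longlonglongrightarrow> m + 0"
    by (intro tendsto_intros LIMSEQ_Suc lim_1_over_n)
  ultimately have "J u \<le> m + 0"
    by (rule LIMSEQ_le) (use w(2) less_imp_le in blast)
  then have J_min: "J u \<le> m" by simp
  have "\<phi> h = inner h u" if h: "h \<in> S" for h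
  proof -
    have *: "t * (inner h u - \<phi> h) + t\<^sup>2 * (norm h)\<^sup>2 / 2 \<ge> 0" for t :: real
    proof -
      have "u + t *\<^sub>R h \<in> S" using sub u(1) h by (simp add: subspace_add subspace_scale)
      then have "J u \<le> J (u + t *\<^sub>R h)" using J_min m_le by force
      moreover have "(norm (u + t *\<^sub>R h))\<^sup>2 = (norm u)\<^sup>2 + 2 * (t * inner h u) + t\<^sup>2 * (norm h)\<^sup>2"
        by (simp only: power2_norm_eq_inner)
          (simp add: inner_add inner_commute power2_eq_square algebra_simps)
      moreover have "\<phi> (u + t *\<^sub>R h) = \<phi> u + t * \<phi> h"
        using u(1) h by (simp add: scale add subspace_scale[OF sub])
      ultimately show ?thesis unfolding J_def by (simp add: algebra_simps)
    qed
    \<comment> \<open>The quadratic in \<open>t\<close> is tested at the minimiser \<open>- c / q\<close> of a majorant; adding 1 in \<open>q\<close>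
      avoids a case distinction on \<open>h = 0\<close>.\<close>
    define c where "c = inner h u - \<phi> h"
    define q where "q = (norm h)\<^sup>2 + 1"
    have "q > 0" by (simp add: q_def add_nonneg_pos)
    have "(- c / q) * c + (- c / q)\<^sup>2 * q / 2 \<ge> (- c / q) * c + (- c / q)\<^sup>2 * (norm h)\<^sup>2 / 2"
      by (simp add: q_def mult_left_mono)
    with *[of "- c / q"] have "(- c / q) * c + (- c / q)\<^sup>2 * q / 2 \<ge> 0" unfolding c_def by linarith
    then have "- (c\<^sup>2) / (2 * q) \<ge> 0" using \<open>q > 0\<close> by (simp add: power2_eq_square field_simps)
    then have "c = 0" using \<open>q > 0\<close> by (simp add: divide_le_0_iff zero_le_divide_iff)
    then show ?thesis by (simp add: c_def)
  qed
  with u(1) show ?thesis using that by blast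
qed

text \<open>
  Weak convergence in the Hilbert space \<open>S\<close>, tested against \<open>S\<close> only, along an arbitrary filter:
  finer filters take the place of subsequences.
\<close>

definition weak_limit_on :: "'a::real_inner set \<Rightarrow> ('b \<Rightarrow> 'a) \<Rightarrow> 'a \<Rightarrow> 'b filter \<Rightarrow> bool" where
  "weak_limit_on S X u F \<longleftrightarrow> u \<in> S \<and> (\<forall>h\<in>S. ((\<lambda>n. inner (X n) h) \<longlongrightarrow> inner u h) F)"

lemma weak_limit_on_mono:
  "weak_limit_on S X u F \<Longrightarrow> F' \<le> F \<Longrightarrow> weak_limit_on S X u F'"
  unfolding weak_limit_on_def using tendsto_mono by blast

lemma weak_limit_on_diff_null:
  assumes "weak_limit_on S X u F" "((\<lambda>n. X n - Y n) \<longlongrightarrow> 0) F"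
  shows "weak_limit_on S Y u F"
  unfolding weak_limit_on_def
proof (intro conjI ballI)
  show "u \<in> S" using assms(1) by (simp add: weak_limit_on_def)
  fix h assume "h \<in> S"
  then have "((\<lambda>n. inner (X n) h - inner (X n - Y n) h) \<longlongrightarrow> inner u h - inner 0 h) F"
    using assms(1) by (intro tendsto_diff tendsto_inner[OF assms(2) tendsto_const])
      (auto simp: weak_limit_on_def)
  then show "((\<lambda>n. inner (Y n) h) \<longlongrightarrow> inner u h) F" by (simp add: inner_diff_left)
qed

text \<open>
  Weak compactness of bounded sets. The functionals \<open>inner (X n)\<close> live in a product of compact
  intervals, which is compact by Tychonoff; a cluster point there is a bounded linear functional,
  hence given by a vector of \<open>S\<close> by the Riesz representation.
\<close>

lemma weak_cluster_point_exists:
  fixes X :: "'b \<Rightarrow> 'a::real_inner"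
  assumes S: "hilbert_subspace S" and X: "\<And>n. X n \<in> S" "\<And>n. norm (X n) \<le> M"
    and F: "F \<noteq> bot"
  obtains F' u where "F' \<le> F" "F' \<noteq> bot" "weak_limit_on S X u F'"
proof -
  define E where "E n = (\<lambda>h. inner (X n) h)" for n
  define K where "K = PiE UNIV (\<lambda>h::'a. {- M * norm h .. M * norm h})"
  have "compactin (product_topology (\<lambda>_. euclidean) UNIV) K"
    unfolding K_def compactin_PiE by simp
  then have "compact K" by (simp add: euclidean_product_topology)
  moreover have "E n \<in> K" for n
  proof -
    have "\<bar>inner (X n) h\<bar> \<le> M * norm h" for h
      using Cauchy_Schwarz_ineq2[of "X n" h] mult_right_mono[OF X(2)[of n], of "norm h"] by simp
    then show ?thesis by (auto simp: K_def E_def abs_le_iff minus_le_iff)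
  qed
  then have "eventually (\<lambda>f. f \<in> K) (filtermap E F)" by (simp add: eventually_filtermap)
  moreover have "filtermap E F \<noteq> bot" using F by (simp add: filtermap_bot_iff)
  ultimately obtain \<phi> where \<phi>: "\<phi> \<in> K" "inf (nhds \<phi>) (filtermap E F) \<noteq> bot"
    unfolding compact_filter by blast
  define F' where "F' = inf F (filtercomap E (nhds \<phi>))"
  have "F' \<noteq> bot"
  proof
    assume "F' = bot"
    then obtain P Q where PQ: "eventually P F" "eventually Q (nhds \<phi>)" "\<And>n. P n \<Longrightarrow> Q (E n) \<Longrightarrow> False"
      unfolding F'_def trivial_limit_def eventually_inf eventually_filtercomap by blast
    have "eventually (\<lambda>f. \<not> Q f) (filtermap E F)"
      unfolding eventually_filtermap using PQ(1) by eventually_elim (use PQ(3) in blast)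
    with PQ(2) have "eventually (\<lambda>_. False) (inf (nhds \<phi>) (filtermap E F))"
      unfolding eventually_inf by blast
    with \<phi>(2) show False by (simp add: trivial_limit_def)
  qed
  have lim_E: "(E \<longlongrightarrow> \<phi>) F'"
    by (simp add: F'_def filterlim_def filtermap_le_iff_le_filtercomap le_infI2)
  have lim: "((\<lambda>n. inner (X n) h) \<longlongrightarrow> \<phi> h) F'" for h
  proof -
    have "((\<lambda>f :: 'a \<Rightarrow> real. f h) \<longlongrightarrow> \<phi> h) (nhds \<phi>)"
    proof (rule topological_tendstoI)
      fix V :: "real set" assume V: "open V" "\<phi> h \<in> V"
      have "open ((\<lambda>f :: 'a \<Rightarrow> real. f h) -` V)"
        using open_vimage[OF V(1) continuous_on_product_coordinates] .
      then have "eventually (\<lambda>f. f \<in> (\<lambda>f :: 'a \<Rightarrow> real. f h) -` V) (nhds \<phi>)"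
        by (rule eventually_nhds_in_open) (use V in simp)
      then show "eventually (\<lambda>f. f h \<in> V) (nhds \<phi>)" by simp
    qed
    from filterlim_compose[OF this lim_E] show ?thesis by (simp add: E_def)
  qed
  have uniq: "p = q" if "(f \<longlongrightarrow> p) F'" "(f \<longlongrightarrow> q) F'" for f :: "'b \<Rightarrow> real" and p q
    using tendsto_unique \<open>F' \<noteq> bot\<close> that by blast
  have "\<phi> (x + y) = \<phi> x + \<phi> y" for x y
    using tendsto_add[OF lim[of x] lim[of y]] lim[of "x + y"] by (auto simp: inner_add_right intro: uniq)
  moreover have "\<phi> (c *\<^sub>R x) = c * \<phi> x" for c x
    using tendsto_mult_left[OF lim[of x], of c] lim[of "c *\<^sub>R x"] by (auto intro: uniq)
  moreover have "\<bar>\<phi> x\<bar> \<le> M * norm x" for x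
    using \<phi>(1) by (auto simp: K_def PiE_def Pi_def abs_le_iff minus_le_iff)
  ultimately obtain u where "u \<in> S" "\<And>x. x \<in> S \<Longrightarrow> \<phi> x = inner x u"
    using riesz_on[OF S, of \<phi> M] by blast
  then have "weak_limit_on S X u F'"
    unfolding weak_limit_on_def using lim by (metis inner_commute)
  moreover have "F' \<le> F" by (simp add: F'_def)
  ultimately show ?thesis using \<open>F' \<noteq> bot\<close> that by blast
qed

section \<open>Haugazeau's iteration\<close>

text \<open>
  The function \<open>Xi\<close> is Haugazeau's closed formula for the projection of \<open>x0\<close> onto the intersection
  of the half-spaces \<open>{h. inner (h - xn) (x0 - xn) \<le> 0}\<close> and \<open>{h. \<Delta> \<le> inner (xn - h) g}\<close>. The
  first two conclusions say that \<open>xn'\<close> lies in both, the third is the variational inequality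
  that characterises the projection. Unless the normals \<open>x0 - xn\<close> and \<open>g\<close> are parallel,
  \<open>x0 - xn'\<close> is a nonnegative combination of them with complementary slackness; if they are
  parallel, the half-space of \<open>g\<close> is the smaller one. The point \<open>h0\<close> of the intersection excludes \<open>g = 0\<close> and, when
  the normals are parallel, that they point in opposite directions.
\<close>

lemma Xi_update:
  fixes x0 xn g :: "'a::real_inner"
  assumes \<Delta>: "\<Delta> > 0"
    and upd: "(\<kappa>, l) = Xi \<Delta> ((norm g)\<^sup>2) ((norm (x0 - xn))\<^sup>2) (inner (x0 - xn) g)"
      "xn' = (1 - \<kappa>) *\<^sub>R x0 + \<kappa> *\<^sub>R xn - l *\<^sub>R g"
    and h0: "inner (h0 - xn) (x0 - xn) \<le> 0" "\<Delta> \<le> inner (xn - h0) g"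
  shows "\<Delta> \<le> inner (xn - xn') g" (is ?A)
    and "inner (xn' - xn) (x0 - xn) \<le> 0" (is ?B)
    and "\<And>h. inner (h - xn) (x0 - xn) \<le> 0 \<Longrightarrow> \<Delta> \<le> inner (xn - h) g \<Longrightarrow> inner (h - xn') (x0 - xn') \<le> 0"
proof -
  define w where "w = x0 - xn"
  define t where "t = inner g g"
  define q where "q = inner w w"
  define c where "c = inner w g"
  define \<rho> where "\<rho> = t * q - c\<^sup>2"
  have "g \<noteq> 0" using \<Delta> h0(2) by auto
  then have t: "t > 0" by (simp add: t_def)
  have q: "q \<ge> 0" by (simp add: q_def)
  have \<rho>: "\<rho> \<ge> 0"
    using Cauchy_Schwarz_ineq[of w g] by (simp add: \<rho>_def t_def q_def c_def mult.commute)
  have norms: "(norm g)\<^sup>2 = t" "(norm (x0 - xn))\<^sup>2 = q" "inner (x0 - xn) g = c"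
    by (simp_all add: power2_norm_eq_inner t_def q_def c_def w_def)
  have xn': "xn - xn' = (\<kappa> - 1) *\<^sub>R w + l *\<^sub>R g" and x0': "x0 - xn' = \<kappa> *\<^sub>R w + l *\<^sub>R g"
    unfolding upd(2) w_def by (simp_all add: algebra_simps)
  have A_eq: "inner (xn - xn') g = (\<kappa> - 1) * c + l * t"
    by (simp add: xn' inner_add_left c_def t_def)
  have B_eq: "inner (xn' - xn) w = (1 - \<kappa>) * q - l * c"
  proof -
    have "xn' - xn = (1 - \<kappa>) *\<^sub>R w - l *\<^sub>R g"
      unfolding upd(2) w_def by (simp add: algebra_simps)
    then show ?thesis
      by (simp only: inner_diff_left[of "_ *\<^sub>R w"] inner_scaleR_left c_def q_def inner_commute[of g w])
  qed
  have C_eq: "inner (h - xn') (x0 - xn') =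
      \<kappa> * (inner (h - xn) w - inner (xn' - xn) w) + l * (inner (xn - xn') g - inner (xn - h) g)" for h
    unfolding x0' by (simp add: inner_add_right inner_diff_left algebra_simps)
  have pars: "(\<kappa>, l) = (if \<rho> = 0 then (1, \<Delta> / t) else if c * \<Delta> \<ge> \<rho> then (0, (\<Delta> + c) / t)
      else (1 - c * \<Delta> / \<rho>, q * \<Delta> / \<rho>))"
    using upd(1) unfolding norms Xi_def Let_def \<rho>_def .
  \<comment> \<open>\<open>\<rho>\<close> is the Gram determinant of the normals: they are parallel, or only the half-space of
    \<open>g\<close> is active, or both are active.\<close>
  consider (deg) "\<rho> = 0" | (drop) "\<rho> > 0" "c * \<Delta> \<ge> \<rho>" | (both) "\<rho> > 0" "c * \<Delta> < \<rho>"
    using \<rho> by linarith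
  then have "inner (xn - xn') g = \<Delta> \<and> \<kappa> \<ge> 0 \<and> l \<ge> 0 \<and> inner (xn' - xn) w \<le> 0 \<and>
      (\<kappa> = 0 \<or> inner (xn' - xn) w = 0 \<or> w = (c / t) *\<^sub>R g \<and> c \<ge> 0 \<and> \<kappa> = 1 \<and> l = \<Delta> / t)"
  proof cases
    case deg
    then have kl: "\<kappa> = 1" "l = \<Delta> / t" using pars by auto
    have "inner (w - (c / t) *\<^sub>R g) (w - (c / t) *\<^sub>R g) = q - c\<^sup>2 / t"
      using t by (simp add: inner_diff inner_commute[of g w] q_def[symmetric] c_def[symmetric] t_def[symmetric]
          power2_eq_square field_simps)
    also have "\<dots> = 0" using deg t by (simp add: \<rho>_def field_simps)
    finally have w_eq: "w = (c / t) *\<^sub>R g" by simp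
    have "c \<ge> 0"
    proof (rule ccontr)
      assume "\<not> c \<ge> 0"
      then have "c / t < 0" using t by (simp add: divide_neg_pos)
      have "(c / t) * inner (h0 - xn) g \<le> 0" using h0(1) unfolding w_def[symmetric]
        by (subst (asm) w_eq) simp
      then have "inner (h0 - xn) g \<ge> 0"
        using \<open>c / t < 0\<close> unfolding mult_le_0_iff by linarith
      then show False using h0(2) \<Delta> by (simp add: inner_diff_left)
    qed
    then have "inner (xn' - xn) w \<le> 0" unfolding B_eq using kl t \<Delta> by simp
    then show ?thesis using w_eq kl t \<Delta> \<open>c \<ge> 0\<close> A_eq by simp
  next
    case drop
    then have kl: "\<kappa> = 0" "l = (\<Delta> + c) / t" using pars by auto
    have "c * \<Delta> > 0" using drop by linarith
    then have "c > 0" using \<Delta> by (simp add: zero_less_mult_iff)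
    have "q * t \<le> \<Delta> * c + c\<^sup>2" using drop(2) by (simp add: \<rho>_def algebra_simps)
    then have "q - l * c \<le> 0" using t by (simp add: kl field_simps power2_eq_square)
    then show ?thesis using kl t \<Delta> \<open>c > 0\<close> by (simp add: A_eq B_eq)
  next
    case both
    then have kl: "\<kappa> = 1 - c * \<Delta> / \<rho>" "l = q * \<Delta> / \<rho>" using pars by auto
    have "(\<kappa> - 1) * c + l * t = \<Delta> * (t * q - c\<^sup>2) / \<rho>"
      by (simp add: kl power2_eq_square field_simps diff_divide_distrib)
    also have "\<dots> = \<Delta>" using both(1) by (simp add: \<rho>_def[symmetric])
    finally have "inner (xn - xn') g = \<Delta>" by (simp add: A_eq)
    moreover have "inner (xn' - xn) w = 0" by (simp add: B_eq kl)
    moreover have "\<kappa> \<ge> 0" "l \<ge> 0" using both \<Delta> q by (simp_all add: kl)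
    ultimately show ?thesis by simp
  qed
  note facts = this
  show ?A using facts by simp
  show ?B using facts by (simp add: w_def)
  show "inner (h - xn') (x0 - xn') \<le> 0"
    if h: "inner (h - xn) (x0 - xn) \<le> 0" "\<Delta> \<le> inner (xn - h) g" for h
  proof -
    have l: "l * (inner (xn - xn') g - inner (xn - h) g) \<le> 0"
      using facts h(2) by (intro mult_nonneg_nonpos) auto
    consider "\<kappa> = 0 \<or> inner (xn' - xn) w = 0" | (deg) "w = (c / t) *\<^sub>R g" "c \<ge> 0"
      using facts by blast
    then have "\<kappa> * (inner (h - xn) w - inner (xn' - xn) w) \<le> 0"
    proof cases
      case 1
      then show ?thesis using facts h(1) by (auto simp: w_def[symmetric] mult_le_0_iff)
    next
      case deg
      have "inner (h - xn) w - inner (xn' - xn) w = inner (h - xn') w"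
        by (simp add: inner_diff_left)
      also have "\<dots> = (c / t) * (inner (xn - xn') g - inner (xn - h) g)"
        by (subst deg(1)) (simp add: inner_diff_left algebra_simps)
      also have "\<dots> \<le> 0"
        using facts h(2) deg(2) t by (intro mult_nonneg_nonpos) auto
      finally show ?thesis using facts by (simp add: mult_nonneg_nonpos)
    qed
    with l show ?thesis unfolding C_eq by linarith
  qed
qed

lemma norm_diff_square:
  "(norm (p - q :: 'a::real_inner))\<^sup>2 = (norm q)\<^sup>2 - 2 * inner q p + (norm p)\<^sup>2"
  by (simp add: power2_norm_eq_inner inner_diff inner_commute)

text \<open>
  Haugazeau's iteration: each point is the projection of the starting point \<open>X 0\<close> onto the
  intersection of two half-spaces that contain \<open>K\<close>.
\<close>

locale haugazeau =
  fixes X g :: "nat \<Rightarrow> 'a::real_inner" and \<Delta> :: "nat \<Rightarrow> real" and K :: "'a set"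
  assumes K: "K = {h. \<forall>n. \<Delta> n \<le> inner (X n - h) (g n)}" and K_nonempty: "K \<noteq> {}"
    and step: "\<And>n. \<Delta> n > 0 \<Longrightarrow> \<exists>\<kappa> l.
        (\<kappa>, l) = Xi (\<Delta> n) ((norm (g n))\<^sup>2) ((norm (X 0 - X n))\<^sup>2) (inner (X 0 - X n) (g n)) \<and>
        X (Suc n) = (1 - \<kappa>) *\<^sub>R X 0 + \<kappa> *\<^sub>R X n - l *\<^sub>R g n"
    and idle: "\<And>n. \<not> \<Delta> n > 0 \<Longrightarrow> X (Suc n) = X n"
begin

lemma inner_anchor: "h \<in> K \<Longrightarrow> inner (h - X n) (X 0 - X n) \<le> 0"
proof (induction n arbitrary: h)
  case (Suc n)
  show ?case
  proof (cases "\<Delta> n > 0")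
    case True
    then obtain \<kappa> l where
      "(\<kappa>, l) = Xi (\<Delta> n) ((norm (g n))\<^sup>2) ((norm (X 0 - X n))\<^sup>2) (inner (X 0 - X n) (g n))"
      "X (Suc n) = (1 - \<kappa>) *\<^sub>R X 0 + \<kappa> *\<^sub>R X n - l *\<^sub>R g n"
      using step by blast
    from Xi_update(3)[OF True this, of h h] Suc K show ?thesis by blast
  next
    case False
    then show ?thesis using Suc idle by simp
  qed
qed simp

lemma step_facts:
  shows "\<Delta> n \<le> norm (X (Suc n) - X n) * norm (g n)"
    and "inner (X (Suc n) - X n) (X 0 - X n) \<le> 0"
proof -
  obtain h where h: "h \<in> K" using K_nonempty by blast
  have "\<Delta> n \<le> inner (X n - X (Suc n)) (g n) \<and> inner (X (Suc n) - X n) (X 0 - X n) \<le> 0" if "\<Delta> n > 0"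
  proof -
    from step[OF that] obtain \<kappa> l where
      "(\<kappa>, l) = Xi (\<Delta> n) ((norm (g n))\<^sup>2) ((norm (X 0 - X n))\<^sup>2) (inner (X 0 - X n) (g n))"
      "X (Suc n) = (1 - \<kappa>) *\<^sub>R X 0 + \<kappa> *\<^sub>R X n - l *\<^sub>R g n"
      by blast
    from Xi_update(1,2)[OF that this inner_anchor[OF h]] h K show ?thesis by blast
  qed
  moreover have "inner (X n - X (Suc n)) (g n) \<le> norm (X (Suc n) - X n) * norm (g n)"
    using norm_cauchy_schwarz[of "X n - X (Suc n)" "g n"] by (simp add: norm_minus_commute)
  ultimately show "\<Delta> n \<le> norm (X (Suc n) - X n) * norm (g n)"
    by (cases "\<Delta> n > 0") (auto intro: order_trans[of _ 0])
  show "inner (X (Suc n) - X n) (X 0 - X n) \<le> 0"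
    using \<open>\<Delta> n > 0 \<Longrightarrow> _\<close> idle[of n] by (cases "\<Delta> n > 0") auto
qed

lemma norm_anchor_le:
  assumes "h \<in> K" shows "norm (X 0 - X n) \<le> norm (X 0 - h)"
proof (cases "X 0 = X n")
  case False
  have "inner (X 0 - X n) (X 0 - X n) = inner (X 0 - h) (X 0 - X n) + inner (h - X n) (X 0 - X n)"
    by (simp add: inner_diff_left)
  also have "\<dots> \<le> norm (X 0 - h) * norm (X 0 - X n)"
    using inner_anchor[OF assms, of n] norm_cauchy_schwarz[of "X 0 - h" "X 0 - X n"] by linarith
  finally show ?thesis using False by (simp add: power2_norm_eq_inner[symmetric] power2_eq_square)
qed simp

text \<open>
  The distance to \<open>X 0\<close> grows at least by the Pythagorean amount; as it is bounded by the distance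
  from \<open>X 0\<close> to \<open>K\<close>, the squared steps are summable.
\<close>

lemma step_norm_le:
  "(norm (X (Suc n) - X n))\<^sup>2 \<le> (norm (X 0 - X (Suc n)))\<^sup>2 - (norm (X 0 - X n))\<^sup>2"
proof -
  have "(norm (X 0 - X (Suc n)))\<^sup>2 = (norm (X 0 - X n))\<^sup>2 + (norm (X (Suc n) - X n))\<^sup>2
      - 2 * inner (X (Suc n) - X n) (X 0 - X n)"
    by (simp add: power2_norm_eq_inner inner_diff inner_commute)
  then show ?thesis using step_facts(2)[of n] by linarith
qed

lemma summable_steps: "summable (\<lambda>n. (norm (X (Suc n) - X n))\<^sup>2)"
proof -
  obtain h where h: "h \<in> K" using K_nonempty by blast
  have "(\<Sum>j<n. (norm (X (Suc j) - X j))\<^sup>2) \<le> (norm (X 0 - X n))\<^sup>2" for n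
  proof (induction n)
    case (Suc n)
    then show ?case using step_norm_le[of n] by simp
  qed simp
  moreover have "(norm (X 0 - X n))\<^sup>2 \<le> (norm (X 0 - h))\<^sup>2" for n
    using norm_anchor_le[OF h] by (simp add: power_mono)
  ultimately have "(\<Sum>j<n. (norm (X (Suc j) - X j))\<^sup>2) \<le> (norm (X 0 - h))\<^sup>2" for n
    by (rule order_trans)
  then show ?thesis
    by (intro summableI_nonneg_bounded[where x = "(norm (X 0 - h))\<^sup>2"]) simp_all
qed

lemma steps_null: "(\<lambda>n. X (Suc n) - X n) \<longlonglongrightarrow> 0"
proof -
  have "(\<lambda>n. sqrt ((norm (X (Suc n) - X n))\<^sup>2)) \<longlonglongrightarrow> sqrt 0"
    using summable_LIMSEQ_zero[OF summable_steps] by (intro tendsto_intros)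
  then show ?thesis by (simp add: tendsto_norm_zero_iff)
qed

lemma bounded_iterates: "\<exists>M. \<forall>n. norm (X n) \<le> M"
proof -
  obtain h where h: "h \<in> K" using K_nonempty by blast
  have "norm (X n) \<le> norm (X 0) + norm (X 0 - h)" for n
    using norm_anchor_le[OF h, of n] norm_triangle_ineq4[of "X 0" "X 0 - X n"] by simp
  then show ?thesis by blast
qed

text \<open>
  A weak cluster point \<open>u\<close> lies in \<open>K\<close>, so \<open>norm (X 0 - u)\<close> is at least the limit of the distances
  \<open>norm (X 0 - X n)\<close>; weak lower semicontinuity of the norm gives equality, and weak convergence
  together with convergence of the norms is strong convergence. Since \<open>K\<close> is convex, only one of its
  points is at the minimal distance from \<open>X 0\<close>, so all cluster points coincide.
\<close>

theorem strong_convergence: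
  assumes S: "hilbert_subspace S" and X: "\<And>n. X n \<in> S"
    and cluster: "\<And>F u. F \<noteq> bot \<Longrightarrow> F \<le> sequentially \<Longrightarrow> weak_limit_on S X u F \<Longrightarrow> u \<in> Z"
    and Z: "Z \<subseteq> K"
  shows "\<exists>u\<in>Z. u \<in> S \<and> X \<longlonglongrightarrow> u"
proof -
  obtain M where M: "\<And>n. norm (X n) \<le> M" using bounded_iterates by blast
  have sub: "subspace S" using S by (simp add: hilbert_subspace_def)
  define lim_dist where "lim_dist = (SUP n. norm (X 0 - X n))"
  have inc: "norm (X 0 - X n) \<le> norm (X 0 - X (Suc n))" for n
  proof (rule power2_le_imp_le)
    show "(norm (X 0 - X n))\<^sup>2 \<le> (norm (X 0 - X (Suc n)))\<^sup>2"
      using step_norm_le[of n] zero_le_power2[of "norm (X (Suc n) - X n)"] by linarith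
  qed simp
  have bdd: "bdd_above (range (\<lambda>n. norm (X 0 - X n)))"
  proof -
    obtain h where "h \<in> K" using K_nonempty by blast
    then show ?thesis using norm_anchor_le by (intro bdd_aboveI2)
  qed
  have lim: "(\<lambda>n. norm (X 0 - X n)) \<longlonglongrightarrow> lim_dist"
    unfolding lim_dist_def using inc bdd by (intro LIMSEQ_incseq_SUP) (auto simp: incseq_Suc_iff)
  have lim_dist_le: "lim_dist \<le> norm (X 0 - h)" if "h \<in> K" for h
    using LIMSEQ_le_const2[OF lim] norm_anchor_le[OF that] by blast
  have sub_cluster: "\<exists>F'\<le>F. F' \<noteq> bot \<and> (\<exists>u\<in>Z. u \<in> S \<and> norm (X 0 - u) = lim_dist \<and> (X \<longlongrightarrow> u) F')"
    if F: "F \<noteq> bot" "F \<le> sequentially" for F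
  proof -
    obtain F' u where F': "F' \<le> F" "F' \<noteq> bot" "weak_limit_on S X u F'"
      by (rule weak_cluster_point_exists[OF S X M F(1)])
    have seq: "F' \<le> sequentially" using F'(1) F(2) by (rule order_trans)
    have u: "u \<in> Z" "u \<in> S" using cluster[OF F'(2) seq F'(3)] F'(3) by (auto simp: weak_limit_on_def)
    have lim': "((\<lambda>n. norm (X 0 - X n)) \<longlongrightarrow> lim_dist) F'" using seq lim by (rule tendsto_mono)
    have "((\<lambda>n. inner (X n) (X 0 - u)) \<longlongrightarrow> inner u (X 0 - u)) F'"
      using F'(3) subspace_diff[OF sub X[of 0] u(2)] unfolding weak_limit_on_def by blast
    then have w: "((\<lambda>n. inner (X 0 - X n) (X 0 - u)) \<longlongrightarrow> (norm (X 0 - u))\<^sup>2) F'"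
    proof -
      assume "((\<lambda>n. inner (X n) (X 0 - u)) \<longlongrightarrow> inner u (X 0 - u)) F'"
      from tendsto_diff[OF tendsto_const[of "inner (X 0) (X 0 - u)"] this] show ?thesis
        by (simp only: power2_norm_eq_inner inner_diff_left[of "X 0" _ "X 0 - u"])
    qed
    have "(norm (X 0 - u))\<^sup>2 \<le> lim_dist * norm (X 0 - u)"
    proof (rule tendsto_le[OF F'(2) tendsto_mult[OF lim' tendsto_const] w])
      show "\<forall>\<^sub>F n in F'. inner (X 0 - X n) (X 0 - u) \<le> norm (X 0 - X n) * norm (X 0 - u)"
        by (intro always_eventually allI norm_cauchy_schwarz)
    qed
    moreover have "0 \<le> lim_dist" by (rule LIMSEQ_le_const[OF lim]) simp
    moreover have "lim_dist \<le> norm (X 0 - u)" using u Z lim_dist_le by blast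
    ultimately have eq: "norm (X 0 - u) = lim_dist"
      by (cases "norm (X 0 - u) = 0") (auto simp: power2_eq_square mult_le_cancel_right)
    have "(norm (X n - u))\<^sup>2 = (norm (X 0 - X n))\<^sup>2 - 2 * inner (X 0 - X n) (X 0 - u) + (norm (X 0 - u))\<^sup>2" for n
    proof -
      have "X n - u = (X 0 - u) - (X 0 - X n)" by simp
      then show ?thesis by (simp only: norm_diff_square)
    qed
    moreover have "((\<lambda>n. (norm (X 0 - X n))\<^sup>2 - 2 * inner (X 0 - X n) (X 0 - u) + (norm (X 0 - u))\<^sup>2)
        \<longlongrightarrow> lim_dist\<^sup>2 - 2 * (norm (X 0 - u))\<^sup>2 + (norm (X 0 - u))\<^sup>2) F'"
      using lim' w by (intro tendsto_add tendsto_diff tendsto_mult tendsto_power tendsto_const)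
    ultimately have "((\<lambda>n. (norm (X n - u))\<^sup>2) \<longlongrightarrow> 0) F'" by (simp add: eq)
    then have "((\<lambda>n. sqrt ((norm (X n - u))\<^sup>2)) \<longlongrightarrow> sqrt 0) F'" by (rule tendsto_real_sqrt)
    then have "(X \<longlongrightarrow> u) F'" by (simp add: tendsto_norm_zero_iff Lim_null[symmetric])
    with F' u eq show ?thesis by blast
  qed
  have unique: "u = u'" if "u \<in> K" "u' \<in> K" "norm (X 0 - u) = lim_dist" "norm (X 0 - u') = lim_dist" for u u'
  proof -
    \<comment> \<open>The midpoint of two distinct minimisers would be strictly closer to \<open>X 0\<close>.\<close>
    define m where "m = (1/2) *\<^sub>R (u + u')"
    have "\<Delta> n \<le> inner (X n - m) (g n)" for n
    proof -
      have "inner (X n - m) (g n) = (inner (X n - u) (g n) + inner (X n - u') (g n)) / 2"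
        by (simp add: m_def inner_simps field_simps)
      moreover have "\<Delta> n \<le> inner (X n - u) (g n)" "\<Delta> n \<le> inner (X n - u') (g n)"
        using that(1,2) K by auto
      ultimately show ?thesis by simp
    qed
    then have "lim_dist \<le> norm (X 0 - m)" using lim_dist_le K by blast
    then have "lim_dist\<^sup>2 \<le> (norm (X 0 - m))\<^sup>2" using that(3) norm_ge_zero by (intro power_mono) auto
    also have "(norm (X 0 - m))\<^sup>2 = (norm (X 0 - u))\<^sup>2 / 2 + (norm (X 0 - u'))\<^sup>2 / 2 - (norm (u - u'))\<^sup>2 / 4"
      by (simp add: m_def power2_norm_eq_inner inner_diff inner_add inner_commute field_simps)
    finally show ?thesis by (simp add: that)
  qed
  obtain u where u: "u \<in> Z" "u \<in> S" "norm (X 0 - u) = lim_dist"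
    using sub_cluster[of sequentially] by auto
  have "X \<longlonglongrightarrow> u"
  proof (rule ccontr)
    assume "\<not> X \<longlonglongrightarrow> u"
    then obtain e where e: "e > 0" "\<exists>\<^sub>F n in sequentially. \<not> dist (X n) u < e"
      by (auto simp: tendsto_iff frequently_def)
    \<comment> \<open>Along the indices that stay away from \<open>u\<close> there would be another cluster point.\<close>
    define F where "F = inf sequentially (principal {n. \<not> dist (X n) u < e})"
    have F: "F \<noteq> bot" "F \<le> sequentially"
      using e(2) by (auto simp: F_def trivial_limit_def eventually_inf_principal frequently_def)
    then obtain F' u' where F': "F' \<le> F" "F' \<noteq> bot" "u' \<in> Z" "norm (X 0 - u') = lim_dist" "(X \<longlongrightarrow> u') F'"
      using sub_cluster by blast
    then have "(X \<longlongrightarrow> u) F'" using unique[of u u'] u Z by auto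
    then have "\<forall>\<^sub>F n in F'. dist (X n) u < e" using e(1) by (simp add: tendstoD)
    moreover have "\<forall>\<^sub>F n in F'. \<not> dist (X n) u < e"
      using filter_leD[OF F'(1), of "\<lambda>n. \<not> dist (X n) u < e"] by (simp add: F_def eventually_inf_principal)
    ultimately have "\<forall>\<^sub>F n in F'. False" by eventually_elim simp
    with F'(2) show False by (simp add: trivial_limit_def)
  qed
  with u show ?thesis by blast
qed

end

section \<open>Outer approximation of the zeros of a monotone sum\<close>

lemma maximally_monotone_onI:
  assumes "operator_on S A" "monotone_operator A"
    and "\<And>u w. u \<in> S \<Longrightarrow> w \<in> S \<Longrightarrow> (\<And>y v. v \<in> A y \<Longrightarrow> 0 \<le> inner (u - y) (w - v)) \<Longrightarrow> w \<in> A u"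
  shows "maximally_monotone_on S A"
  unfolding maximally_monotone_on_def
proof (intro conjI allI impI)
  fix B assume B: "operator_on S B \<and> monotone_operator B \<and> (\<forall>x. A x \<subseteq> B x)"
  have "B u \<subseteq> A u" for u
  proof
    fix w assume w: "w \<in> B u"
    show "w \<in> A u"
    proof (rule assms(3))
      show "u \<in> S" "w \<in> S" using B w by (auto simp: operator_on_def)
      show "0 \<le> inner (u - y) (w - v)" if "v \<in> A y" for y v
        using B w that unfolding monotone_operator_def by blast
    qed
  qed
  with B show "B = A" by blast
qed (use assms in auto)

text \<open>
  Otherwise the pair \<open>(u, w)\<close> could be added to the graph.
\<close>

lemma maximally_monotone_on_mem:
  assumes M: "maximally_monotone_on S M" and mem: "u \<in> S" "w \<in> S"
    and rel: "\<And>y v. v \<in> M y \<Longrightarrow> 0 \<le> inner (u - y) (w - v)"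
  shows "w \<in> M u"
proof -
  define M' where "M' x = (if x = u then insert w (M x) else M x)" for x
  have graph: "v \<in> M' y \<longleftrightarrow> v \<in> M y \<or> (y = u \<and> v = w)" for y v by (auto simp: M'_def)
  have "operator_on S M'"
    using M mem by (auto simp: maximally_monotone_on_def operator_on_def graph)
  moreover have "monotone_operator M'"
  proof -
    have "0 \<le> inner (y - u) (v - w)" if "v \<in> M y" for y v
    proof -
      have "inner (y - u) (v - w) = inner (u - y) (w - v)"
        by (metis inner_minus_left inner_minus_right minus_diff_eq minus_minus)
      then show ?thesis using rel[OF that] by simp
    qed
    then show ?thesis
      using M rel unfolding monotone_operator_def maximally_monotone_on_def
      by (auto simp: graph)
  qed
  moreover have "\<forall>x. M x \<subseteq> M' x" by (auto simp: graph)
  ultimately have "M' = M" using M unfolding maximally_monotone_on_def by blast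
  then show ?thesis using graph[of w u] by simp
qed

lemma tendsto_inner_bounded_null:
  fixes a g :: "'b \<Rightarrow> 'a::real_inner"
  assumes "\<And>n. norm (a n) \<le> K" "(g \<longlongrightarrow> 0) F"
  shows "((\<lambda>n. inner (a n) (g n)) \<longlongrightarrow> 0) F"
proof (rule Lim_null_comparison)
  show "\<forall>\<^sub>F n in F. norm (inner (a n) (g n)) \<le> K * norm (g n)"
  proof (intro always_eventually allI)
    fix n
    show "norm (inner (a n) (g n)) \<le> K * norm (g n)"
      using Cauchy_Schwarz_ineq2[of "a n" "g n"] mult_right_mono[OF assms(1)[of n], of "norm (g n)"]
      by simp
  qed
  show "((\<lambda>n. K * norm (g n)) \<longlongrightarrow> 0) F"
    using assms(2) by (auto intro!: tendsto_eq_intros)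
qed

text \<open>
  The graph of \<open>M + B\<close> is closed for weak convergence of the arguments and strong convergence of the
  values. This is usually read off from maximal monotonicity of the sum, which rests on Minty's
  theorem. Here it is obtained directly. Let \<open>\<beta>\<close> be a weak cluster point of \<open>B (a n)\<close>, so that
  \<open>- \<beta>\<close> is a weak cluster point of the elements \<open>g n - B (a n)\<close> of \<open>M (a n)\<close>. Monotonicity of \<open>B\<close> at \<open>u\<close> bounds
  \<open>inner (a n - u) (B (a n))\<close> from below by a null sequence, which is the one-sided estimate under
  which the monotonicity inequality for \<open>M\<close> survives the limit: hence \<open>- \<beta> \<in> M u\<close>. Using this pair
  in the monotonicity inequality for \<open>M\<close> bounds the same quantity from above, so that the monotonicity
  inequality for \<open>B\<close> survives too, and Minty's line argument yields \<open>\<beta> = B u\<close>.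
\<close>

lemma weak_demiclosed_sum:
  fixes a g :: "'b \<Rightarrow> 'a::real_inner"
  assumes S: "hilbert_subspace S" and M: "maximally_monotone_on S M"
    and B: "B \<in> S \<rightarrow> S" "monotone_map_on S B" "c-lipschitz_on S B"
    and F: "F \<noteq> bot" and u: "weak_limit_on S a u F"
    and a: "\<And>n. a n \<in> S" "\<And>n. norm (a n) \<le> K"
    and incl: "\<And>n. g n - B (a n) \<in> M (a n)" and g: "(g \<longlongrightarrow> 0) F"
  shows "- B u \<in> M u"
proof -
  have sub: "subspace S" using S by (simp add: hilbert_subspace_def)
  have uS: "u \<in> S" using u by (simp add: weak_limit_on_def)
  have c: "0 \<le> c" using B(3) lipschitz_on_nonneg by blast
  have monoM: "0 \<le> inner (x - y) (p - q)" if "p \<in> M x" "q \<in> M y" for x y p q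
    using M that unfolding maximally_monotone_on_def monotone_operator_def by blast
  have graphM: "x \<in> S \<and> p \<in> S" if "p \<in> M x" for x p
    using M that unfolding maximally_monotone_on_def operator_on_def by blast
  have Ba: "B (a n) \<in> S" "norm (B (a n)) \<le> norm (B u) + c * (K + norm u)" for n
  proof -
    show "B (a n) \<in> S" using B(1) a(1) by blast
    have "norm (B (a n)) \<le> norm (B u) + norm (B (a n) - B u)"
      by (metis add.commute diff_add_cancel norm_triangle_ineq)
    also have "norm (B (a n) - B u) \<le> c * norm (a n - u)"
      using lipschitz_onD[OF B(3) a(1) uS] by (simp add: dist_norm)
    also have "\<dots> \<le> c * (K + norm u)"
      using c a(2)[of n] norm_triangle_ineq4[of "a n" u] by (intro mult_left_mono) auto
    finally show "norm (B (a n)) \<le> norm (B u) + c * (K + norm u)" by simp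
  qed
  obtain F' \<beta> where F': "F' \<le> F" "F' \<noteq> bot" "weak_limit_on S (\<lambda>n. B (a n)) \<beta> F'"
    by (rule weak_cluster_point_exists[OF S Ba F])
  have \<beta>: "\<beta> \<in> S" using F'(3) by (simp add: weak_limit_on_def)
  have limB: "((\<lambda>n. inner h (B (a n))) \<longlongrightarrow> inner h \<beta>) F'" if "h \<in> S" for h
    using F'(3) that unfolding weak_limit_on_def by (simp add: inner_commute[of h])
  have lima: "((\<lambda>n. inner (a n - y) h) \<longlongrightarrow> inner (u - y) h) F'" if "h \<in> S" for h y
  proof -
    have "((\<lambda>n. inner (a n) h) \<longlongrightarrow> inner u h) F'"
      using weak_limit_on_mono[OF u F'(1)] that unfolding weak_limit_on_def by blast
    from tendsto_diff[OF this tendsto_const[of "inner y h"]] show ?thesis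
      by (simp only: inner_diff_left)
  qed
  have limg: "((\<lambda>n. inner (a n - y) (g n)) \<longlongrightarrow> 0) F'" for y
  proof (rule tendsto_inner_bounded_null)
    show "norm (a n - y) \<le> K + norm y" for n
      using a(2)[of n] norm_triangle_ineq4[of "a n" y] by linarith
    show "(g \<longlongrightarrow> 0) F'" using F'(1) g by (rule tendsto_mono)
  qed
  have nonneg_lim: "0 \<le> l" if "(f \<longlongrightarrow> l) F'" "\<And>n. 0 \<le> f n" for f :: "'b \<Rightarrow> real" and l
    using tendsto_lowerbound[OF that(1) always_eventually F'(2)] that(2) by blast
  have monoB: "0 \<le> inner (a n - y) (B (a n) - B y)" if "y \<in> S" for n y
    using B(2) a(1) that unfolding monotone_map_on_def by blast
  have \<beta>_M: "- \<beta> \<in> M u"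
  proof (rule maximally_monotone_on_mem[OF M uS])
    show "- \<beta> \<in> S" using \<beta> sub by (simp add: subspace_neg)
    fix y w assume w: "w \<in> M y"
    then have yw: "y \<in> S" "w \<in> S" using graphM by auto
    \<comment> \<open>In this sum of two monotonicity inequalities the products \<open>inner (a n) (B (a n))\<close>, which need
      not converge, cancel.\<close>
    let ?f = "\<lambda>n. inner (a n - y) (g n) - inner (a n - u) (B u) - inner (u - y) (B (a n)) - inner (a n - y) w"
    have "0 \<le> ?f n" for n
    proof -
      have "0 \<le> inner (a n - y) (g n - B (a n) - w) + inner (a n - u) (B (a n) - B u)"
        using monoM[OF incl w] monoB[OF uS] by (intro add_nonneg_nonneg)
      also have "\<dots> = ?f n" by (simp add: inner_diff_left inner_diff_right)
      finally show ?thesis .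
    qed
    moreover have "(?f \<longlongrightarrow> 0 - inner (u - u) (B u) - inner (u - y) \<beta> - inner (u - y) w) F'"
      using B(1) uS yw subspace_diff[OF sub uS yw(1)]
      by (intro tendsto_diff limg lima limB) auto
    ultimately have "0 \<le> 0 - inner (u - u) (B u) - inner (u - y) \<beta> - inner (u - y) w"
      using nonneg_lim by blast
    then show "0 \<le> inner (u - y) (- \<beta> - w)" by (simp add: inner_diff_right)
  qed
  have minty: "0 \<le> inner (u - y) (\<beta> - B y)" if y: "y \<in> S" for y
  proof -
    \<comment> \<open>The same cancellation, now with the pair \<open>(u, - \<beta>)\<close> of the graph of \<open>M\<close>.\<close>
    let ?f = "\<lambda>n. inner (a n - u) (g n) + inner (a n - u) \<beta> + inner (u - y) (B (a n)) - inner (a n - y) (B y)"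
    have "0 \<le> ?f n" for n
    proof -
      have "0 \<le> inner (a n - u) (g n - B (a n) - - \<beta>) + inner (a n - y) (B (a n) - B y)"
        using monoM[OF incl \<beta>_M] monoB[OF y] by (intro add_nonneg_nonneg)
      also have "\<dots> = ?f n" by (simp add: inner_diff_left inner_diff_right inner_add_right)
      finally show ?thesis .
    qed
    moreover have "(?f \<longlongrightarrow> 0 + inner (u - u) \<beta> + inner (u - y) \<beta> - inner (u - y) (B y)) F'"
      using B(1) uS y \<beta> subspace_diff[OF sub uS y]
      by (intro tendsto_diff tendsto_add limg lima limB) auto
    ultimately have "0 \<le> 0 + inner (u - u) \<beta> + inner (u - y) \<beta> - inner (u - y) (B y)"
      using nonneg_lim by blast
    then show ?thesis by (simp add: inner_diff_right)
  qed
  define h where "h = B u - \<beta>"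
  \<comment> \<open>Instead of letting \<open>y\<close> tend to \<open>u\<close>, the Lipschitz constant allows one fixed step \<open>t\<close> with
    \<open>c * t < 1\<close>.\<close>
  define t where "t = 1 / (c + 1)"
  have t: "t > 0" "c * t < 1" using c by (simp_all add: t_def field_simps)
  have hS: "h \<in> S" unfolding h_def
    by (intro subspace_diff[OF sub] funcset_mem[OF B(1)] uS \<beta>)
  define y where "y = u - t *\<^sub>R h"
  have yS: "y \<in> S" using uS hS sub by (simp add: y_def subspace_diff subspace_scale)
  have "0 \<le> t * inner h (\<beta> - B y)" using minty[OF yS] by (simp add: y_def)
  then have "0 \<le> inner h (\<beta> - B y)" using t by (simp add: zero_le_mult_iff)
  also have "\<beta> - B y = (B u - B y) - h" by (simp add: h_def)
  finally have "(norm h)\<^sup>2 \<le> inner h (B u - B y)"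
    by (simp only: inner_diff_right[of h _ h] power2_norm_eq_inner)
  also have "\<dots> \<le> norm h * norm (B u - B y)" by (rule norm_cauchy_schwarz)
  also have "norm (B u - B y) \<le> c * norm (u - y)"
    using lipschitz_onD[OF B(3) uS yS] by (simp add: dist_norm)
  finally have "(norm h)\<^sup>2 \<le> norm h * (c * norm (u - y))" by (simp add: mult_left_mono)
  then have contraction: "(norm h)\<^sup>2 \<le> (c * t) * (norm h)\<^sup>2"
    using t(1) by (simp add: y_def power2_eq_square mult_ac)
  have "h = 0"
  proof (rule ccontr)
    assume "h \<noteq> 0"
    then have "(c * t) * (norm h)\<^sup>2 < 1 * (norm h)\<^sup>2"
      using t(2) by (intro mult_strict_right_mono) auto
    with contraction show False by simp
  qed
  then show ?thesis using \<beta>_M by (simp add: h_def)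
qed

text \<open>
  An abstract form of the algorithm for a zero of \<open>M + B + C\<close> with \<open>M\<close> maximally monotone, \<open>B\<close>
  monotone and Lipschitzian, and \<open>C\<close> cocoercive. Cocoercivity enters through the inequality
  \<open>three_point\<close>; the map \<open>Pr\<close> discards coordinates on which \<open>C\<close> does not act. The
  point \<open>xt n\<close> is a delayed version of \<open>X n\<close>, and \<open>g n\<close> is an element of
  \<open>M (a n) + B (a n) + C (xt n)\<close>. The kernels \<open>N n\<close> link this element to the iterate: up to a
  residual and the delay in \<open>C\<close>, \<open>a n\<close> is the resolvent of \<open>M + B + C\<close> at \<open>X n\<close> in the
  geometry of \<open>N n\<close>. The conditions on
  delay and residual are implications because vanishing steps are a consequence of the others.
\<close>

locale outer_approximation =
  fixes S :: "'a::real_inner set" and M :: "'a \<Rightarrow> 'a set" and B C Pr :: "'a \<Rightarrow> 'a"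
    and N :: "nat \<Rightarrow> 'a \<Rightarrow> 'a" and X a xt g :: "nat \<Rightarrow> 'a" and \<Delta> :: "nat \<Rightarrow> real"
    and cB cC \<Lambda> \<kappa> \<theta> :: real
  assumes S: "hilbert_subspace S" and M: "maximally_monotone_on S M"
    and B: "B \<in> S \<rightarrow> S" "monotone_map_on S B" "cB-lipschitz_on S B"
    and C: "C \<in> S \<rightarrow> S" "cC-lipschitz_on S C"
    and Pr: "linear Pr" "\<And>w. norm (Pr w) \<le> norm w" and \<kappa>: "0 \<le> \<kappa>"
    and three_point: "\<And>u v w. u \<in> S \<Longrightarrow> v \<in> S \<Longrightarrow> w \<in> S \<Longrightarrow>
        inner (v - w) (C u - C v) \<le> \<kappa> * (norm (Pr (u - w)))\<^sup>2"
    and \<theta>: "0 < \<theta>"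
    and N_mono: "\<And>n u v. u \<in> S \<Longrightarrow> v \<in> S \<Longrightarrow>
        \<theta> * (norm (u - v))\<^sup>2 + \<kappa> * (norm (Pr (u - v)))\<^sup>2 \<le> inner (u - v) (N n u - N n v)"
    and N_lip: "\<And>n. \<Lambda>-lipschitz_on S (N n)"
    and mem: "\<And>n. X n \<in> S" "\<And>n. a n \<in> S" "\<And>n. xt n \<in> S"
    and incl: "\<And>n. g n - B (a n) - C (xt n) \<in> M (a n)"
    and \<Delta>: "\<And>n. \<Delta> n = inner (X n - a n) (g n) - \<kappa> * (norm (Pr (xt n - a n)))\<^sup>2"
    and step: "\<And>n. \<Delta> n > 0 \<Longrightarrow> \<exists>q l.
        (q, l) = Xi (\<Delta> n) ((norm (g n))\<^sup>2) ((norm (X 0 - X n))\<^sup>2) (inner (X 0 - X n) (g n)) \<and>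
        X (Suc n) = (1 - q) *\<^sub>R X 0 + q *\<^sub>R X n - l *\<^sub>R g n"
    and idle: "\<And>n. \<not> \<Delta> n > 0 \<Longrightarrow> X (Suc n) = X n"
    and delay: "(\<lambda>n. X (Suc n) - X n) \<longlonglongrightarrow> 0 \<Longrightarrow> (\<lambda>n. xt n - X n) \<longlonglongrightarrow> 0"
    and residual: "(\<lambda>n. X (Suc n) - X n) \<longlonglongrightarrow> 0 \<Longrightarrow>
        (\<lambda>n. g n - (N n (X n) - N n (a n))) \<longlonglongrightarrow> 0"
    and zero_exists: "\<exists>h\<in>S. - (B h + C h) \<in> M h"
begin

text \<open>
  Every zero \<open>h\<close> lies in the half-space of step \<open>n\<close>: monotonicity of \<open>M + B\<close> between \<open>a n\<close> and
  \<open>h\<close> leaves only the terms of \<open>C\<close>, which the three-point inequality controls.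
\<close>

lemma halfspace:
  assumes h: "h \<in> S" "- (B h + C h) \<in> M h"
  shows "inner (h - a n) (g n) \<le> \<kappa> * (norm (Pr (xt n - a n)))\<^sup>2"
proof -
  have "0 \<le> inner (a n - h) (g n - B (a n) - C (xt n) - - (B h + C h))"
    using M incl h(2) unfolding maximally_monotone_on_def monotone_operator_def by blast
  moreover have "0 \<le> inner (a n - h) (B (a n) - B h)"
    using B(2) mem(2) h(1) unfolding monotone_map_on_def by blast
  ultimately have "0 \<le> inner (a n - h) (g n - B (a n) - C (xt n) - - (B h + C h))
      + inner (a n - h) (B (a n) - B h)" by simp
  also have "\<dots> = inner (h - a n) (C (xt n) - C h) - inner (h - a n) (g n)"
    by (simp add: inner_diff_left inner_diff_right inner_add_right)
  also have "inner (h - a n) (C (xt n) - C h) \<le> \<kappa> * (norm (Pr (xt n - a n)))\<^sup>2"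
    using three_point mem h(1) by blast
  finally show ?thesis by simp
qed

sublocale haugazeau X g \<Delta> "{h. \<forall>n. \<Delta> n \<le> inner (X n - h) (g n)}"
proof unfold_locales
  obtain h where "h \<in> S" "- (B h + C h) \<in> M h" using zero_exists by blast
  note h = halfspace[OF this]
  have "\<Delta> n \<le> inner (X n - h) (g n)" for n
    using h[of n] by (simp add: \<Delta> inner_diff_left)
  then show "{h. \<forall>n. \<Delta> n \<le> inner (X n - h) (g n)} \<noteq> {}" by blast
qed (use step idle in auto)

text \<open>
  Strong monotonicity of \<open>N n\<close> makes \<open>a n\<close> depend on \<open>X n\<close>, up to the residual, like a resolvent:
  its distance to a zero is bounded by a multiple of quantities already known to be bounded.
\<close>

lemma approx_bounded: "\<exists>K. \<forall>n. norm (a n) \<le> K"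
proof -
  obtain h where h: "h \<in> S" "- (B h + C h) \<in> M h" using zero_exists by blast
  obtain K1 where K1: "\<And>n. norm (X n) \<le> K1" using bounded_iterates by blast
  obtain K2 where K2: "\<And>n. norm (xt n - X n) \<le> K2"
    using convergent_imp_Bseq[OF convergentI[OF delay[OF steps_null]]] by (auto simp: Bseq_def)
  define r where "r n = g n - (N n (X n) - N n (a n))" for n
  obtain K3 where K3: "\<And>n. norm (r n) \<le> K3"
    using convergent_imp_Bseq[OF convergentI[OF residual[OF steps_null]]] by (auto simp: Bseq_def r_def)
  have nn: "0 \<le> \<Lambda>" "0 \<le> cC" using N_lip C(2) lipschitz_on_nonneg by blast+
  define D where "D = \<Lambda> * (K1 + norm h) + K3 + cC * (K2 + K1 + norm h)"
  have "\<theta> * norm (a n - h) \<le> D" for n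
  proof -
    define w where "w = (N n (X n) - N n h) + r n - (C (xt n) - C h)"
    have "0 \<le> inner (a n - h) (g n - B (a n) - C (xt n) - - (B h + C h))"
      using M incl h(2) unfolding maximally_monotone_on_def monotone_operator_def by blast
    moreover have "0 \<le> inner (a n - h) (B (a n) - B h)"
      using B(2) mem(2) h(1) unfolding monotone_map_on_def by blast
    moreover have "\<theta> * (norm (a n - h))\<^sup>2 \<le> inner (a n - h) (N n (a n) - N n h)"
      using N_mono[OF mem(2) h(1), of n n] \<kappa> zero_le_power2[of "norm (Pr (a n - h))"]
      by (smt (verit) mult_nonneg_nonneg)
    ultimately have "\<theta> * (norm (a n - h))\<^sup>2 \<le> inner (a n - h) (g n - B (a n) - C (xt n) - - (B h + C h))
      + inner (a n - h) (B (a n) - B h) + inner (a n - h) (N n (a n) - N n h)" by linarith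
    also have "\<dots> = inner (a n - h) w"
      by (simp add: w_def r_def inner_diff_right inner_add_right)
    also have "\<dots> \<le> norm (a n - h) * norm w" by (rule norm_cauchy_schwarz)
    also have "norm w \<le> D"
    proof -
      have "norm (N n (X n) - N n h) \<le> \<Lambda> * norm (X n - h)"
        using lipschitz_onD[OF N_lip mem(1) h(1)] by (simp add: dist_norm)
      also have "\<dots> \<le> \<Lambda> * (K1 + norm h)"
        using nn K1[of n] norm_triangle_ineq4[of "X n" h] by (intro mult_left_mono) auto
      finally have 1: "norm (N n (X n) - N n h) \<le> \<Lambda> * (K1 + norm h)" .
      have "norm (C (xt n) - C h) \<le> cC * norm (xt n - h)"
        using lipschitz_onD[OF C(2) mem(3) h(1)] by (simp add: dist_norm)
      also have "norm (xt n - h) \<le> K2 + K1 + norm h"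
        using K1[of n] K2[of n] norm_triangle_ineq4[of "X n" h] norm_triangle_ineq[of "xt n - X n" "X n - h"]
        by simp
      finally have 2: "norm (C (xt n) - C h) \<le> cC * (K2 + K1 + norm h)"
        using nn by (simp add: mult_left_mono)
      show ?thesis
        using 1 2 K3[of n] norm_triangle_ineq4[of "N n (X n) - N n h + r n" "C (xt n) - C h"]
          norm_triangle_ineq[of "N n (X n) - N n h" "r n"] unfolding w_def D_def by linarith
    qed
    finally have "\<theta> * (norm (a n - h))\<^sup>2 \<le> norm (a n - h) * D" by (simp add: mult_left_mono)
    moreover have "0 \<le> D"
      using \<open>norm w \<le> D\<close> norm_ge_zero order_trans by blast
    ultimately show ?thesis
      by (cases "norm (a n - h) = 0") (auto simp: power2_eq_square)
  qed
  then have "norm (a n - h) \<le> D / \<theta>" for n using \<theta> by (simp add: field_simps)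
  then have "norm (a n) \<le> D / \<theta> + norm h" for n
    using norm_triangle_ineq[of "a n - h" h] by (smt (verit) diff_add_cancel)
  then show ?thesis by blast
qed

text \<open>
  If \<open>\<Delta> n\<close> is positive, the half-space of step \<open>n\<close> contains \<open>X (Suc n)\<close> but not \<open>X n\<close>, so in any case \<open>\<Delta> n\<close> is at most the length of a step times \<open>norm (g n)\<close>. On the other hand strong monotonicity
  of \<open>N n\<close> bounds \<open>\<Delta> n\<close> from below by \<open>\<theta> * (norm (X n - a n))\<^sup>2\<close> up to delay and residual.
\<close>

lemma gap_null: "(\<lambda>n. X n - a n) \<longlonglongrightarrow> 0" and normal_null: "g \<longlonglongrightarrow> 0"
proof -
  define w where "w n = X n - a n" for n
  define r where "r n = g n - (N n (X n) - N n (a n))" for n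
  define d where "d n = xt n - X n" for n
  have r0: "r \<longlonglongrightarrow> 0" using residual[OF steps_null] by (simp add: r_def[abs_def])
  have d0: "d \<longlonglongrightarrow> 0" using delay[OF steps_null] by (simp add: d_def[abs_def])
  obtain K1 where K1: "\<And>n. norm (X n) \<le> K1" using bounded_iterates by blast
  obtain K2 where K2: "\<And>n. norm (a n) \<le> K2" using approx_bounded by blast
  have w_bdd: "norm (w n) \<le> K1 + K2" for n
    using K1[of n] K2[of n] norm_triangle_ineq4[of "X n" "a n"] by (simp add: w_def)
  have \<Lambda>: "0 \<le> \<Lambda>" using N_lip lipschitz_on_nonneg by blast
  have g_eq: "g n = (N n (X n) - N n (a n)) + r n" for n by (simp add: r_def)
  have g_le: "norm (g n) \<le> \<Lambda> * norm (w n) + norm (r n)" for n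
    using norm_triangle_ineq[of "N n (X n) - N n (a n)" "r n"] lipschitz_onD[OF N_lip mem(1,2), of n n n]
    by (simp add: g_eq[symmetric] dist_norm w_def)
  \<comment> \<open>The three error terms stem from the step length, the residual and the delay.\<close>
  define \<epsilon> where "\<epsilon> n = norm (X (Suc n) - X n) * (\<Lambda> * (K1 + K2) + norm (r n))
      + (K1 + K2) * norm (r n) + \<kappa> * (2 * (K1 + K2) * norm (d n) + (norm (d n))\<^sup>2)" for n
  have "\<epsilon> \<longlonglongrightarrow> 0 * (\<Lambda> * (K1 + K2) + 0) + (K1 + K2) * 0 + \<kappa> * (2 * (K1 + K2) * 0 + 0\<^sup>2)"
    unfolding \<epsilon>_def using r0 d0 steps_null
    by (intro tendsto_add tendsto_mult tendsto_power tendsto_const tendsto_norm_zero)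
  then have \<epsilon>0: "\<epsilon> \<longlonglongrightarrow> 0" by simp
  have key: "\<theta> * (norm (w n))\<^sup>2 \<le> \<epsilon> n" for n
  proof -
    have 1: "\<Delta> n \<le> norm (X (Suc n) - X n) * (\<Lambda> * (K1 + K2) + norm (r n))"
    proof -
      have "\<Delta> n \<le> norm (X (Suc n) - X n) * norm (g n)" by (rule step_facts)
      also have "norm (g n) \<le> \<Lambda> * (K1 + K2) + norm (r n)"
        using g_le[of n] mult_left_mono[OF w_bdd \<Lambda>, of n] by linarith
      finally show ?thesis by (simp add: mult_left_mono)
    qed
    have 2: "(norm (Pr (xt n - a n)))\<^sup>2 \<le> (norm (Pr (w n)))\<^sup>2 + (2 * (K1 + K2) * norm (d n) + (norm (d n))\<^sup>2)"
    proof -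
      have "Pr (xt n - a n) = Pr (w n) + Pr (d n)"
        using linear_add[OF Pr(1), of "w n" "d n"] by (simp add: w_def d_def)
      then have "norm (Pr (xt n - a n)) \<le> norm (Pr (w n)) + norm (d n)"
        using norm_triangle_ineq[of "Pr (w n)" "Pr (d n)"] Pr(2)[of "d n"] by simp
      then have "(norm (Pr (xt n - a n)))\<^sup>2 \<le> (norm (Pr (w n)) + norm (d n))\<^sup>2" by (simp add: power_mono)
      also have "\<dots> = (norm (Pr (w n)))\<^sup>2 + (2 * norm (Pr (w n)) * norm (d n) + (norm (d n))\<^sup>2)"
        by (simp add: power2_sum)
      also have "2 * norm (Pr (w n)) * norm (d n) \<le> 2 * (K1 + K2) * norm (d n)"
        using Pr(2)[of "w n"] w_bdd[of n] by (intro mult_right_mono) auto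
      finally show ?thesis by simp
    qed
    have 3: "- ((K1 + K2) * norm (r n)) \<le> inner (w n) (r n)"
      using Cauchy_Schwarz_ineq2[of "w n" "r n"] mult_right_mono[OF w_bdd[of n], of "norm (r n)"] by simp
    have "\<theta> * (norm (w n))\<^sup>2 + \<kappa> * (norm (Pr (w n)))\<^sup>2 \<le> inner (w n) (N n (X n) - N n (a n))"
      using N_mono[OF mem(1,2)] by (simp add: w_def)
    also have "\<dots> = \<Delta> n + \<kappa> * (norm (Pr (xt n - a n)))\<^sup>2 - inner (w n) (r n)"
      unfolding \<Delta> by (simp add: g_eq[of n] w_def inner_add_right)
    finally show ?thesis
      using 1 3 mult_left_mono[OF 2 \<kappa>] unfolding \<epsilon>_def distrib_left[of \<kappa> "(norm (Pr (w n)))\<^sup>2"]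
      by linarith
  qed
  have "(\<lambda>n. \<epsilon> n / \<theta>) \<longlonglongrightarrow> 0" using tendsto_divide[OF \<epsilon>0 tendsto_const] \<theta> by fastforce
  moreover have "norm ((norm (w n))\<^sup>2) \<le> \<epsilon> n / \<theta>" for n
    using key[of n] \<theta> by (simp add: field_simps)
  ultimately have "(\<lambda>n. (norm (w n))\<^sup>2) \<longlonglongrightarrow> 0"
    using Lim_null_comparison[of "\<lambda>n. (norm (w n))\<^sup>2" "\<lambda>n. \<epsilon> n / \<theta>"] by simp
  then have "(\<lambda>n. sqrt ((norm (w n))\<^sup>2)) \<longlonglongrightarrow> sqrt 0" by (rule tendsto_real_sqrt)
  then have w0: "w \<longlonglongrightarrow> 0" by (simp add: tendsto_norm_zero_iff)
  then show "(\<lambda>n. X n - a n) \<longlonglongrightarrow> 0" by (simp add: w_def[abs_def])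
  have "(\<lambda>n. \<Lambda> * norm (w n) + norm (r n)) \<longlonglongrightarrow> \<Lambda> * 0 + 0"
    using w0 r0 by (intro tendsto_add tendsto_mult tendsto_const tendsto_norm_zero)
  then show "g \<longlonglongrightarrow> 0"
    using g_le by (intro Lim_null_comparison[of g "\<lambda>n. \<Lambda> * norm (w n) + norm (r n)"]) auto
qed

theorem converges_to_zero: "\<exists>u\<in>S. - (B u + C u) \<in> M u \<and> X \<longlonglongrightarrow> u"
proof -
  define Z where "Z = {u \<in> S. - (B u + C u) \<in> M u}"
  define BC where "BC u = B u + C u" for u
  define g' where "g' n = g n - (C (xt n) - C (a n))" for n
  have sub: "subspace S" using S by (simp add: hilbert_subspace_def)
  have BC: "BC \<in> S \<rightarrow> S" "monotone_map_on S BC" "(cB + cC)-lipschitz_on S BC"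
  proof -
    show "BC \<in> S \<rightarrow> S"
      using B(1) C(1) subspace_add[OF sub] unfolding BC_def by blast
    show "(cB + cC)-lipschitz_on S BC"
      unfolding BC_def by (intro lipschitz_on_add B C)
    show "monotone_map_on S BC"
      unfolding monotone_map_on_def BC_def
    proof (intro ballI)
      fix u v assume uv: "u \<in> S" "v \<in> S"
      have "inner (v - u) (C u - C v) \<le> 0"
        using three_point[OF uv uv(1)] linear_0[OF Pr(1)] by simp
      moreover have "0 \<le> inner (u - v) (B u - B v)" using B(2) uv unfolding monotone_map_on_def by blast
      ultimately show "0 \<le> inner (u - v) (B u + C u - (B v + C v))"
        by (simp add: inner_diff_left inner_diff_right inner_add_right)
    qed
  qed
  have g': "g' \<longlonglongrightarrow> 0"
  proof -
    have "norm (C (xt n) - C (a n)) \<le> cC * norm ((xt n - X n) + (X n - a n))" for n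
      using lipschitz_onD[OF C(2) mem(3,2)] by (simp add: dist_norm)
    moreover have "(\<lambda>n. cC * norm ((xt n - X n) + (X n - a n))) \<longlonglongrightarrow> cC * norm (0 + 0 :: 'a)"
      by (intro tendsto_mult tendsto_const tendsto_norm tendsto_add gap_null delay[OF steps_null])
    ultimately have "(\<lambda>n. C (xt n) - C (a n)) \<longlonglongrightarrow> 0"
      by (intro Lim_null_comparison[of "\<lambda>n. C (xt n) - C (a n)" "\<lambda>n. cC * norm ((xt n - X n) + (X n - a n))"])
        auto
    from tendsto_diff[OF normal_null this] show ?thesis by (simp add: g'_def[abs_def])
  qed
  obtain K where K: "\<And>n. norm (a n) \<le> K" using approx_bounded by blast
  have "\<exists>u\<in>Z. u \<in> S \<and> X \<longlonglongrightarrow> u"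
  proof (rule strong_convergence[OF S mem(1)])
    fix F u assume F: "F \<noteq> bot" "F \<le> sequentially" "weak_limit_on S X u F"
    \<comment> \<open>\<open>C\<close> can be evaluated at \<open>a n\<close> instead of \<open>xt n\<close> at the price of a null sequence, which turns
      \<open>B + C\<close> into one Lipschitzian monotone map.\<close>
    have "weak_limit_on S a u F"
      by (rule weak_limit_on_diff_null[OF F(3)]) (rule tendsto_mono[OF F(2) gap_null])
    moreover have "g' n - BC (a n) \<in> M (a n)" for n
      using incl[of n] by (simp add: g'_def BC_def algebra_simps)
    ultimately have "- BC u \<in> M u"
      by (intro weak_demiclosed_sum[where a = a and g = g', OF S M BC F(1) _ mem(2) K] tendsto_mono[OF F(2) g'])
    then show "u \<in> Z" using F(3) by (simp add: Z_def BC_def weak_limit_on_def)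
  next
    show "Z \<subseteq> {h. \<forall>n. \<Delta> n \<le> inner (X n - h) (g n)}"
    proof clarify
      fix h n assume "h \<in> Z"
      then show "\<Delta> n \<le> inner (X n - h) (g n)"
        using halfspace[of h n] by (simp add: Z_def \<Delta> inner_diff_left)
    qed
  qed
  then show ?thesis by (auto simp: Z_def)
qed

end

section \<open>Products of Hilbert spaces, Lipschitzian maps and adjoints\<close>

lemma hilbert_subspace_direct_sum:
  fixes H :: "'i::finite \<Rightarrow> 'h::real_inner set"
  assumes "\<And>i. hilbert_subspace (H i)"
  shows "hilbert_subspace (direct_sum H)"
  unfolding hilbert_subspace_def
proof
  show "subspace (direct_sum H)"
    using assms
    by (auto simp: direct_sum_def hilbert_subspace_def subspace_def)
  show "complete (direct_sum H)"
    unfolding complete_def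
  proof (intro allI impI, elim conjE)
    fix f assume f: "\<forall>n. f n \<in> direct_sum H" "Cauchy f"
    have "\<exists>l\<in>H i. (\<lambda>n. f n $ i) \<longlonglongrightarrow> l" for i
    proof -
      have "\<forall>n. f n $ i \<in> H i" using f(1) by (simp add: direct_sum_def)
      then show ?thesis
        using completeE[of "H i" "\<lambda>n. f n $ i"] assms[of i] Cauchy_vec_nth[OF f(2), of i]
        unfolding hilbert_subspace_def by metis
    qed
    then obtain l where l: "\<And>i. l i \<in> H i" "\<And>i. (\<lambda>n. f n $ i) \<longlonglongrightarrow> l i" by metis
    then have "f \<longlonglongrightarrow> (\<chi> i. l i)" by (intro vec_tendstoI) simp
    moreover have "(\<chi> i. l i) \<in> direct_sum H" using l(1) by (simp add: direct_sum_def)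
    ultimately show "\<exists>l\<in>direct_sum H. f \<longlonglongrightarrow> l" by blast
  qed
qed

lemma hilbert_subspace_Times:
  assumes "hilbert_subspace S" "hilbert_subspace T"
  shows "hilbert_subspace (S \<times> T)"
  unfolding hilbert_subspace_def
proof
  show "subspace (S \<times> T)"
    using assms by (auto simp: hilbert_subspace_def subspace_def zero_prod_def)
  show "complete (S \<times> T)"
    unfolding complete_def
  proof (intro allI impI, elim conjE)
    fix f :: "nat \<Rightarrow> _" assume f: "\<forall>n. f n \<in> S \<times> T" "Cauchy f"
    have mem: "fst (f n) \<in> S" "snd (f n) \<in> T" for n using f(1) by (auto simp: mem_Times_iff)
    obtain p where p: "p \<in> S" "(\<lambda>n. fst (f n)) \<longlonglongrightarrow> p"
      using completeE[of S "\<lambda>n. fst (f n)"] assms(1) Cauchy_fst[OF f(2)] mem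
      unfolding hilbert_subspace_def by metis
    obtain q where q: "q \<in> T" "(\<lambda>n. snd (f n)) \<longlonglongrightarrow> q"
      using completeE[of T "\<lambda>n. snd (f n)"] assms(2) Cauchy_snd[OF f(2)] mem
      unfolding hilbert_subspace_def by metis
    have "(\<lambda>n. (fst (f n), snd (f n))) \<longlonglongrightarrow> (p, q)" by (intro tendsto_Pair p q)
    then show "\<exists>l\<in>S \<times> T. f \<longlonglongrightarrow> l" using p q by auto
  qed
qed

definition vec_operator :: "('i::finite \<Rightarrow> 'h \<Rightarrow> 'h set) \<Rightarrow> 'h ^ 'i \<Rightarrow> ('h ^ 'i) set" where
  "vec_operator A x = {u. \<forall>i. u $ i \<in> A i (x $ i)}"

definition pair_operator ::
    "('a \<Rightarrow> 'a set) \<Rightarrow> ('b \<Rightarrow> 'b set) \<Rightarrow> 'a \<times> 'b \<Rightarrow> ('a \<times> 'b) set" where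
  "pair_operator A B x = A (fst x) \<times> B (snd x)"

text \<open>
  The constant operator 0, set-valued so that its domain is \<open>S\<close>.
\<close>

definition zero_operator :: "'a::zero set \<Rightarrow> 'a \<Rightarrow> 'a set" where
  "zero_operator S x = (if x \<in> S then {0} else {})"

text \<open>
  Maximality in a form that adds up over components: a witness with nonpositive product always exists,
  and it can be chosen strictly negative unless the pair is in the graph.
\<close>

lemma maximally_monotone_on_violation:
  assumes "maximally_monotone_on S A" "u \<in> S" "w \<in> S"
  shows "\<exists>y v. v \<in> A y \<and> inner (u - y) (w - v) \<le> 0 \<and> (w \<notin> A u \<longrightarrow> inner (u - y) (w - v) < 0)"
proof (cases "w \<in> A u")
  case True
  then show ?thesis by (intro exI[of _ u] exI[of _ w]) simp
next
  case False
  then have "\<not> (\<forall>y v. v \<in> A y \<longrightarrow> 0 \<le> inner (u - y) (w - v))"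
    using maximally_monotone_on_mem[OF assms] by blast
  then show ?thesis by (auto simp: not_le intro: less_imp_le)
qed

text \<open>
  If some component of \<open>(u, w)\<close> were outside its graph, the componentwise witnesses would together
  violate monotonicity.
\<close>

lemma maximally_monotone_on_vec_operator:
  fixes A :: "'i::finite \<Rightarrow> 'h::real_inner \<Rightarrow> 'h set"
  assumes A: "\<And>i. maximally_monotone_on (H i) (A i)"
  shows "maximally_monotone_on (direct_sum H) (vec_operator A)"
proof (rule maximally_monotone_onI)
  show "operator_on (direct_sum H) (vec_operator A)"
    using A unfolding maximally_monotone_on_def operator_on_def direct_sum_def vec_operator_def
    by blast
  show "monotone_operator (vec_operator A)"
    unfolding monotone_operator_def
  proof (intro allI ballI)
    fix x y u v assume "u \<in> vec_operator A x" "v \<in> vec_operator A y"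
    then have "0 \<le> inner (x $ i - y $ i) (u $ i - v $ i)" for i
      using A[of i] unfolding maximally_monotone_on_def monotone_operator_def vec_operator_def by blast
    then show "0 \<le> inner (x - y) (u - v)" by (simp add: inner_vec_def sum_nonneg)
  qed
  fix u w assume u: "u \<in> direct_sum H" "w \<in> direct_sum H"
    and rel: "\<And>y v. v \<in> vec_operator A y \<Longrightarrow> 0 \<le> inner (u - y) (w - v)"
  have "\<forall>i. \<exists>y v. v \<in> A i y \<and> inner (u $ i - y) (w $ i - v) \<le> 0 \<and>
      (w $ i \<notin> A i (u $ i) \<longrightarrow> inner (u $ i - y) (w $ i - v) < 0)"
    using maximally_monotone_on_violation[OF A] u by (auto simp: direct_sum_def)
  then obtain y v where yv: "\<And>i. v i \<in> A i (y i)" "\<And>i. inner (u $ i - y i) (w $ i - v i) \<le> 0"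
      "\<And>i. w $ i \<notin> A i (u $ i) \<Longrightarrow> inner (u $ i - y i) (w $ i - v i) < 0"
    by metis
  have "0 \<le> inner (u - (\<chi> i. y i)) (w - (\<chi> i. v i))"
    using yv(1) by (intro rel) (simp add: vec_operator_def)
  then have "0 \<le> (\<Sum>i\<in>UNIV. inner (u $ i - y i) (w $ i - v i))" by (simp add: inner_vec_def)
  moreover have "(\<Sum>i\<in>UNIV. inner (u $ i - y i) (w $ i - v i)) < 0" if "w $ j \<notin> A j (u $ j)" for j
    using sum_strict_mono_ex1[of UNIV "\<lambda>i. inner (u $ i - y i) (w $ i - v i)" "\<lambda>_. 0"] yv(2) yv(3)[OF that]
    by auto
  ultimately show "w \<in> vec_operator A u" unfolding vec_operator_def by fastforce
qed

lemma maximally_monotone_on_pair_operator: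
  fixes A :: "'a::real_inner \<Rightarrow> 'a set" and B :: "'b::real_inner \<Rightarrow> 'b set"
  assumes A: "maximally_monotone_on S A" and B: "maximally_monotone_on T B"
  shows "maximally_monotone_on (S \<times> T) (pair_operator A B)"
proof (rule maximally_monotone_onI)
  show "operator_on (S \<times> T) (pair_operator A B)"
    using A B unfolding maximally_monotone_on_def operator_on_def pair_operator_def
    by (auto simp: mem_Times_iff)
  show "monotone_operator (pair_operator A B)"
    unfolding monotone_operator_def
  proof (intro allI ballI)
    fix x y u v assume "u \<in> pair_operator A B x" "v \<in> pair_operator A B y"
    then have "0 \<le> inner (fst x - fst y) (fst u - fst v)" "0 \<le> inner (snd x - snd y) (snd u - snd v)"
      using A B unfolding maximally_monotone_on_def monotone_operator_def pair_operator_def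
      by (auto simp: mem_Times_iff)
    then show "0 \<le> inner (x - y) (u - v)" by (simp add: inner_prod_def)
  qed
  fix u w assume u: "u \<in> S \<times> T" "w \<in> S \<times> T"
    and rel: "\<And>y v. v \<in> pair_operator A B y \<Longrightarrow> 0 \<le> inner (u - y) (w - v)"
  obtain y v where yv: "v \<in> A y" "inner (fst u - y) (fst w - v) \<le> 0"
      "fst w \<notin> A (fst u) \<longrightarrow> inner (fst u - y) (fst w - v) < 0"
    using maximally_monotone_on_violation[OF A, of "fst u" "fst w"] u by (auto simp: mem_Times_iff)
  obtain y' v' where yv': "v' \<in> B y'" "inner (snd u - y') (snd w - v') \<le> 0"
      "snd w \<notin> B (snd u) \<longrightarrow> inner (snd u - y') (snd w - v') < 0"
    using maximally_monotone_on_violation[OF B, of "snd u" "snd w"] u by (auto simp: mem_Times_iff)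
  have "0 \<le> inner (u - (y, y')) (w - (v, v'))"
    using yv(1) yv'(1) by (intro rel) (simp add: pair_operator_def)
  then have "0 \<le> inner (fst u - y) (fst w - v) + inner (snd u - y') (snd w - v')"
    by (simp add: inner_prod_def)
  then have "fst w \<in> A (fst u) \<and> snd w \<in> B (snd u)" using yv yv' by linarith
  then show "w \<in> pair_operator A B u" by (simp add: pair_operator_def mem_Times_iff)
qed

lemma maximally_monotone_on_zero_operator:
  assumes S: "subspace S"
  shows "maximally_monotone_on S (zero_operator S)"
proof (rule maximally_monotone_onI)
  show "operator_on S (zero_operator S)" "monotone_operator (zero_operator S)"
    using subspace_0[OF S]
    by (auto simp: operator_on_def monotone_operator_def zero_operator_def split: if_splits)
  fix u w assume u: "u \<in> S" "w \<in> S"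
    and rel: "\<And>y v. v \<in> zero_operator S y \<Longrightarrow> 0 \<le> inner (u - y) (w - v)"
  have "u + w \<in> S" using S u by (simp add: subspace_add)
  then have "0 \<le> inner (u - (u + w)) (w - 0)" by (intro rel) (simp add: zero_operator_def)
  then have "inner w w = 0" using inner_ge_zero[of w] by simp
  then have "w = 0" by simp
  then show "w \<in> zero_operator S u" using u by (simp add: zero_operator_def)
qed

text \<open>
  Only the existence of a Lipschitz constant matters for the coupling map below; leaving it implicit
  makes composition rules usable as introduction rules.
\<close>

definition lipschitz_map_on :: "'a::metric_space set \<Rightarrow> ('a \<Rightarrow> 'b::metric_space) \<Rightarrow> bool" where
  "lipschitz_map_on S f \<longleftrightarrow> (\<exists>c. c-lipschitz_on S f)"

lemma lipschitz_map_onI: "c-lipschitz_on S f \<Longrightarrow> lipschitz_map_on S f"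
  by (auto simp: lipschitz_map_on_def)

lemma lipschitz_map_on_const: "lipschitz_map_on S (\<lambda>_. c)"
  using lipschitz_map_onI[OF lipschitz_on_constant] .

lemma lipschitz_map_on_add:
  fixes f g :: "'a::metric_space \<Rightarrow> 'b::real_normed_vector"
  assumes "lipschitz_map_on S f" "lipschitz_map_on S g"
  shows "lipschitz_map_on S (\<lambda>x. f x + g x)"
  using assms lipschitz_on_add unfolding lipschitz_map_on_def by blast

lemma lipschitz_map_on_diff:
  fixes f g :: "'a::metric_space \<Rightarrow> 'b::real_normed_vector"
  assumes "lipschitz_map_on S f" "lipschitz_map_on S g"
  shows "lipschitz_map_on S (\<lambda>x. f x - g x)"
  using assms lipschitz_on_diff unfolding lipschitz_map_on_def by blast

lemma lipschitz_map_on_sum: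
  fixes f :: "'i \<Rightarrow> 'a::metric_space \<Rightarrow> 'b::real_normed_vector"
  assumes "\<And>i. lipschitz_map_on S (f i)"
  shows "lipschitz_map_on S (\<lambda>x. \<Sum>i\<in>I. f i x)"
  by (induction I rule: infinite_finite_induct) (auto intro: lipschitz_map_on_const lipschitz_map_on_add assms)

lemma lipschitz_map_on_Pair:
  assumes "lipschitz_map_on S f" "lipschitz_map_on S g"
  shows "lipschitz_map_on S (\<lambda>x. (f x, g x))"
  using assms lipschitz_on_Pair unfolding lipschitz_map_on_def by blast

lemma lipschitz_map_on_compose:
  assumes "lipschitz_map_on T f" "lipschitz_map_on S g" "\<And>x. x \<in> S \<Longrightarrow> g x \<in> T"
  shows "lipschitz_map_on S (\<lambda>x. f (g x))"
proof -
  obtain c d where "c-lipschitz_on T f" "d-lipschitz_on S g"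
    using assms by (auto simp: lipschitz_map_on_def)
  then have "(c * d)-lipschitz_on S (\<lambda>x. f (g x))"
    using assms(3) by (intro lipschitz_on_compose2[of d S g c f]) (auto intro: lipschitz_on_subset)
  then show ?thesis by (rule lipschitz_map_onI)
qed

lemma lipschitz_map_on_dist_le:
  assumes "lipschitz_map_on S f" "\<And>x y. dist (g x) (g y) \<le> dist (f x) (f y)"
  shows "lipschitz_map_on S g"
proof -
  obtain c where c: "c-lipschitz_on S f" using assms(1) by (auto simp: lipschitz_map_on_def)
  have "c-lipschitz_on S g"
  proof (rule lipschitz_onI)
    show "0 \<le> c" using c by (rule lipschitz_on_nonneg)
    show "dist (g x) (g y) \<le> c * dist x y" if "x \<in> S" "y \<in> S" for x y
      using assms(2) lipschitz_onD[OF c that] by (rule order_trans)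
  qed
  then show ?thesis by (rule lipschitz_map_onI)
qed

lemma lipschitz_map_on_fst: "lipschitz_map_on S f \<Longrightarrow> lipschitz_map_on S (\<lambda>x. fst (f x))"
  by (erule lipschitz_map_on_dist_le) (rule dist_fst_le)

lemma lipschitz_map_on_snd: "lipschitz_map_on S f \<Longrightarrow> lipschitz_map_on S (\<lambda>x. snd (f x))"
  by (erule lipschitz_map_on_dist_le) (rule dist_snd_le)

lemma lipschitz_map_on_nth: "lipschitz_map_on S f \<Longrightarrow> lipschitz_map_on S (\<lambda>x. f x $ i)"
  by (erule lipschitz_map_on_dist_le) (rule dist_vec_nth_le)

lemma lipschitz_map_on_vec:
  fixes f :: "'i::finite \<Rightarrow> 'a::metric_space \<Rightarrow> 'b::real_normed_vector"
  assumes "\<And>i. lipschitz_map_on S (f i)"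
  shows "lipschitz_map_on S (\<lambda>x. \<chi> i. f i x)"
proof -
  obtain c where c: "\<And>i. (c i)-lipschitz_on S (f i)"
    using assms unfolding lipschitz_map_on_def by metis
  have "(\<Sum>i\<in>UNIV. c i)-lipschitz_on S (\<lambda>x. \<chi> i. f i x)"
  proof (rule lipschitz_onI)
    show "0 \<le> (\<Sum>i\<in>UNIV. c i)" using lipschitz_on_nonneg[OF c] by (simp add: sum_nonneg)
    fix x y assume xy: "x \<in> S" "y \<in> S"
    have "dist (\<chi> i. f i x) (\<chi> i. f i y) \<le> (\<Sum>i\<in>UNIV. dist (f i x) (f i y))"
      using L2_set_le_sum[of UNIV "\<lambda>i. dist (f i x) (f i y)"] by (simp add: dist_vec_def)
    also have "\<dots> \<le> (\<Sum>i\<in>UNIV. c i * dist x y)"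
      using lipschitz_onD[OF c xy] by (intro sum_mono) simp
    finally show "dist (\<chi> i. f i x) (\<chi> i. f i y) \<le> (\<Sum>i\<in>UNIV. c i) * dist x y"
      by (simp add: sum_distrib_right)
  qed
  then show ?thesis by (rule lipschitz_map_onI)
qed

lemma bounded_linear_between_diff:
  assumes S: "subspace S" and L: "bounded_linear_between S T L" and "x \<in> S" "y \<in> S"
  shows "L (x - y) = L x - L y"
proof -
  have "L (x + (- 1) *\<^sub>R y) = L x + L ((- 1) *\<^sub>R y)"
    using L assms(3) subspace_scale[OF S assms(4)] unfolding bounded_linear_between_def by blast
  also have "L ((- 1) *\<^sub>R y) = (- 1) *\<^sub>R L y"
    using L assms(4) unfolding bounded_linear_between_def by blast
  finally show ?thesis by simp
qed

lemma bounded_linear_between_bound: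
  assumes "bounded_linear_between S T L"
  obtains M where "0 \<le> M" "\<And>x. x \<in> S \<Longrightarrow> norm (L x) \<le> M * norm x"
proof -
  obtain M where M: "\<And>x. x \<in> S \<Longrightarrow> norm (L x) \<le> M * norm x"
    using assms unfolding bounded_linear_between_def by blast
  have "norm (L x) \<le> \<bar>M\<bar> * norm x" if "x \<in> S" for x
    using M[OF that] mult_right_mono[OF abs_ge_self[of M] norm_ge_zero[of x]] by (rule order_trans)
  then show ?thesis using that[of "\<bar>M\<bar>"] by simp
qed

lemma lipschitz_map_on_bounded_linear_between:
  assumes S: "subspace S" and L: "bounded_linear_between S T L"
  shows "lipschitz_map_on S L"
proof -
  obtain M where M: "0 \<le> M" "\<And>x. x \<in> S \<Longrightarrow> norm (L x) \<le> M * norm x"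
    by (rule bounded_linear_between_bound[OF L]) blast
  have "M-lipschitz_on S L"
  proof (rule lipschitz_onI)
    fix x y assume xy: "x \<in> S" "y \<in> S"
    have "norm (L x - L y) = norm (L (x - y))"
      by (simp add: bounded_linear_between_diff[OF S L xy])
    also have "\<dots> \<le> M * norm (x - y)"
      using M(2)[OF subspace_diff[OF S xy]] by simp
    finally show "dist (L x) (L y) \<le> M * dist x y" by (simp add: dist_norm)
  qed (rule M(1))
  then show ?thesis by (rule lipschitz_map_onI)
qed

text \<open>
  The Riesz representation theorem makes the definite description in \<open>adjoint_on\<close> meaningful.
\<close>

lemma adjoint_on_props:
  assumes S: "hilbert_subspace S" and L: "bounded_linear_between S T L"
  shows "adjoint_on S L v \<in> S" and "\<And>x. x \<in> S \<Longrightarrow> inner x (adjoint_on S L v) = inner (L x) v"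
proof -
  have sub: "subspace S" using S by (simp add: hilbert_subspace_def)
  obtain M where M: "0 \<le> M" "\<And>x. x \<in> S \<Longrightarrow> norm (L x) \<le> M * norm x"
    by (rule bounded_linear_between_bound[OF L]) blast
  obtain u where u: "u \<in> S" "\<And>x. x \<in> S \<Longrightarrow> inner (L x) v = inner x u"
  proof (rule riesz_on[OF S, of "\<lambda>x. inner (L x) v" "M * norm v"])
    fix x y assume "x \<in> S" "y \<in> S"
    then show "inner (L (x + y)) v = inner (L x) v + inner (L y) v"
      using L unfolding bounded_linear_between_def by (simp add: inner_add_left)
  next
    fix c x assume "x \<in> S"
    then show "inner (L (c *\<^sub>R x)) v = c * inner (L x) v"
      using L unfolding bounded_linear_between_def by simp
  next
    fix x assume "x \<in> S"
    then show "\<bar>inner (L x) v\<bar> \<le> M * norm v * norm x"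
      using Cauchy_Schwarz_ineq2[of "L x" v] mult_right_mono[OF M(2)[of x], of "norm v"]
      by (simp add: mult_ac)
  next
    fix u assume "u \<in> S" "\<And>x. x \<in> S \<Longrightarrow> inner (L x) v = inner x u"
    then show thesis by (rule that)
  qed
  have "u' = u" if "u' \<in> S" "\<And>x. x \<in> S \<Longrightarrow> inner (L x) v = inner x u'" for u'
  proof -
    have "u' - u \<in> S" using sub that(1) u(1) by (simp add: subspace_diff)
    then have "inner (u' - u) (u' - u) = 0" using that(2) u(2) by (simp add: inner_diff_right)
    then show ?thesis by simp
  qed
  then have "\<exists>!u. u \<in> S \<and> (\<forall>x\<in>S. inner (L x) v = inner x u)" using u by blast
  from theI'[OF this] show "adjoint_on S L v \<in> S"
    "\<And>x. x \<in> S \<Longrightarrow> inner x (adjoint_on S L v) = inner (L x) v"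
    unfolding adjoint_on_def by auto
qed

lemma lipschitz_map_on_adjoint_on:
  assumes S: "hilbert_subspace S" and L: "bounded_linear_between S T L"
  shows "lipschitz_map_on V (adjoint_on S L)"
proof -
  have sub: "subspace S" using S by (simp add: hilbert_subspace_def)
  obtain M where M: "0 \<le> M" "\<And>x. x \<in> S \<Longrightarrow> norm (L x) \<le> M * norm x"
    by (rule bounded_linear_between_bound[OF L]) blast
  have "M-lipschitz_on V (adjoint_on S L)"
  proof (rule lipschitz_onI)
    fix v w
    define d where "d = adjoint_on S L v - adjoint_on S L w"
    have d: "d \<in> S" using adjoint_on_props(1)[OF S L] sub by (simp add: d_def subspace_diff)
    have "(norm d)\<^sup>2 = inner d (adjoint_on S L v) - inner d (adjoint_on S L w)"
      by (simp add: power2_norm_eq_inner inner_diff_right[symmetric] d_def[symmetric])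
    also have "\<dots> = inner (L d) (v - w)"
      using adjoint_on_props(2)[OF S L d] by (simp add: inner_diff_right)
    also have "\<dots> \<le> norm (L d) * norm (v - w)" by (rule norm_cauchy_schwarz)
    also have "\<dots> \<le> (M * norm d) * norm (v - w)"
      using M(2)[OF d] by (intro mult_right_mono) auto
    finally have key: "norm d * norm d \<le> norm d * (M * norm (v - w))"
      by (simp add: power2_eq_square mult_ac)
    then have "norm d \<le> M * norm (v - w)"
    proof (cases "norm d = 0")
      case True
      then show ?thesis
        using mult_nonneg_nonneg[OF M(1) norm_ge_zero[of "v - w"]] by linarith
    next
      case False
      then have "0 < norm d" by simp
      with key show ?thesis by (rule mult_left_le_imp_le)
    qed
    then show "dist (adjoint_on S L v) (adjoint_on S L w) \<le> M * dist v w"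
      by (simp add: dist_norm d_def)
  qed (rule M(1))
  then show ?thesis by (rule lipschitz_map_onI)
qed

section \<open>Block updates and bounded delays\<close>

definition last_update :: "(nat \<Rightarrow> 'a set) \<Rightarrow> 'a \<Rightarrow> nat \<Rightarrow> nat" where
  "last_update J i n = (GREATEST j. j \<le> n \<and> i \<in> J j)"

lemma last_update_props:
  assumes "J 0 = UNIV"
  shows "last_update J i n \<le> n" and "i \<in> J (last_update J i n)"
    and "\<And>j. last_update J i n < j \<Longrightarrow> j \<le> n \<Longrightarrow> i \<notin> J j"
proof -
  let ?P = "\<lambda>j. j \<le> n \<and> i \<in> J j"
  have "?P (last_update J i n)"
    unfolding last_update_def by (rule GreatestI_nat[of ?P 0 n]) (use assms in auto)
  then show "last_update J i n \<le> n" "i \<in> J (last_update J i n)" by auto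
  show "i \<notin> J j" if "last_update J i n < j" "j \<le> n" for j
  proof
    assume "i \<in> J j"
    then have "j \<le> last_update J i n"
      unfolding last_update_def using that(2) by (intro Greatest_le_nat[of ?P j n]) auto
    with that(1) show False by simp
  qed
qed

lemma last_update_window:
  assumes "J 0 = UNIV" "\<And>n. (\<Union>j\<in>{n..n + P}. J j) = UNIV"
  shows "n \<le> last_update J i n + P"
proof (rule ccontr)
  assume less: "\<not> n \<le> last_update J i n + P"
  have "i \<in> (\<Union>j\<in>{n - P..n - P + P}. J j)" using assms(2) by blast
  then obtain j where "n - P \<le> j" "j \<le> n" "i \<in> J j" using less by auto
  with last_update_props(3)[of J i n j] assms(1) less show False by force
qed

lemma unchanged_since_last_update:
  assumes "J 0 = UNIV" "\<And>n. i \<notin> J (Suc n) \<Longrightarrow> f (Suc n) = f n"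
  shows "f n = f (last_update J i n)"
proof -
  have "last_update J i n + j \<le> n \<Longrightarrow> f (last_update J i n + j) = f (last_update J i n)" for j
  proof (induction j)
    case (Suc j)
    have "i \<notin> J (Suc (last_update J i n + j))"
      using last_update_props(3)[where J = J, OF assms(1), of i n "Suc (last_update J i n + j)"]
        Suc.prems by simp
    from assms(2)[OF this] Suc show ?case by simp
  qed simp
  from this[of "n - last_update J i n"] show ?thesis
    using last_update_props(1)[where J = J, OF assms(1), of i n] by simp
qed

text \<open>
  A bounded number of vanishing steps vanishes.
\<close>

lemma delayed_difference_null:
  fixes X :: "nat \<Rightarrow> 'a::real_normed_vector"
  assumes X: "(\<lambda>n. X (Suc n) - X n) \<longlonglongrightarrow> 0" and \<delta>: "\<And>n. \<delta> n \<le> n" "\<And>n. n \<le> \<delta> n + m"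
  shows "(\<lambda>n. X (\<delta> n) - X n) \<longlonglongrightarrow> 0"
proof (rule Lim_null_comparison)
  show "\<forall>\<^sub>F n in sequentially. norm (X (\<delta> n) - X n) \<le> (\<Sum>j<m. norm (X (n - j) - X (n - Suc j)))"
  proof (intro always_eventually allI)
    fix n
    have "X n - X (\<delta> n) = (\<Sum>j<n - \<delta> n. X (n - j) - X (n - Suc j))"
      using \<delta>(1)[of n] sum_lessThan_telescope'[of "\<lambda>j. X (n - j)" "n - \<delta> n"] by simp
    then have "norm (X (\<delta> n) - X n) \<le> (\<Sum>j<n - \<delta> n. norm (X (n - j) - X (n - Suc j)))"
      by (metis norm_minus_commute norm_sum)
    also have "\<dots> \<le> (\<Sum>j<m. norm (X (n - j) - X (n - Suc j)))"
      using \<delta>(2)[of n] by (intro sum_mono2) auto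
    finally show "norm (X (\<delta> n) - X n) \<le> (\<Sum>j<m. norm (X (n - j) - X (n - Suc j)))" .
  qed
  have "(\<lambda>n. X (n - j) - X (n - Suc j)) \<longlonglongrightarrow> 0" for j
    by (rule LIMSEQ_offset[where k = "Suc j"]) (use X in \<open>simp add: Suc_diff_le\<close>)
  then show "(\<lambda>n. \<Sum>j<m. norm (X (n - j) - X (n - Suc j))) \<longlonglongrightarrow> 0"
    by (intro tendsto_null_sum tendsto_norm_zero)
qed

lemma lipschitz_map_on_difference_null:
  fixes f :: "'a::real_normed_vector \<Rightarrow> 'b::real_normed_vector"
  assumes f: "lipschitz_map_on S f" and mem: "\<And>n. p n \<in> S" "\<And>n. q n \<in> S"
    and null: "((\<lambda>n. p n - q n) \<longlongrightarrow> 0) F"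
  shows "((\<lambda>n. f (p n) - f (q n)) \<longlongrightarrow> 0) F"
proof -
  obtain c where c: "c-lipschitz_on S f" using f by (auto simp: lipschitz_map_on_def)
  show ?thesis
  proof (rule Lim_null_comparison)
    show "\<forall>\<^sub>F n in F. norm (f (p n) - f (q n)) \<le> c * norm (p n - q n)"
      using lipschitz_onD[OF c mem] by (simp add: dist_norm)
    show "((\<lambda>n. c * norm (p n - q n)) \<longlongrightarrow> 0) F"
      using null by (intro tendsto_mult_right_zero tendsto_norm_zero)
  qed
qed

lemma scaled_difference_null:
  fixes d :: "'b \<Rightarrow> 'a::real_normed_vector"
  assumes "(d \<longlongrightarrow> 0) F" "\<And>n. \<bar>c n\<bar> \<le> K"
  shows "((\<lambda>n. c n *\<^sub>R d n) \<longlongrightarrow> 0) F"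
proof (rule Lim_null_comparison)
  show "\<forall>\<^sub>F n in F. norm (c n *\<^sub>R d n) \<le> K * norm (d n)"
    using assms(2) by (simp add: mult_right_mono)
  show "((\<lambda>n. K * norm (d n)) \<longlongrightarrow> 0) F"
    using assms(1) by (intro tendsto_mult_right_zero tendsto_norm_zero)
qed

section \<open>The saddle operator\<close>

type_synonym ('h, 'i, 'g, 'k) saddle_vector =
  "('h ^ 'i) \<times> ('g ^ 'k) \<times> ('g ^ 'k) \<times> ('g ^ 'k)"

lemma inner_le_lipschitz:
  assumes "c-lipschitz_on S f" "p \<in> S" "q \<in> S"
  shows "inner (p - q) (f p - f q) \<le> c * (norm (p - q))\<^sup>2"
proof -
  have "inner (p - q) (f p - f q) \<le> norm (p - q) * norm (f p - f q)" by (rule norm_cauchy_schwarz)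
  also have "\<dots> \<le> norm (p - q) * (c * norm (p - q))"
    using lipschitz_onD[OF assms] by (intro mult_left_mono) (simp_all add: dist_norm)
  finally show ?thesis by (simp add: power2_eq_square mult_ac)
qed

lemma norm_vec_square: "(norm (x :: 'c::real_inner ^ 'd::finite))\<^sup>2 = (\<Sum>i\<in>UNIV. (norm (x $ i))\<^sup>2)"
  by (simp add: power2_norm_eq_inner inner_vec_def)

lemma norm_Pair_square:
  "(norm (x, y, z, v))\<^sup>2 = (norm x)\<^sup>2 + (norm y)\<^sup>2 + (norm z)\<^sup>2 + (norm v)\<^sup>2"
  by (simp add: norm_Pair)

definition drop_dual ::
    "('h::real_inner, 'i::finite, 'g::real_inner, 'k::finite) saddle_vector \<Rightarrow> ('h, 'i, 'g, 'k) saddle_vector" where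
  "drop_dual u = (case u of (x, y, z, v) \<Rightarrow> (x, y, z, 0))"

lemma drop_dual: "linear drop_dual" "norm (drop_dual u) \<le> norm u"
proof -
  show "linear drop_dual" by (rule linearI) (auto simp: drop_dual_def split: prod.splits)
  show "norm (drop_dual u) \<le> norm u"
  proof (rule power2_le_imp_le)
    show "(norm (drop_dual u))\<^sup>2 \<le> (norm u)\<^sup>2"
      by (cases u) (simp add: drop_dual_def norm_Pair_square)
  qed simp
qed

text \<open>
  The step sizes enter as a diagonal map, with the inverse of a step size as the weight of its block.
\<close>

definition weight ::
    "('i \<Rightarrow> real) \<Rightarrow> ('k \<Rightarrow> real) \<Rightarrow> ('k \<Rightarrow> real) \<Rightarrow> ('k \<Rightarrow> real) \<Rightarrow>
     ('h::real_inner, 'i::finite, 'g::real_inner, 'k::finite) saddle_vector \<Rightarrow> ('h, 'i, 'g, 'k) saddle_vector" where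
  "weight p q t w u = (case u of (x, y, z, v) \<Rightarrow>
     (\<chi> i. p i *\<^sub>R x $ i, \<chi> k. q k *\<^sub>R y $ k, \<chi> k. t k *\<^sub>R z $ k, \<chi> k. w k *\<^sub>R v $ k))"

lemma weight_lipschitz:
  fixes p :: "'i::finite \<Rightarrow> real" and q t w :: "'k::finite \<Rightarrow> real"
    and S :: "('h::real_inner, 'i, 'g::real_inner, 'k) saddle_vector set"
  assumes "\<And>i. \<bar>p i\<bar> \<le> c" "\<And>k. \<bar>q k\<bar> \<le> c" "\<And>k. \<bar>t k\<bar> \<le> c" "\<And>k. \<bar>w k\<bar> \<le> c"
  shows "c-lipschitz_on S (weight p q t w)"
proof (rule lipschitz_onI)
  show c: "0 \<le> c" using assms(1) abs_ge_zero order_trans by blast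
  fix u u' :: "('h, 'i, 'g, 'k) saddle_vector"
  have vec: "(norm (\<chi> i. f i *\<^sub>R d $ i))\<^sup>2 \<le> c\<^sup>2 * (norm d)\<^sup>2"
    if "\<And>i. \<bar>f i\<bar> \<le> c" for f :: "'d::finite \<Rightarrow> real" and d :: "'c::real_inner ^ 'd"
  proof -
    have "(f i)\<^sup>2 \<le> c\<^sup>2" for i using that[of i] by (metis abs_le_square_iff abs_of_nonneg c)
    then show ?thesis
      by (simp add: norm_vec_square sum_distrib_left power_mult_distrib sum_mono mult_right_mono)
  qed
  have "norm (weight p q t w (u - u')) \<le> c * norm (u - u')"
  proof (rule power2_le_imp_le)
    obtain x y z v where u: "u - u' = (x, y, z, v)" by (cases "u - u'") auto
    show "(norm (weight p q t w (u - u')))\<^sup>2 \<le> (c * norm (u - u'))\<^sup>2"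
      using vec[of p x, OF assms(1)] vec[of q y, OF assms(2)] vec[of t z, OF assms(3)] vec[of w v, OF assms(4)]
      by (simp add: u weight_def norm_Pair_square power_mult_distrib distrib_left)
  qed (simp add: c)
  moreover have "weight p q t w (u - u') = weight p q t w u - weight p q t w u'"
    by (cases u; cases u') (simp add: weight_def vec_eq_iff scaleR_diff_right)
  ultimately show "dist (weight p q t w u) (weight p q t w u') \<le> c * dist u u'" by (simp add: dist_norm)
qed

text \<open>
  Vectors are quadruples \<open>(x, y, z, v)\<close> of a primal variable \<open>x\<close>, a dual variable \<open>v\<close>, and a
  splitting \<open>y + z\<close> of the argument of the parallel sums. The saddle operator on them is the sum of
  \<open>maximal_part\<close>, \<open>lipschitz_part\<close> and \<open>cocoercive_part\<close>; its zeros are the Kuhn--Tucker points,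
  with the splitting made explicit. The linear coupling is placed in \<open>lipschitz_part\<close>, where it is skew.
\<close>

locale kuhn_tucker_problem =
  fixes H :: "'i::finite \<Rightarrow> 'h::real_inner set" and G :: "'k::finite \<Rightarrow> 'g::real_inner set"
    and s :: "'i \<Rightarrow> 'h" and r :: "'k \<Rightarrow> 'g"
    and A :: "'i \<Rightarrow> 'h \<Rightarrow> 'h set" and C Q :: "'i \<Rightarrow> 'h \<Rightarrow> 'h" and R :: "'i \<Rightarrow> 'h ^ 'i \<Rightarrow> 'h"
    and Bm Dm :: "'k \<Rightarrow> 'g \<Rightarrow> 'g set" and Bc Bl Dc Dl :: "'k \<Rightarrow> 'g \<Rightarrow> 'g"
    and L :: "'k \<Rightarrow> 'i \<Rightarrow> 'h \<Rightarrow> 'g"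
    and \<alpha>c \<alpha>l :: "'i \<Rightarrow> real" and \<beta>c \<beta>l \<delta>c \<delta>l :: "'k \<Rightarrow> real" and chi \<alpha> :: real
  assumes H: "\<And>i. hilbert_subspace (H i)"
    and G: "\<And>k. hilbert_subspace (G k)"
    and s: "\<And>i. s i \<in> H i"
    and r: "\<And>k. r k \<in> G k"
    and A: "\<And>i. maximally_monotone_on (H i) (A i)"
    and C: "\<And>i. C i \<in> H i \<rightarrow> H i" "\<And>i. cocoercive_on (\<alpha>c i) (H i) (C i)"
    and Q: "\<And>i. Q i \<in> H i \<rightarrow> H i" "\<And>i. monotone_map_on (H i) (Q i)"
      "\<And>i. (\<alpha>l i)-lipschitz_on (H i) (Q i)"
    and R: "\<And>i. R i \<in> direct_sum H \<rightarrow> H i"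
      "monotone_map_on (direct_sum H) (\<lambda>x. \<chi> i. R i x)"
      "chi-lipschitz_on (direct_sum H) (\<lambda>x. \<chi> i. R i x)"
    and Bm: "\<And>k. maximally_monotone_on (G k) (Bm k)"
    and Bc: "\<And>k. Bc k \<in> G k \<rightarrow> G k" "\<And>k. cocoercive_on (\<beta>c k) (G k) (Bc k)"
    and Bl: "\<And>k. Bl k \<in> G k \<rightarrow> G k" "\<And>k. monotone_map_on (G k) (Bl k)"
      "\<And>k. (\<beta>l k)-lipschitz_on (G k) (Bl k)"
    and Dm: "\<And>k. maximally_monotone_on (G k) (Dm k)"
    and Dc: "\<And>k. Dc k \<in> G k \<rightarrow> G k" "\<And>k. cocoercive_on (\<delta>c k) (G k) (Dc k)"
    and Dl: "\<And>k. Dl k \<in> G k \<rightarrow> G k" "\<And>k. monotone_map_on (G k) (Dl k)"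
      "\<And>k. (\<delta>l k)-lipschitz_on (G k) (Dl k)"
    and L: "\<And>k i. bounded_linear_between (H i) (G k) (L k i)"
    and \<alpha>: "0 < \<alpha>" "\<And>i. \<alpha> \<le> \<alpha>c i" "\<And>k. \<alpha> \<le> \<beta>c k" "\<And>k. \<alpha> \<le> \<delta>c k"
begin

abbreviation Ls :: "'k \<Rightarrow> 'i \<Rightarrow> 'g \<Rightarrow> 'h" where
  "Ls k i \<equiv> adjoint_on (H i) (L k i)"

definition saddle_space :: "('h, 'i, 'g, 'k) saddle_vector set" where
  "saddle_space = direct_sum H \<times> direct_sum G \<times> direct_sum G \<times> direct_sum G"

definition maximal_part ::
    "('h, 'i, 'g, 'k) saddle_vector \<Rightarrow> ('h, 'i, 'g, 'k) saddle_vector set" where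
  "maximal_part = pair_operator (vec_operator A) (pair_operator (vec_operator Bm)
     (pair_operator (vec_operator Dm) (zero_operator (direct_sum G))))"

definition lipschitz_part ::
    "('h, 'i, 'g, 'k) saddle_vector \<Rightarrow> ('h, 'i, 'g, 'k) saddle_vector" where
  "lipschitz_part u = (case u of (x, y, z, v) \<Rightarrow>
     (\<chi> i. Q i (x $ i) + R i x + (\<Sum>k\<in>UNIV. Ls k i (v $ k)) - s i,
      \<chi> k. Bl k (y $ k) - v $ k,
      \<chi> k. Dl k (z $ k) - v $ k,
      \<chi> k. r k + y $ k + z $ k - (\<Sum>i\<in>UNIV. L k i (x $ i))))"

definition cocoercive_part ::
    "('h, 'i, 'g, 'k) saddle_vector \<Rightarrow> ('h, 'i, 'g, 'k) saddle_vector" where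
  "cocoercive_part u = (case u of (x, y, z, v) \<Rightarrow>
     (\<chi> i. C i (x $ i), \<chi> k. Bc k (y $ k), \<chi> k. Dc k (z $ k), 0))"

lemma sub_H: "subspace (H i)" and sub_G: "subspace (G k)"
  using H G by (simp_all add: hilbert_subspace_def)

lemma mem_saddle_space:
  "(x, y, z, v) \<in> saddle_space \<longleftrightarrow> (\<forall>i. x $ i \<in> H i) \<and> (\<forall>k. y $ k \<in> G k) \<and> (\<forall>k. z $ k \<in> G k) \<and> (\<forall>k. v $ k \<in> G k)"
  by (auto simp: saddle_space_def direct_sum_def)

lemma saddle_space: "hilbert_subspace saddle_space"
  unfolding saddle_space_def using H G by (intro hilbert_subspace_Times hilbert_subspace_direct_sum)

lemma subspace_saddle_space: "subspace saddle_space"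
  using saddle_space by (simp add: hilbert_subspace_def)

lemma maximal_part: "maximally_monotone_on saddle_space maximal_part"
proof -
  have "subspace (direct_sum G)"
    using hilbert_subspace_direct_sum[of G, OF G] by (simp add: hilbert_subspace_def)
  then show ?thesis
    unfolding saddle_space_def maximal_part_def
    by (intro maximally_monotone_on_pair_operator maximally_monotone_on_vec_operator
        maximally_monotone_on_zero_operator A Bm Dm)
qed

lemma Ls_mem: "Ls k i v \<in> H i"
  by (rule adjoint_on_props(1)[OF H L])

lemma inner_Ls: "x \<in> H i \<Longrightarrow> inner x (Ls k i v) = inner (L k i x) v"
  by (rule adjoint_on_props(2)[OF H L])

lemma L_mem: "x \<in> H i \<Longrightarrow> L k i x \<in> G k"
  using L unfolding bounded_linear_between_def by blast

lemma lipschitz_part_mem: "lipschitz_part \<in> saddle_space \<rightarrow> saddle_space"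
proof
  fix u assume u: "u \<in> saddle_space"
  obtain x y z v where [simp]: "u = (x, y, z, v)" by (cases u) auto
  from u have mem: "\<And>i. x $ i \<in> H i" "x \<in> direct_sum H" "\<And>k. y $ k \<in> G k" "\<And>k. z $ k \<in> G k" "\<And>k. v $ k \<in> G k"
    by (auto simp: mem_saddle_space direct_sum_def)
  have "Q i (x $ i) + R i x + (\<Sum>k\<in>UNIV. Ls k i (v $ k)) - s i \<in> H i" for i
    by (intro subspace_add subspace_diff subspace_sum sub_H Ls_mem s funcset_mem[OF Q(1)]
        funcset_mem[OF R(1)] mem)
  moreover have "Bl k (y $ k) - v $ k \<in> G k" "Dl k (z $ k) - v $ k \<in> G k" for k
    by (intro subspace_diff sub_G funcset_mem[OF Bl(1)] funcset_mem[OF Dl(1)] mem)+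
  moreover have "r k + y $ k + z $ k - (\<Sum>i\<in>UNIV. L k i (x $ i)) \<in> G k" for k
    by (intro subspace_add subspace_diff subspace_sum sub_G L_mem r mem)
  ultimately show "lipschitz_part u \<in> saddle_space"
    by (simp add: lipschitz_part_def mem_saddle_space)
qed

lemma cocoercive_part_mem: "cocoercive_part \<in> saddle_space \<rightarrow> saddle_space"
proof
  fix u assume "u \<in> saddle_space"
  then show "cocoercive_part u \<in> saddle_space"
    using funcset_mem[OF C(1)] funcset_mem[OF Bc(1)] funcset_mem[OF Dc(1)] subspace_0[OF sub_G]
    by (cases u) (auto simp: cocoercive_part_def mem_saddle_space)
qed

lemma lipschitz_part_lipschitz: "lipschitz_map_on saddle_space lipschitz_part"
proof -
  have projs: "lipschitz_map_on saddle_space (\<lambda>u. fst u)" "lipschitz_map_on saddle_space (\<lambda>u. fst (snd u))"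
    "lipschitz_map_on saddle_space (\<lambda>u. fst (snd (snd u)))" "lipschitz_map_on saddle_space (\<lambda>u. snd (snd (snd u)))"
    by (intro lipschitz_map_on_fst lipschitz_map_on_snd lipschitz_map_onI[OF lipschitz_on_id])+
  have mem: "fst u $ i \<in> H i" "fst u \<in> direct_sum H" "fst (snd u) $ k \<in> G k"
      "fst (snd (snd u)) $ k \<in> G k" "snd (snd (snd u)) $ k \<in> G k" if "u \<in> saddle_space" for u i k
    using that by (auto simp: saddle_space_def direct_sum_def)
  have R_lip: "lipschitz_map_on (direct_sum H) (R i)" for i
    using lipschitz_map_on_nth[OF lipschitz_map_onI[OF R(3)], of i] by simp
  have "lipschitz_map_on saddle_space (\<lambda>u.
     (\<chi> i. Q i (fst u $ i) + R i (fst u) + (\<Sum>k\<in>UNIV. Ls k i (snd (snd (snd u)) $ k)) - s i,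
      \<chi> k. Bl k (fst (snd u) $ k) - snd (snd (snd u)) $ k,
      \<chi> k. Dl k (fst (snd (snd u)) $ k) - snd (snd (snd u)) $ k,
      \<chi> k. r k + fst (snd u) $ k + fst (snd (snd u)) $ k - (\<Sum>i\<in>UNIV. L k i (fst u $ i))))"
    by (intro lipschitz_map_on_Pair lipschitz_map_on_vec lipschitz_map_on_add lipschitz_map_on_diff
        lipschitz_map_on_sum lipschitz_map_on_const lipschitz_map_on_nth projs
        lipschitz_map_on_compose[OF lipschitz_map_onI[OF Q(3)]]
        lipschitz_map_on_compose[OF R_lip]
        lipschitz_map_on_compose[OF lipschitz_map_onI[OF Bl(3)]]
        lipschitz_map_on_compose[OF lipschitz_map_onI[OF Dl(3)]]
        lipschitz_map_on_compose[OF lipschitz_map_on_bounded_linear_between[OF sub_H L]]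
        lipschitz_map_on_compose[OF lipschitz_map_on_adjoint_on[OF H L, where V = UNIV]] mem UNIV_I)
  then show ?thesis by (simp add: lipschitz_part_def[abs_def] case_prod_unfold)
qed

text \<open>
  The contributions of \<open>L\<close>, of its adjoint and of the terms \<open>v\<close>, \<open>y\<close>, \<open>z\<close> cancel: the coupling is
  skew.
\<close>

lemma inner_lipschitz_part:
  assumes "(x, y, z, v) \<in> saddle_space" "(x', y', z', v') \<in> saddle_space"
  shows "inner ((x, y, z, v) - (x', y', z', v')) (lipschitz_part (x, y, z, v) - lipschitz_part (x', y', z', v'))
    = (\<Sum>i\<in>UNIV. inner (x $ i - x' $ i) (Q i (x $ i) - Q i (x' $ i)))
      + inner (x - x') ((\<chi> i. R i x) - (\<chi> i. R i x'))
      + (\<Sum>k\<in>UNIV. inner (y $ k - y' $ k) (Bl k (y $ k) - Bl k (y' $ k)))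
      + (\<Sum>k\<in>UNIV. inner (z $ k - z' $ k) (Dl k (z $ k) - Dl k (z' $ k)))"
proof -
  have mem: "x $ i \<in> H i" "x' $ i \<in> H i" for i using assms by (auto simp: mem_saddle_space)
  define c where "c k i = inner (L k i (x $ i) - L k i (x' $ i)) (v $ k - v' $ k)" for k i
  have c: "inner (x $ i - x' $ i) (Ls k i (v $ k) - Ls k i (v' $ k)) = c k i" for k i
    unfolding c_def inner_diff_right[of "x $ i - x' $ i"] inner_Ls[OF subspace_diff[OF sub_H mem]]
      bounded_linear_between_diff[OF sub_H L mem] by (simp add: inner_diff_right)
  have 1: "inner (x $ i - x' $ i) (Q i (x $ i) + R i x + (\<Sum>k\<in>UNIV. Ls k i (v $ k)) - s i
        - (Q i (x' $ i) + R i x' + (\<Sum>k\<in>UNIV. Ls k i (v' $ k)) - s i))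
      = inner (x $ i - x' $ i) (Q i (x $ i) - Q i (x' $ i)) + inner (x $ i - x' $ i) (R i x - R i x')
        + (\<Sum>k\<in>UNIV. c k i)" for i
  proof -
    have "(\<Sum>k\<in>UNIV. c k i) = inner (x $ i - x' $ i) ((\<Sum>k\<in>UNIV. Ls k i (v $ k)) - (\<Sum>k\<in>UNIV. Ls k i (v' $ k)))"
      by (simp only: c[symmetric] inner_sum_right[symmetric] sum_subtractf)
    then show ?thesis by (simp add: inner_diff_right inner_add_right)
  qed
  have 2: "inner (v $ k - v' $ k) (r k + y $ k + z $ k - (\<Sum>i\<in>UNIV. L k i (x $ i))
        - (r k + y' $ k + z' $ k - (\<Sum>i\<in>UNIV. L k i (x' $ i))))
      = inner (y $ k - y' $ k) (v $ k - v' $ k) + inner (z $ k - z' $ k) (v $ k - v' $ k)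
        - (\<Sum>i\<in>UNIV. c k i)" for k
  proof -
    have "(\<Sum>i\<in>UNIV. c k i) = inner (v $ k - v' $ k) ((\<Sum>i\<in>UNIV. L k i (x $ i)) - (\<Sum>i\<in>UNIV. L k i (x' $ i)))"
      by (simp only: c_def inner_commute[of _ "v $ k - v' $ k"] inner_sum_right[symmetric] sum_subtractf)
    moreover have "inner (y $ k - y' $ k) (v $ k - v' $ k) = inner (v $ k - v' $ k) (y $ k - y' $ k)"
      "inner (z $ k - z' $ k) (v $ k - v' $ k) = inner (v $ k - v' $ k) (z $ k - z' $ k)"
      by (rule inner_commute)+
    ultimately show ?thesis by (simp add: inner_diff_right inner_add_right)
  qed
  have 3: "inner (y $ k - y' $ k) (Bl k (y $ k) - v $ k - (Bl k (y' $ k) - v' $ k))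
      = inner (y $ k - y' $ k) (Bl k (y $ k) - Bl k (y' $ k)) - inner (y $ k - y' $ k) (v $ k - v' $ k)" for k
    by (simp add: inner_diff_right)
  have 4: "inner (z $ k - z' $ k) (Dl k (z $ k) - v $ k - (Dl k (z' $ k) - v' $ k))
      = inner (z $ k - z' $ k) (Dl k (z $ k) - Dl k (z' $ k)) - inner (z $ k - z' $ k) (v $ k - v' $ k)" for k
    by (simp add: inner_diff_right)
  have "(\<Sum>i\<in>UNIV. \<Sum>k\<in>UNIV. c k i) = (\<Sum>k\<in>UNIV. \<Sum>i\<in>UNIV. c k i)" by (rule sum.swap)
  then show ?thesis
    unfolding lipschitz_part_def prod.case diff_Pair inner_Pair inner_vec_def vector_minus_component
      vec_lambda_beta 1 2 3 4 sum.distrib sum_subtractf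
    by simp
qed

lemma lipschitz_part_monotone: "monotone_map_on saddle_space lipschitz_part"
  unfolding monotone_map_on_def
proof (intro ballI)
  fix u u' assume mem: "u \<in> saddle_space" "u' \<in> saddle_space"
  obtain x y z v where u: "u = (x, y, z, v)" by (cases u) auto
  obtain x' y' z' v' where u': "u' = (x', y', z', v')" by (cases u') auto
  have "0 \<le> inner (x - x') ((\<chi> i. R i x) - (\<chi> i. R i x'))"
    using R(2) mem unfolding monotone_map_on_def u u' by (simp add: mem_saddle_space direct_sum_def)
  moreover have "0 \<le> inner (x $ i - x' $ i) (Q i (x $ i) - Q i (x' $ i))"
    "0 \<le> inner (y $ k - y' $ k) (Bl k (y $ k) - Bl k (y' $ k))"
    "0 \<le> inner (z $ k - z' $ k) (Dl k (z $ k) - Dl k (z' $ k))" for i k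
    using Q(2) Bl(2) Dl(2) mem unfolding monotone_map_on_def u u' mem_saddle_space by blast+
  ultimately show "0 \<le> inner (u - u') (lipschitz_part u - lipschitz_part u')"
    unfolding u u' inner_lipschitz_part[OF mem[unfolded u u']] by (simp add: sum_nonneg)
qed

text \<open>
  The step size bounds are made for this estimate: a weight of at least \<open>\<alpha>l i + chi + \<sigma>\<close> absorbs
  the Lipschitz constants of \<open>Q i\<close> and \<open>R\<close> and leaves \<open>\<sigma>\<close>, of which \<open>\<kappa>\<close> is spent on the cocoercive
  part. The skew coupling does not contribute, so that on the dual block the weight itself remains.
\<close>

lemma weight_strongly_monotone:
  assumes mem: "u \<in> saddle_space" "u' \<in> saddle_space"
    and p: "\<And>i. \<alpha>l i + chi + \<sigma> \<le> p i" and q: "\<And>k. \<beta>l k + \<sigma> \<le> q k" and t: "\<And>k. \<delta>l k + \<sigma> \<le> t k"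
    and w: "\<And>k. \<epsilon> \<le> w k"
    and \<theta>: "\<theta> \<le> \<sigma> - \<kappa>" "\<theta> \<le> \<epsilon>"
  shows "\<theta> * (norm (u - u'))\<^sup>2 + \<kappa> * (norm (drop_dual (u - u')))\<^sup>2
    \<le> inner (u - u') ((weight p q t w u - lipschitz_part u) - (weight p q t w u' - lipschitz_part u'))"
proof -
  obtain x y z v where u: "u = (x, y, z, v)" by (cases u) auto
  obtain x' y' z' v' where u': "u' = (x', y', z', v')" by (cases u') auto
  have mem': "x \<in> direct_sum H" "x' \<in> direct_sum H" "x $ i \<in> H i" "x' $ i \<in> H i"
    "y $ k \<in> G k" "y' $ k \<in> G k" "z $ k \<in> G k" "z' $ k \<in> G k" for i k
    using mem unfolding u u' mem_saddle_space by (auto simp: direct_sum_def)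
  have W: "inner (u - u') (weight p q t w u - weight p q t w u') =
     (\<Sum>i\<in>UNIV. p i * (norm (x $ i - x' $ i))\<^sup>2) + (\<Sum>k\<in>UNIV. q k * (norm (y $ k - y' $ k))\<^sup>2)
     + (\<Sum>k\<in>UNIV. t k * (norm (z $ k - z' $ k))\<^sup>2) + (\<Sum>k\<in>UNIV. w k * (norm (v $ k - v' $ k))\<^sup>2)"
    by (simp add: u u' weight_def inner_vec_def scaleR_diff_right[symmetric] power2_norm_eq_inner)
  have RL: "inner (x - x') ((\<chi> i. R i x) - (\<chi> i. R i x')) \<le> (\<Sum>i\<in>UNIV. chi * (norm (x $ i - x' $ i))\<^sup>2)"
    using inner_le_lipschitz[OF R(3) mem'(1,2)] by (simp add: norm_vec_square sum_distrib_left)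
  have P: "(\<Sum>i\<in>UNIV. \<sigma> * (norm (x $ i - x' $ i))\<^sup>2) \<le>
      (\<Sum>i\<in>UNIV. p i * (norm (x $ i - x' $ i))\<^sup>2 - inner (x $ i - x' $ i) (Q i (x $ i) - Q i (x' $ i))
        - chi * (norm (x $ i - x' $ i))\<^sup>2)"
  proof (rule sum_mono)
    fix i
    have "(\<alpha>l i + chi + \<sigma>) * (norm (x $ i - x' $ i))\<^sup>2 \<le> p i * (norm (x $ i - x' $ i))\<^sup>2"
      using p by (intro mult_right_mono) auto
    then show "\<sigma> * (norm (x $ i - x' $ i))\<^sup>2 \<le> p i * (norm (x $ i - x' $ i))\<^sup>2
      - inner (x $ i - x' $ i) (Q i (x $ i) - Q i (x' $ i)) - chi * (norm (x $ i - x' $ i))\<^sup>2"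
      using inner_le_lipschitz[OF Q(3) mem'(3,4), of i] by (simp add: distrib_right)
  qed
  have Qk: "(\<Sum>k\<in>UNIV. \<sigma> * (norm (y $ k - y' $ k))\<^sup>2) \<le>
      (\<Sum>k\<in>UNIV. q k * (norm (y $ k - y' $ k))\<^sup>2 - inner (y $ k - y' $ k) (Bl k (y $ k) - Bl k (y' $ k)))"
  proof (rule sum_mono)
    fix k
    have "(\<beta>l k + \<sigma>) * (norm (y $ k - y' $ k))\<^sup>2 \<le> q k * (norm (y $ k - y' $ k))\<^sup>2"
      using q by (intro mult_right_mono) auto
    then show "\<sigma> * (norm (y $ k - y' $ k))\<^sup>2 \<le> q k * (norm (y $ k - y' $ k))\<^sup>2
        - inner (y $ k - y' $ k) (Bl k (y $ k) - Bl k (y' $ k))"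
      using inner_le_lipschitz[OF Bl(3) mem'(5,6), of k] by (simp add: distrib_right)
  qed
  have Tk: "(\<Sum>k\<in>UNIV. \<sigma> * (norm (z $ k - z' $ k))\<^sup>2) \<le>
      (\<Sum>k\<in>UNIV. t k * (norm (z $ k - z' $ k))\<^sup>2 - inner (z $ k - z' $ k) (Dl k (z $ k) - Dl k (z' $ k)))"
  proof (rule sum_mono)
    fix k
    have "(\<delta>l k + \<sigma>) * (norm (z $ k - z' $ k))\<^sup>2 \<le> t k * (norm (z $ k - z' $ k))\<^sup>2"
      using t by (intro mult_right_mono) auto
    then show "\<sigma> * (norm (z $ k - z' $ k))\<^sup>2 \<le> t k * (norm (z $ k - z' $ k))\<^sup>2
        - inner (z $ k - z' $ k) (Dl k (z $ k) - Dl k (z' $ k))"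
      using inner_le_lipschitz[OF Dl(3) mem'(7,8), of k] by (simp add: distrib_right)
  qed
  have Wk: "(\<Sum>k\<in>UNIV. \<epsilon> * (norm (v $ k - v' $ k))\<^sup>2) \<le> (\<Sum>k\<in>UNIV. w k * (norm (v $ k - v' $ k))\<^sup>2)"
    using w by (intro sum_mono mult_right_mono) auto
  define a where "a = (norm (x - x'))\<^sup>2 + (norm (y - y'))\<^sup>2 + (norm (z - z'))\<^sup>2"
  define b where "b = (norm (v - v'))\<^sup>2"
  have sums: "(\<Sum>i\<in>UNIV. (norm (x $ i - x' $ i))\<^sup>2) + (\<Sum>k\<in>UNIV. (norm (y $ k - y' $ k))\<^sup>2)
      + (\<Sum>k\<in>UNIV. (norm (z $ k - z' $ k))\<^sup>2) = a" "(\<Sum>k\<in>UNIV. (norm (v $ k - v' $ k))\<^sup>2) = b"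
    by (simp_all add: a_def b_def norm_vec_square)
  have "\<sigma> * a + \<epsilon> * b \<le> inner (u - u') (weight p q t w u - weight p q t w u')
      - inner (u - u') (lipschitz_part u - lipschitz_part u')"
    using RL P Qk Tk Wk
    unfolding W unfolding u u' inner_lipschitz_part[OF mem[unfolded u u']] sums[symmetric]
    by (simp add: sum_subtractf sum_distrib_left distrib_left)
  also have "\<dots> = inner (u - u') ((weight p q t w u - lipschitz_part u) - (weight p q t w u' - lipschitz_part u'))"
    by (simp add: inner_diff_right)
  finally have main: "\<sigma> * a + \<epsilon> * b \<le> \<dots>" .
  have "\<theta> * a \<le> (\<sigma> - \<kappa>) * a" "\<theta> * b \<le> \<epsilon> * b"
    using \<theta> by (intro mult_right_mono; simp add: a_def b_def)+
  moreover have "(norm (u - u'))\<^sup>2 = a + b" "(norm (drop_dual (u - u')))\<^sup>2 = a"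
    by (simp_all add: u u' drop_dual_def norm_Pair_square a_def b_def)
  ultimately show ?thesis using main by (simp add: algebra_simps)
qed

lemma cocoercive_part_cocoercive:
  assumes "u \<in> saddle_space" "u' \<in> saddle_space"
  shows "\<alpha> * (norm (cocoercive_part u - cocoercive_part u'))\<^sup>2
    \<le> inner (u - u') (cocoercive_part u - cocoercive_part u')"
proof -
  obtain x y z v where u: "u = (x, y, z, v)" by (cases u) auto
  obtain x' y' z' v' where u': "u' = (x', y', z', v')" by (cases u') auto
  have *: "\<alpha> * (norm (f p - f p'))\<^sup>2 \<le> inner (p - p') (f p - f p')"
    if "cocoercive_on c S f" "\<alpha> \<le> c" "p \<in> S" "p' \<in> S" for c S and f :: "'c::real_inner \<Rightarrow> 'c" and p p'
  proof -
    have "\<alpha> * (norm (f p - f p'))\<^sup>2 \<le> c * (norm (f p - f p'))\<^sup>2" using that(2) by (simp add: mult_right_mono)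
    also have "\<dots> \<le> inner (p - p') (f p - f p')" using that unfolding cocoercive_on_def by blast
    finally show ?thesis .
  qed
  have "\<alpha> * (norm (C i (x $ i) - C i (x' $ i)))\<^sup>2 \<le> inner (x $ i - x' $ i) (C i (x $ i) - C i (x' $ i))"
    "\<alpha> * (norm (Bc k (y $ k) - Bc k (y' $ k)))\<^sup>2 \<le> inner (y $ k - y' $ k) (Bc k (y $ k) - Bc k (y' $ k))"
    "\<alpha> * (norm (Dc k (z $ k) - Dc k (z' $ k)))\<^sup>2 \<le> inner (z $ k - z' $ k) (Dc k (z $ k) - Dc k (z' $ k))" for i k
    using assms unfolding u u' mem_saddle_space by (auto intro!: *[OF C(2) \<alpha>(2)] *[OF Bc(2) \<alpha>(3)] *[OF Dc(2) \<alpha>(4)])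
  then show ?thesis
    by (simp add: u u' cocoercive_part_def norm_Pair_square norm_vec_square inner_vec_def
        distrib_left sum_distrib_left add.assoc) (intro add_mono sum_mono, auto)
qed

text \<open>
  Cocoercivity between \<open>u\<close> and \<open>u'\<close> pays for the change of base point from \<open>u\<close> to \<open>w\<close>:
  \<open>p * q \<le> p\<^sup>2 / (4 * \<alpha>) + \<alpha> * q\<^sup>2\<close>.
\<close>

lemma cocoercive_part_three_point:
  assumes "u \<in> saddle_space" "u' \<in> saddle_space"
  shows "inner (u' - w) (cocoercive_part u - cocoercive_part u')
    \<le> 1 / (4 * \<alpha>) * (norm (drop_dual (u - w)))\<^sup>2"
proof -
  define D where "D = cocoercive_part u - cocoercive_part u'"
  have "inner (u - w) D = inner (drop_dual (u - w)) D"
    by (cases u; cases u'; cases w) (simp add: D_def drop_dual_def cocoercive_part_def)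
  also have "\<dots> \<le> norm (drop_dual (u - w)) * norm D" by (rule norm_cauchy_schwarz)
  also have "\<dots> \<le> 1 / (4 * \<alpha>) * (norm (drop_dual (u - w)))\<^sup>2 + \<alpha> * (norm D)\<^sup>2"
  proof -
    have "0 \<le> (norm (drop_dual (u - w)) - 2 * \<alpha> * norm D)\<^sup>2 / (4 * \<alpha>)" using \<alpha>(1) by simp
    also have "\<dots> = 1 / (4 * \<alpha>) * (norm (drop_dual (u - w)))\<^sup>2 + \<alpha> * (norm D)\<^sup>2
        - norm (drop_dual (u - w)) * norm D"
      using \<alpha>(1) by (simp add: power2_eq_square field_simps)
    finally show ?thesis by simp
  qed
  finally have "inner (u - w) D \<le> 1 / (4 * \<alpha>) * (norm (drop_dual (u - w)))\<^sup>2 + \<alpha> * (norm D)\<^sup>2" .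
  moreover have "\<alpha> * (norm D)\<^sup>2 \<le> inner (u - u') D"
    using cocoercive_part_cocoercive[OF assms] by (simp add: D_def)
  moreover have "inner (u' - w) D = inner (u - w) D - inner (u - u') D"
    by (simp add: inner_diff_left)
  ultimately show ?thesis unfolding D_def by linarith
qed

lemma cocoercive_part_lipschitz: "(1 / \<alpha>)-lipschitz_on saddle_space cocoercive_part"
proof (rule lipschitz_onI)
  fix u u' assume mem: "u \<in> saddle_space" "u' \<in> saddle_space"
  define D where "D = norm (cocoercive_part u - cocoercive_part u')"
  have "\<alpha> * D\<^sup>2 \<le> norm (u - u') * D"
    using cocoercive_part_cocoercive[OF mem] norm_cauchy_schwarz unfolding D_def by (rule order_trans)
  then have "D * (\<alpha> * D) \<le> D * norm (u - u')" by (simp add: power2_eq_square mult_ac)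
  then have "\<alpha> * D \<le> norm (u - u')"
  proof (cases "D = 0")
    case False
    then have "0 < D" by (simp add: D_def)
    with \<open>D * (\<alpha> * D) \<le> D * norm (u - u')\<close> show ?thesis by (rule mult_left_le_imp_le)
  qed simp
  then show "dist (cocoercive_part u) (cocoercive_part u') \<le> 1 / \<alpha> * dist u u'"
    using \<alpha>(1) by (simp add: D_def dist_norm field_simps)
qed (use \<alpha>(1) in simp)

end

section \<open>Zeros of the saddle operator and Kuhn--Tucker points\<close>

lemma mem_three_sum: "u \<in> three_sum M f g x \<longleftrightarrow> u - f x - g x \<in> M x"
proof
  assume "u \<in> three_sum M f g x"
  then obtain m where "m \<in> M x" "u = m + f x + g x"
    by (auto simp: three_sum_def set_plus_def)
  then show "u - f x - g x \<in> M x" by simp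
next
  assume "u - f x - g x \<in> M x"
  then have "(u - f x - g x) + f x + g x \<in> three_sum M f g x"
    unfolding three_sum_def by (intro set_plus_intro) auto
  then show "u \<in> three_sum M f g x" by simp
qed

lemma parallel_sum_iff:
  "v \<in> parallel_sum B D w \<longleftrightarrow> w \<in> set_inverse B v + set_inverse D v"
  by (simp add: parallel_sum_def set_inverse_def)

context kuhn_tucker_problem
begin

lemma mem_primal_sum:
  "u \<in> A i p + {C i p} + {Q i p} + {R i x} \<longleftrightarrow> u - C i p - Q i p - R i x \<in> A i p"
proof
  assume "u \<in> A i p + {C i p} + {Q i p} + {R i x}"
  then obtain m where "m \<in> A i p" "u = m + C i p + Q i p + R i x"
    by (auto simp: set_plus_def)
  then show "u - C i p - Q i p - R i x \<in> A i p" by simp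
next
  assume "u - C i p - Q i p - R i x \<in> A i p"
  then have "(u - C i p - Q i p - R i x) + C i p + Q i p + R i x \<in> A i p + {C i p} + {Q i p} + {R i x}"
    by (intro set_plus_intro) auto
  then show "u \<in> A i p + {C i p} + {Q i p} + {R i x}" by simp
qed

text \<open>
  The four blocks of the saddle inclusion are the primal inclusion, membership of \<open>v\<close> in both operators
  of the parallel sum, and the splitting of its argument.
\<close>

lemma saddle_zero_iff:
  assumes "(x, y, z, v) \<in> saddle_space"
  shows "- (lipschitz_part (x, y, z, v) + cocoercive_part (x, y, z, v)) \<in> maximal_part (x, y, z, v) \<longleftrightarrow>
    (\<forall>i. s i - (\<Sum>k\<in>UNIV. Ls k i (v $ k)) \<in> A i (x $ i) + {C i (x $ i)} + {Q i (x $ i)} + {R i x}) \<and>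
    (\<forall>k. v $ k \<in> three_sum (Bm k) (Bc k) (Bl k) (y $ k)) \<and>
    (\<forall>k. v $ k \<in> three_sum (Dm k) (Dc k) (Dl k) (z $ k)) \<and>
    (\<forall>k. (\<Sum>i\<in>UNIV. L k i (x $ i)) - r k = y $ k + z $ k)"
proof -
  have v: "v \<in> direct_sum G" using assms by (simp add: mem_saddle_space direct_sum_def)
  have 1: "s i - (\<Sum>k\<in>UNIV. Ls k i (v $ k)) - C i (x $ i) - Q i (x $ i) - R i x
      = - (Q i (x $ i) + R i x + (\<Sum>k\<in>UNIV. Ls k i (v $ k)) - s i + C i (x $ i))" for i
    by (simp add: algebra_simps)
  have 2: "v $ k - Bc k (y $ k) - Bl k (y $ k) = - (Bl k (y $ k) - v $ k + Bc k (y $ k))"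
    "v $ k - Dc k (z $ k) - Dl k (z $ k) = - (Dl k (z $ k) - v $ k + Dc k (z $ k))" for k
    by (simp_all add: algebra_simps)
  have 3: "(\<Sum>i\<in>UNIV. L k i (x $ i)) - r k = y $ k + z $ k \<longleftrightarrow>
      - (r k + y $ k + z $ k - (\<Sum>i\<in>UNIV. L k i (x $ i))) = 0" for k
    by (auto simp: algebra_simps)
  show ?thesis
    unfolding mem_primal_sum mem_three_sum 1 2 3
    using v by (simp add: lipschitz_part_def cocoercive_part_def maximal_part_def pair_operator_def
        vec_operator_def zero_operator_def vec_eq_iff)
qed

lemma saddle_zero_imp_solutions:
  assumes mem: "(x, y, z, v) \<in> saddle_space"
    and zero: "- (lipschitz_part (x, y, z, v) + cocoercive_part (x, y, z, v)) \<in> maximal_part (x, y, z, v)"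
  shows "primal_solution H s r A C Q R Bm Bc Bl Dm Dc Dl L x"
    and "dual_solution H G s r A C Q R Bm Bc Bl Dm Dc Dl L v"
    and "(x, v) \<in> kuhn_tucker_set H G s r A C Q R Bm Bc Bl Dm Dc Dl L"
proof -
  have xv: "x \<in> direct_sum H" "v \<in> direct_sum G"
    using mem by (auto simp: mem_saddle_space direct_sum_def)
  have P: "s i - (\<Sum>k\<in>UNIV. Ls k i (v $ k)) \<in> A i (x $ i) + {C i (x $ i)} + {Q i (x $ i)} + {R i x}" for i
    using zero unfolding saddle_zero_iff[OF mem] by blast
  have D: "(\<Sum>j\<in>UNIV. L k j (x $ j)) - r k
      \<in> set_inverse (three_sum (Bm k) (Bc k) (Bl k)) (v $ k) + set_inverse (three_sum (Dm k) (Dc k) (Dl k)) (v $ k)" for k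
  proof -
    have "y $ k \<in> set_inverse (three_sum (Bm k) (Bc k) (Bl k)) (v $ k)"
      "z $ k \<in> set_inverse (three_sum (Dm k) (Dc k) (Dl k)) (v $ k)"
      using zero unfolding saddle_zero_iff[OF mem] set_inverse_def by auto
    moreover have "(\<Sum>j\<in>UNIV. L k j (x $ j)) - r k = y $ k + z $ k"
      using zero unfolding saddle_zero_iff[OF mem] by blast
    ultimately show ?thesis by (metis set_plus_intro)
  qed
  show "(x, v) \<in> kuhn_tucker_set H G s r A C Q R Bm Bc Bl Dm Dc Dl L"
    unfolding kuhn_tucker_set_def using xv P D by simp
  show "dual_solution H G s r A C Q R Bm Bc Bl Dm Dc Dl L v"
    unfolding dual_solution_def parallel_sum_iff using xv P D by blast
  show "primal_solution H s r A C Q R Bm Bc Bl Dm Dc Dl L x"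
    unfolding primal_solution_def
  proof (intro conjI allI xv)
    fix i
    let ?B = "\<lambda>k. Ls k i ` parallel_sum (three_sum (Bm k) (Bc k) (Bl k)) (three_sum (Dm k) (Dc k) (Dl k))
            ((\<Sum>j\<in>UNIV. L k j (x $ j)) - r k)"
    have "(\<Sum>k\<in>UNIV. Ls k i (v $ k)) \<in> (\<Sum>k\<in>UNIV. ?B k)"
      unfolding set_sum_alt[OF finite] using D by (auto simp: parallel_sum_iff)
    from set_plus_intro[OF P[of i] this]
    show "s i \<in> A i (x $ i) + {C i (x $ i)} + {Q i (x $ i)} + {R i x} + (\<Sum>k\<in>UNIV. ?B k)" by simp
  qed
qed

lemma dual_solution_imp_saddle_zero:
  assumes "dual_solution H G s r A C Q R Bm Bc Bl Dm Dc Dl L v"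
  shows "\<exists>u\<in>saddle_space. - (lipschitz_part u + cocoercive_part u) \<in> maximal_part u"
proof -
  obtain x where x: "v \<in> direct_sum G" "x \<in> direct_sum H"
    "\<And>i. s i - (\<Sum>k\<in>UNIV. Ls k i (v $ k)) \<in> A i (x $ i) + {C i (x $ i)} + {Q i (x $ i)} + {R i x}"
    "\<And>k. (\<Sum>j\<in>UNIV. L k j (x $ j)) - r k \<in> set_inverse (three_sum (Bm k) (Bc k) (Bl k)) (v $ k)
       + set_inverse (three_sum (Dm k) (Dc k) (Dl k)) (v $ k)"
    using assms unfolding dual_solution_def parallel_sum_iff by blast
  have "\<exists>y z. (\<Sum>j\<in>UNIV. L k j (x $ j)) - r k = y + z \<and>
      v $ k \<in> three_sum (Bm k) (Bc k) (Bl k) y \<and> v $ k \<in> three_sum (Dm k) (Dc k) (Dl k) z" for k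
    using x(4)[of k] unfolding set_inverse_def set_plus_def by blast
  then obtain y z where yz: "\<And>k. (\<Sum>j\<in>UNIV. L k j (x $ j)) - r k = y k + z k"
      "\<And>k. v $ k \<in> three_sum (Bm k) (Bc k) (Bl k) (y k)" "\<And>k. v $ k \<in> three_sum (Dm k) (Dc k) (Dl k) (z k)"
    by metis
  have graph: "p \<in> S" if "maximally_monotone_on S M" "u \<in> M p" for S M and p u :: 'g
    using that unfolding maximally_monotone_on_def operator_on_def by blast
  have "y k \<in> G k" "z k \<in> G k" for k
    using graph[OF Bm] graph[OF Dm] yz(2,3) unfolding mem_three_sum by blast+
  then have mem: "(x, \<chi> k. y k, \<chi> k. z k, v) \<in> saddle_space"
    using x(1,2) by (simp add: mem_saddle_space direct_sum_def)
  show ?thesis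
    by (rule bexI[OF _ mem], subst saddle_zero_iff[OF mem]) (simp add: x(3) yz)
qed

end

section \<open>Strong convergence of the block-iterative algorithm\<close>

lemma resolvent_scale_operator_imp:
  assumes "p \<in> resolvent (scale_operator c A) (q + c *\<^sub>R w)" and "c \<noteq> 0"
  shows "inverse c *\<^sub>R (q - p) + w \<in> A p"
proof -
  obtain u where u: "u \<in> A p" "q + c *\<^sub>R w = p + c *\<^sub>R u"
    using assms(1) by (auto simp: resolvent_def set_inverse_def scale_operator_def set_plus_def)
  have "inverse c *\<^sub>R (q - p) + w = inverse c *\<^sub>R ((q + c *\<^sub>R w) - p)"
    using \<open>c \<noteq> 0\<close> by (simp add: scaleR_diff_right scaleR_add_right)
  also have "\<dots> = u" unfolding u(2) using \<open>c \<noteq> 0\<close> by simp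
  finally show ?thesis using u(1) by simp
qed

theorem theorem3p7:
  fixes H :: "'i::finite \<Rightarrow> 'h::real_inner set"
    and G :: "'k::finite \<Rightarrow> 'g::real_inner set"
    and s :: "'i \<Rightarrow> 'h" and r :: "'k \<Rightarrow> 'g"
    and A :: "'i \<Rightarrow> 'h \<Rightarrow> 'h set" and C Q :: "'i \<Rightarrow> 'h \<Rightarrow> 'h" and R :: "'i \<Rightarrow> 'h ^ 'i \<Rightarrow> 'h"
    and Bm Dm :: "'k \<Rightarrow> 'g \<Rightarrow> 'g set" and Bc Bl Dc Dl :: "'k \<Rightarrow> 'g \<Rightarrow> 'g"
    and L :: "'k \<Rightarrow> 'i \<Rightarrow> 'h \<Rightarrow> 'g"
    and \<alpha>c \<alpha>l :: "'i \<Rightarrow> real" and \<beta>c \<beta>l \<delta>c \<delta>l :: "'k \<Rightarrow> real" and chi :: real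
    and \<alpha> \<sigma> \<epsilon> :: real
    and \<gamma> :: "'i \<Rightarrow> nat \<Rightarrow> real" and \<mu> \<nu> \<sigma>k :: "'k \<Rightarrow> nat \<Rightarrow> real"
    and P T :: nat
    and In :: "nat \<Rightarrow> 'i set" and Kn :: "nat \<Rightarrow> 'k set"
    and \<pi> :: "'i \<Rightarrow> nat \<Rightarrow> nat" and \<omega> :: "'k \<Rightarrow> nat \<Rightarrow> nat"
    and x a ls as ps :: "nat \<Rightarrow> 'h ^ 'i"
    and y z vs b d us ws es qs ts e :: "nat \<Rightarrow> 'g ^ 'k"
    and \<xi> :: "'i \<Rightarrow> nat \<Rightarrow> real" and \<eta> :: "'k \<Rightarrow> nat \<Rightarrow> real"
    and \<Delta> \<tau> \<zeta> \<theta> \<kappa> lam :: "nat \<Rightarrow> real"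
  \<comment> \<open>setting\<close>
  assumes H: "\<And>i. hilbert_subspace (H i)"
    and G: "\<And>k. hilbert_subspace (G k)"
    and s: "\<And>i. s i \<in> H i"
    and r: "\<And>k. r k \<in> G k"
    and A: "\<And>i. maximally_monotone_on (H i) (A i)"
    and C: "\<And>i. C i \<in> H i \<rightarrow> H i" "\<And>i. cocoercive_on (\<alpha>c i) (H i) (C i)"
    and Q: "\<And>i. Q i \<in> H i \<rightarrow> H i" "\<And>i. monotone_map_on (H i) (Q i)"
      "\<And>i. (\<alpha>l i)-lipschitz_on (H i) (Q i)"
    and R: "\<And>i. R i \<in> direct_sum H \<rightarrow> H i"
      "monotone_map_on (direct_sum H) (\<lambda>x. \<chi> i. R i x)"
      "chi-lipschitz_on (direct_sum H) (\<lambda>x. \<chi> i. R i x)"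
    and Bm: "\<And>k. maximally_monotone_on (G k) (Bm k)"
    and Bc: "\<And>k. Bc k \<in> G k \<rightarrow> G k" "\<And>k. cocoercive_on (\<beta>c k) (G k) (Bc k)"
    and Bl: "\<And>k. Bl k \<in> G k \<rightarrow> G k" "\<And>k. monotone_map_on (G k) (Bl k)"
      "\<And>k. (\<beta>l k)-lipschitz_on (G k) (Bl k)"
    and Dm: "\<And>k. maximally_monotone_on (G k) (Dm k)"
    and Dc: "\<And>k. Dc k \<in> G k \<rightarrow> G k" "\<And>k. cocoercive_on (\<delta>c k) (G k) (Dc k)"
    and Dl: "\<And>k. Dl k \<in> G k \<rightarrow> G k" "\<And>k. monotone_map_on (G k) (Dl k)"
      "\<And>k. (\<delta>l k)-lipschitz_on (G k) (Dl k)"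
    and L: "\<And>k i. bounded_linear_between (H i) (G k) (L k i)"
  \<comment> \<open>parameters\<close>
    and \<alpha>: "\<alpha> = Min (range \<alpha>c \<union> range \<beta>c \<union> range \<delta>c)"
    and \<sigma>: "\<sigma> > 0" "\<sigma> > 1 / (4 * \<alpha>)"
    and \<epsilon>: "0 < \<epsilon>" "\<epsilon> < 1"
      "1 / \<epsilon> > Max (range (\<lambda>i. \<alpha>l i + chi + \<sigma>) \<union> range (\<lambda>k. \<beta>l k + \<sigma>) \<union> range (\<lambda>k. \<delta>l k + \<sigma>))"
    and \<gamma>: "\<And>i n. \<gamma> i n \<in> {\<epsilon> .. 1 / (\<alpha>l i + chi + \<sigma>)}"
    and \<mu>: "\<And>k n. \<mu> k n \<in> {\<epsilon> .. 1 / (\<beta>l k + \<sigma>)}"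
    and \<nu>: "\<And>k n. \<nu> k n \<in> {\<epsilon> .. 1 / (\<delta>l k + \<sigma>)}"
    and \<sigma>k: "\<And>k n. \<sigma>k k n \<in> {\<epsilon> .. 1 / \<epsilon>}"
    and init: "\<And>i. x 0 $ i \<in> H i" "\<And>k. y 0 $ k \<in> G k" "\<And>k. z 0 $ k \<in> G k" "\<And>k. vs 0 $ k \<in> G k"
  \<comment> \<open>block selection and delays\<close>
    and In: "\<And>n. In n \<noteq> {}" "In 0 = UNIV" "\<And>n. (\<Union>j\<in>{n..n + P}. In j) = UNIV"
    and Kn: "\<And>n. Kn n \<noteq> {}" "Kn 0 = UNIV" "\<And>n. (\<Union>j\<in>{n..n + P}. Kn j) = UNIV"
    and \<pi>: "\<And>i n. int n - int T \<le> int (\<pi> i n)" "\<And>i n. \<pi> i n \<le> n"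
    and \<omega>: "\<And>k n. int n - int T \<le> int (\<omega> k n)" "\<And>k n. \<omega> k n \<le> n"
  \<comment> \<open>algorithm, step 1\<close>
    and ls: "\<And>n i. i \<in> In n \<Longrightarrow>
      ls n $ i = Q i (x (\<pi> i n) $ i) + R i (x (\<pi> i n))
        + (\<Sum>k\<in>UNIV. adjoint_on (H i) (L k i) (vs (\<pi> i n) $ k))"
    and a: "\<And>n i. i \<in> In n \<Longrightarrow>
      a n $ i \<in> resolvent (scale_operator (\<gamma> i (\<pi> i n)) (A i))
        (x (\<pi> i n) $ i + \<gamma> i (\<pi> i n) *\<^sub>R (s i - ls n $ i - C i (x (\<pi> i n) $ i)))"
    and as: "\<And>n i. i \<in> In n \<Longrightarrow>
      as n $ i = inverse (\<gamma> i (\<pi> i n)) *\<^sub>R (x (\<pi> i n) $ i - a n $ i) - ls n $ i + Q i (a n $ i)"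
    and \<xi>: "\<And>n i. i \<in> In n \<Longrightarrow> \<xi> i n = (norm (a n $ i - x (\<pi> i n) $ i))\<^sup>2"
  \<comment> \<open>step 2; the index 0 never occurs here because \<open>In 0 = UNIV\<close>, and likewise in step 4\<close>
    and step2: "\<And>n i. i \<notin> In (Suc n) \<Longrightarrow>
      a (Suc n) $ i = a n $ i \<and> as (Suc n) $ i = as n $ i \<and> \<xi> i (Suc n) = \<xi> i n"
  \<comment> \<open>step 3\<close>
    and us: "\<And>n k. k \<in> Kn n \<Longrightarrow> us n $ k = vs (\<omega> k n) $ k - Bl k (y (\<omega> k n) $ k)"
    and ws: "\<And>n k. k \<in> Kn n \<Longrightarrow> ws n $ k = vs (\<omega> k n) $ k - Dl k (z (\<omega> k n) $ k)"
    and b: "\<And>n k. k \<in> Kn n \<Longrightarrow>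
      b n $ k \<in> resolvent (scale_operator (\<mu> k (\<omega> k n)) (Bm k))
        (y (\<omega> k n) $ k + \<mu> k (\<omega> k n) *\<^sub>R (us n $ k - Bc k (y (\<omega> k n) $ k)))"
    and d: "\<And>n k. k \<in> Kn n \<Longrightarrow>
      d n $ k \<in> resolvent (scale_operator (\<nu> k (\<omega> k n)) (Dm k))
        (z (\<omega> k n) $ k + \<nu> k (\<omega> k n) *\<^sub>R (ws n $ k - Dc k (z (\<omega> k n) $ k)))"
    and es: "\<And>n k. k \<in> Kn n \<Longrightarrow>
      es n $ k = \<sigma>k k (\<omega> k n) *\<^sub>R
          ((\<Sum>i\<in>UNIV. L k i (x (\<omega> k n) $ i)) - y (\<omega> k n) $ k - z (\<omega> k n) $ k - r k)
        + vs (\<omega> k n) $ k"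
    and qs: "\<And>n k. k \<in> Kn n \<Longrightarrow>
      qs n $ k = inverse (\<mu> k (\<omega> k n)) *\<^sub>R (y (\<omega> k n) $ k - b n $ k) + us n $ k
        + Bl k (b n $ k) - es n $ k"
    and ts: "\<And>n k. k \<in> Kn n \<Longrightarrow>
      ts n $ k = inverse (\<nu> k (\<omega> k n)) *\<^sub>R (z (\<omega> k n) $ k - d n $ k) + ws n $ k
        + Dl k (d n $ k) - es n $ k"
    and \<eta>: "\<And>n k. k \<in> Kn n \<Longrightarrow>
      \<eta> k n = (norm (b n $ k - y (\<omega> k n) $ k))\<^sup>2 + (norm (d n $ k - z (\<omega> k n) $ k))\<^sup>2"
  \<comment> \<open>step 4\<close>
    and step4: "\<And>n k. k \<notin> Kn (Suc n) \<Longrightarrow>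
      b (Suc n) $ k = b n $ k \<and> d (Suc n) $ k = d n $ k \<and> es (Suc n) $ k = es n $ k \<and>
      qs (Suc n) $ k = qs n $ k \<and> ts (Suc n) $ k = ts n $ k \<and> \<eta> k (Suc n) = \<eta> k n"
  \<comment> \<open>step 5\<close>
    and e: "\<And>n k. e n $ k = r k + b n $ k + d n $ k - (\<Sum>i\<in>UNIV. L k i (a n $ i))"
    and ps: "\<And>n i. ps n $ i = as n $ i + R i (a n)
        + (\<Sum>k\<in>UNIV. adjoint_on (H i) (L k i) (es n $ k))"
  \<comment> \<open>step 6\<close>
    and \<Delta>: "\<And>n. \<Delta> n =
      - inverse (4 * \<alpha>) * ((\<Sum>i\<in>UNIV. \<xi> i n) + (\<Sum>k\<in>UNIV. \<eta> k n))
      + (\<Sum>i\<in>UNIV. inner (x n $ i - a n $ i) (ps n $ i))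
      + (\<Sum>k\<in>UNIV. inner (y n $ k - b n $ k) (qs n $ k) + inner (z n $ k - d n $ k) (ts n $ k)
          + inner (e n $ k) (vs n $ k - es n $ k))"
  \<comment> \<open>step 7; \<open>\<zeta>\<close> is varsigma and \<open>\<theta>\<close> is the sequence chi\<close>
    and \<tau>: "\<And>n. \<Delta> n > 0 \<Longrightarrow> \<tau> n =
      (\<Sum>i\<in>UNIV. (norm (ps n $ i))\<^sup>2)
      + (\<Sum>k\<in>UNIV. (norm (qs n $ k))\<^sup>2 + (norm (ts n $ k))\<^sup>2 + (norm (e n $ k))\<^sup>2)"
    and \<zeta>: "\<And>n. \<Delta> n > 0 \<Longrightarrow> \<zeta> n =
      (\<Sum>i\<in>UNIV. (norm (x 0 $ i - x n $ i))\<^sup>2)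
      + (\<Sum>k\<in>UNIV. (norm (y 0 $ k - y n $ k))\<^sup>2 + (norm (z 0 $ k - z n $ k))\<^sup>2
          + (norm (vs 0 $ k - vs n $ k))\<^sup>2)"
    and \<theta>: "\<And>n. \<Delta> n > 0 \<Longrightarrow> \<theta> n =
      (\<Sum>i\<in>UNIV. inner (x 0 $ i - x n $ i) (ps n $ i))
      + (\<Sum>k\<in>UNIV. inner (y 0 $ k - y n $ k) (qs n $ k) + inner (z 0 $ k - z n $ k) (ts n $ k)
          + inner (e n $ k) (vs 0 $ k - vs n $ k))"
    and \<kappa>_lam: "\<And>n. \<Delta> n > 0 \<Longrightarrow> (\<kappa> n, lam n) = Xi (\<Delta> n) (\<tau> n) (\<zeta> n) (\<theta> n)"
    and update_pos: "\<And>n i k. \<Delta> n > 0 \<Longrightarrow>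
      x (Suc n) $ i = (1 - \<kappa> n) *\<^sub>R (x 0 $ i) + \<kappa> n *\<^sub>R (x n $ i) - lam n *\<^sub>R (ps n $ i) \<and>
      y (Suc n) $ k = (1 - \<kappa> n) *\<^sub>R (y 0 $ k) + \<kappa> n *\<^sub>R (y n $ k) - lam n *\<^sub>R (qs n $ k) \<and>
      z (Suc n) $ k = (1 - \<kappa> n) *\<^sub>R (z 0 $ k) + \<kappa> n *\<^sub>R (z n $ k) - lam n *\<^sub>R (ts n $ k) \<and>
      vs (Suc n) $ k = (1 - \<kappa> n) *\<^sub>R (vs 0 $ k) + \<kappa> n *\<^sub>R (vs n $ k) - lam n *\<^sub>R (e n $ k)"
    and update_nonpos: "\<And>n i k. \<not> \<Delta> n > 0 \<Longrightarrow>
      x (Suc n) $ i = x n $ i \<and> y (Suc n) $ k = y n $ k \<and>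
      z (Suc n) $ k = z n $ k \<and> vs (Suc n) $ k = vs n $ k"
  \<comment> \<open>the dual inclusion has a solution\<close>
    and dual: "\<exists>v. dual_solution H G s r A C Q R Bm Bc Bl Dm Dc Dl L v"
  shows "(\<forall>i. summable (\<lambda>n. (norm (x (Suc n) $ i - x n $ i))\<^sup>2)) \<and>
    (\<forall>k. summable (\<lambda>n. (norm (y (Suc n) $ k - y n $ k))\<^sup>2) \<and>
         summable (\<lambda>n. (norm (z (Suc n) $ k - z n $ k))\<^sup>2) \<and>
         summable (\<lambda>n. (norm (vs (Suc n) $ k - vs n $ k))\<^sup>2)) \<and>
    (\<forall>i k. (\<lambda>n. x n $ i - a n $ i) \<longlonglongrightarrow> 0 \<and>
           (\<lambda>n. y n $ k - b n $ k) \<longlonglongrightarrow> 0 \<and>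
           (\<lambda>n. z n $ k - d n $ k) \<longlonglongrightarrow> 0 \<and>
           (\<lambda>n. vs n $ k - es n $ k) \<longlonglongrightarrow> 0) \<and>
    (\<exists>xbar vbar.
       primal_solution H s r A C Q R Bm Bc Bl Dm Dc Dl L xbar \<and>
       dual_solution H G s r A C Q R Bm Bc Bl Dm Dc Dl L vbar \<and>
       (\<forall>i k. (\<lambda>n. x n $ i) \<longlonglongrightarrow> xbar $ i \<and>
              (\<lambda>n. a n $ i) \<longlonglongrightarrow> xbar $ i \<and>
              (\<lambda>n. vs n $ k) \<longlonglongrightarrow> vbar $ k) \<and>
       (xbar, vbar) \<in> kuhn_tucker_set H G s r A C Q R Bm Bc Bl Dm Dc Dl L)"
proof -
  have \<alpha>_props: "0 < \<alpha>" "\<alpha> \<le> \<alpha>c i" "\<alpha> \<le> \<beta>c k" "\<alpha> \<le> \<delta>c k" for i k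
  proof -
    let ?A = "range \<alpha>c \<union> range \<beta>c \<union> range \<delta>c"
    have "\<alpha> \<in> ?A" unfolding \<alpha> by (rule Min_in) auto
    then show "0 < \<alpha>"
      using C(2) Bc(2) Dc(2) unfolding cocoercive_on_def by auto
    show "\<alpha> \<le> \<alpha>c i" "\<alpha> \<le> \<beta>c k" "\<alpha> \<le> \<delta>c k" unfolding \<alpha> by (intro Min_le; simp)+
  qed
  interpret kuhn_tucker_problem H G s r A C Q R Bm Dm Bc Bl Dc Dl L \<alpha>c \<alpha>l \<beta>c \<beta>l \<delta>c \<delta>l chi \<alpha>
    by unfold_locales (rule H G s r A C Q R Bm Bc Bl Dm Dc Dl L \<alpha>_props)+

  \<comment> \<open>The index of the iterate from which the current value of a block was computed: the delay is
    counted from the last activation of the block. With these indices the formulas for active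
    blocks hold at every step.\<close>
  define \<pi>' where "\<pi>' i n = \<pi> i (last_update In i n)" for i n
  define \<omega>' where "\<omega>' k n = \<omega> k (last_update Kn k n)" for k n
  have lag: "\<pi>' i n \<le> n" "n \<le> \<pi>' i n + (P + T)" "\<omega>' k n \<le> n" "n \<le> \<omega>' k n + (P + T)" for i k n
  proof -
    have "last_update In i n \<le> n" "n \<le> last_update In i n + P"
      "last_update Kn k n \<le> n" "n \<le> last_update Kn k n + P"
      by (rule last_update_props(1)[where J = In, OF In(2)] last_update_window[where J = In, OF In(2,3)]
          last_update_props(1)[where J = Kn, OF Kn(2)] last_update_window[where J = Kn, OF Kn(2,3)])+
    with \<pi>(1)[of "last_update In i n" i] \<pi>(2)[of i "last_update In i n"]
      \<omega>(1)[of "last_update Kn k n" k] \<omega>(2)[of k "last_update Kn k n"]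
    show "\<pi>' i n \<le> n" "n \<le> \<pi>' i n + (P + T)" "\<omega>' k n \<le> n" "n \<le> \<omega>' k n + (P + T)"
      unfolding \<pi>'_def \<omega>'_def by linarith+
  qed

  have \<gamma>': "0 < \<gamma> i n" "\<alpha>l i + chi + \<sigma> \<le> inverse (\<gamma> i n)" "\<bar>inverse (\<gamma> i n)\<bar> \<le> 1 / \<epsilon>"
    and \<mu>': "0 < \<mu> k n" "\<beta>l k + \<sigma> \<le> inverse (\<mu> k n)" "\<bar>inverse (\<mu> k n)\<bar> \<le> 1 / \<epsilon>"
    and \<nu>': "0 < \<nu> k n" "\<delta>l k + \<sigma> \<le> inverse (\<nu> k n)" "\<bar>inverse (\<nu> k n)\<bar> \<le> 1 / \<epsilon>"
    and \<sigma>k': "0 < \<sigma>k k n" "\<epsilon> \<le> inverse (\<sigma>k k n)" "\<bar>inverse (\<sigma>k k n)\<bar> \<le> 1 / \<epsilon>" for i k n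
  proof -
    have step: "0 < c \<and> m \<le> inverse c \<and> \<bar>inverse c\<bar> \<le> 1 / \<epsilon>" if "c \<in> {\<epsilon>..1 / m}" "0 < m" for c m
      using that \<epsilon>(1) by (auto simp: field_simps)
    have nn: "0 \<le> \<alpha>l i" "0 \<le> chi" "0 \<le> \<beta>l k" "0 \<le> \<delta>l k"
      by (rule lipschitz_on_nonneg[OF Q(3)] lipschitz_on_nonneg[OF R(3)] lipschitz_on_nonneg[OF Bl(3)]
          lipschitz_on_nonneg[OF Dl(3)])+
    show "0 < \<gamma> i n" "\<alpha>l i + chi + \<sigma> \<le> inverse (\<gamma> i n)" "\<bar>inverse (\<gamma> i n)\<bar> \<le> 1 / \<epsilon>"
      using step[OF \<gamma>[of i n]] nn \<sigma>(1) by auto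
    show "0 < \<mu> k n" "\<beta>l k + \<sigma> \<le> inverse (\<mu> k n)" "\<bar>inverse (\<mu> k n)\<bar> \<le> 1 / \<epsilon>"
      using step[OF \<mu>[of k n]] nn \<sigma>(1) by auto
    show "0 < \<nu> k n" "\<delta>l k + \<sigma> \<le> inverse (\<nu> k n)" "\<bar>inverse (\<nu> k n)\<bar> \<le> 1 / \<epsilon>"
      using step[OF \<nu>[of k n]] nn \<sigma>(1) by auto
    show "0 < \<sigma>k k n" "\<epsilon> \<le> inverse (\<sigma>k k n)" "\<bar>inverse (\<sigma>k k n)\<bar> \<le> 1 / \<epsilon>"
      using step[OF \<sigma>k[of k n] \<epsilon>(1)] by auto
  qed

  define l' where "l' i n = Q i (x (\<pi>' i n) $ i) + R i (x (\<pi>' i n)) + (\<Sum>k\<in>UNIV. Ls k i (vs (\<pi>' i n) $ k))" for i n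
  have a_res: "inverse (\<gamma> i (\<pi>' i n)) *\<^sub>R (x (\<pi>' i n) $ i - a n $ i)
        + (s i - l' i n - C i (x (\<pi>' i n) $ i)) \<in> A i (a n $ i)"
    and as_eq: "as n $ i = inverse (\<gamma> i (\<pi>' i n)) *\<^sub>R (x (\<pi>' i n) $ i - a n $ i) - l' i n + Q i (a n $ i)"
    and \<xi>_eq: "\<xi> i n = (norm (x (\<pi>' i n) $ i - a n $ i))\<^sup>2" for i n
  proof -
    let ?m = "last_update In i n"
    have m: "i \<in> In ?m" by (rule last_update_props(2)[where J = In, OF In(2)])
    have eqs: "a n $ i = a ?m $ i" "as n $ i = as ?m $ i" "\<xi> i n = \<xi> i ?m"
      by (rule unchanged_since_last_update[where J = In and f = "\<lambda>n. a n $ i", OF In(2)]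
          unchanged_since_last_update[where J = In and f = "\<lambda>n. as n $ i", OF In(2)]
          unchanged_since_last_update[where J = In and f = "\<lambda>n. \<xi> i n", OF In(2)]; use step2 in blast)+
    have l'_eq: "ls ?m $ i = l' i n" using ls[OF m] by (simp add: l'_def \<pi>'_def)
    show "inverse (\<gamma> i (\<pi>' i n)) *\<^sub>R (x (\<pi>' i n) $ i - a n $ i)
        + (s i - l' i n - C i (x (\<pi>' i n) $ i)) \<in> A i (a n $ i)"
      using resolvent_scale_operator_imp[OF a[OF m]] \<gamma>'(1)[of i "\<pi> i ?m"]
      by (simp add: eqs l'_eq \<pi>'_def)
    show "as n $ i = inverse (\<gamma> i (\<pi>' i n)) *\<^sub>R (x (\<pi>' i n) $ i - a n $ i) - l' i n + Q i (a n $ i)"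
      using as[OF m] by (simp add: eqs l'_eq \<pi>'_def)
    show "\<xi> i n = (norm (x (\<pi>' i n) $ i - a n $ i))\<^sup>2"
      using \<xi>[OF m] by (simp add: eqs \<pi>'_def norm_minus_commute)
  qed
  have b_res: "inverse (\<mu> k (\<omega>' k n)) *\<^sub>R (y (\<omega>' k n) $ k - b n $ k)
        + (vs (\<omega>' k n) $ k - Bl k (y (\<omega>' k n) $ k) - Bc k (y (\<omega>' k n) $ k)) \<in> Bm k (b n $ k)"
    and d_res: "inverse (\<nu> k (\<omega>' k n)) *\<^sub>R (z (\<omega>' k n) $ k - d n $ k)
        + (vs (\<omega>' k n) $ k - Dl k (z (\<omega>' k n) $ k) - Dc k (z (\<omega>' k n) $ k)) \<in> Dm k (d n $ k)"
    and es_eq: "es n $ k = \<sigma>k k (\<omega>' k n) *\<^sub>R ((\<Sum>i\<in>UNIV. L k i (x (\<omega>' k n) $ i))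
          - y (\<omega>' k n) $ k - z (\<omega>' k n) $ k - r k) + vs (\<omega>' k n) $ k"
    and qs_eq: "qs n $ k = inverse (\<mu> k (\<omega>' k n)) *\<^sub>R (y (\<omega>' k n) $ k - b n $ k)
        + (vs (\<omega>' k n) $ k - Bl k (y (\<omega>' k n) $ k)) + Bl k (b n $ k) - es n $ k"
    and ts_eq: "ts n $ k = inverse (\<nu> k (\<omega>' k n)) *\<^sub>R (z (\<omega>' k n) $ k - d n $ k)
        + (vs (\<omega>' k n) $ k - Dl k (z (\<omega>' k n) $ k)) + Dl k (d n $ k) - es n $ k"
    and \<eta>_eq: "\<eta> k n = (norm (y (\<omega>' k n) $ k - b n $ k))\<^sup>2 + (norm (z (\<omega>' k n) $ k - d n $ k))\<^sup>2" for k n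
  proof -
    let ?m = "last_update Kn k n"
    have m: "k \<in> Kn ?m" by (rule last_update_props(2)[where J = Kn, OF Kn(2)])
    have eqs: "b n $ k = b ?m $ k" "d n $ k = d ?m $ k" "es n $ k = es ?m $ k"
        "qs n $ k = qs ?m $ k" "ts n $ k = ts ?m $ k" "\<eta> k n = \<eta> k ?m"
      by (rule unchanged_since_last_update[where J = Kn and f = "\<lambda>n. b n $ k", OF Kn(2)]
          unchanged_since_last_update[where J = Kn and f = "\<lambda>n. d n $ k", OF Kn(2)]
          unchanged_since_last_update[where J = Kn and f = "\<lambda>n. es n $ k", OF Kn(2)]
          unchanged_since_last_update[where J = Kn and f = "\<lambda>n. qs n $ k", OF Kn(2)]
          unchanged_since_last_update[where J = Kn and f = "\<lambda>n. ts n $ k", OF Kn(2)]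
          unchanged_since_last_update[where J = Kn and f = "\<lambda>n. \<eta> k n", OF Kn(2)]; use step4 in blast)+
    show "inverse (\<mu> k (\<omega>' k n)) *\<^sub>R (y (\<omega>' k n) $ k - b n $ k)
        + (vs (\<omega>' k n) $ k - Bl k (y (\<omega>' k n) $ k) - Bc k (y (\<omega>' k n) $ k)) \<in> Bm k (b n $ k)"
      using resolvent_scale_operator_imp[OF b[OF m]] \<mu>'(1)[of k "\<omega> k ?m"]
      by (simp add: eqs us[OF m] \<omega>'_def)
    show "inverse (\<nu> k (\<omega>' k n)) *\<^sub>R (z (\<omega>' k n) $ k - d n $ k)
        + (vs (\<omega>' k n) $ k - Dl k (z (\<omega>' k n) $ k) - Dc k (z (\<omega>' k n) $ k)) \<in> Dm k (d n $ k)"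
      using resolvent_scale_operator_imp[OF d[OF m]] \<nu>'(1)[of k "\<omega> k ?m"]
      by (simp add: eqs ws[OF m] \<omega>'_def)
    show "es n $ k = \<sigma>k k (\<omega>' k n) *\<^sub>R ((\<Sum>i\<in>UNIV. L k i (x (\<omega>' k n) $ i))
          - y (\<omega>' k n) $ k - z (\<omega>' k n) $ k - r k) + vs (\<omega>' k n) $ k"
      using es[OF m] by (simp only: eqs \<omega>'_def)
    show "qs n $ k = inverse (\<mu> k (\<omega>' k n)) *\<^sub>R (y (\<omega>' k n) $ k - b n $ k)
        + (vs (\<omega>' k n) $ k - Bl k (y (\<omega>' k n) $ k)) + Bl k (b n $ k) - es n $ k"
      using qs[OF m] by (simp only: eqs us[OF m] \<omega>'_def)
    show "ts n $ k = inverse (\<nu> k (\<omega>' k n)) *\<^sub>R (z (\<omega>' k n) $ k - d n $ k)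
        + (vs (\<omega>' k n) $ k - Dl k (z (\<omega>' k n) $ k)) + Dl k (d n $ k) - es n $ k"
      using ts[OF m] by (simp only: eqs ws[OF m] \<omega>'_def)
    show "\<eta> k n = (norm (y (\<omega>' k n) $ k - b n $ k))\<^sup>2 + (norm (z (\<omega>' k n) $ k - d n $ k))\<^sup>2"
      using \<eta>[OF m] by (simp only: eqs \<omega>'_def norm_minus_commute)
  qed

  \<comment> \<open>The algorithm as one sequence in the product space. In \<open>X' n\<close> every block is delayed as in
    the step that produced the current \<open>a' n\<close>; its dual block is arbitrary, since neither
    \<open>cocoercive_part\<close> nor \<open>drop_dual\<close> sees it.\<close>
  define X where "X n = (x n, y n, z n, vs n)" for n
  define X' where "X' n = (\<chi> i. x (\<pi>' i n) $ i, \<chi> k. y (\<omega>' k n) $ k, \<chi> k. z (\<omega>' k n) $ k, vs n)" for n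
  define a' where "a' n = (a n, b n, d n, es n)" for n
  define g where "g n = (ps n, qs n, ts n, e n)" for n
  define W :: "nat \<Rightarrow> ('h, 'i, 'g, 'k) saddle_vector \<Rightarrow> ('h, 'i, 'g, 'k) saddle_vector"
    where "W n = weight (\<lambda>i. inverse (\<gamma> i (\<pi>' i n))) (\<lambda>k. inverse (\<mu> k (\<omega>' k n)))
      (\<lambda>k. inverse (\<nu> k (\<omega>' k n))) (\<lambda>k. inverse (\<sigma>k k (\<omega>' k n)))" for n
  define N where "N n u = W n u - lipschitz_part u" for n u

  have graph: "p \<in> S \<and> q \<in> S" if "maximally_monotone_on S M" "q \<in> M p"
    for S and M :: "'c::real_inner \<Rightarrow> 'c set" and p q
    using that unfolding maximally_monotone_on_def operator_on_def by blast
  have abd_mem: "a n $ i \<in> H i" "b n $ k \<in> G k" "d n $ k \<in> G k" for n i k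
    using graph[OF A a_res] graph[OF Bm b_res] graph[OF Dm d_res] by blast+
  have a_mem: "a n \<in> direct_sum H" for n using abd_mem(1) by (simp add: direct_sum_def)
  have g_mem: "g n \<in> saddle_space" and es_mem: "\<And>k. es n $ k \<in> G k"
    if prev: "\<And>m. m \<le> n \<Longrightarrow> X m \<in> saddle_space" for n
  proof -
    have X_mem: "x m $ i \<in> H i" "x m \<in> direct_sum H" "y m $ k \<in> G k" "z m $ k \<in> G k" "vs m $ k \<in> G k"
      if "m \<le> n" for m i k
      using prev[OF that] by (auto simp: X_def mem_saddle_space direct_sum_def)
    have "l' i n \<in> H i" for i
      unfolding l'_def by (intro subspace_add subspace_sum sub_H Ls_mem funcset_mem[OF Q(1)]
        funcset_mem[OF R(1)] X_mem lag)
    then have "as n $ i \<in> H i" for i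
      unfolding as_eq by (intro subspace_add subspace_diff subspace_scale sub_H
        funcset_mem[OF Q(1)] X_mem lag abd_mem)
    then have ps_mem: "ps n $ i \<in> H i" for i
      unfolding ps by (intro subspace_add subspace_sum sub_H Ls_mem funcset_mem[OF R(1)] a_mem)
    show es_mem: "es n $ k \<in> G k" for k
      unfolding es_eq by (intro subspace_add subspace_diff subspace_scale subspace_sum sub_G
        L_mem X_mem lag r)
    have "qs n $ k \<in> G k" "ts n $ k \<in> G k" for k
      unfolding qs_eq ts_eq by (intro subspace_add subspace_diff subspace_scale sub_G es_mem
        funcset_mem[OF Bl(1)] funcset_mem[OF Dl(1)] X_mem lag abd_mem)+
    moreover have "e n $ k \<in> G k" for k
      unfolding e by (intro subspace_add subspace_diff subspace_sum sub_G L_mem abd_mem r)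
    ultimately show "g n \<in> saddle_space" using ps_mem by (simp add: g_def mem_saddle_space)
  qed
  have update: "X (Suc n) = (1 - \<kappa> n) *\<^sub>R X 0 + \<kappa> n *\<^sub>R X n - lam n *\<^sub>R g n" if "\<Delta> n > 0" for n
    using update_pos[OF that] by (simp add: X_def g_def vec_eq_iff)
  have idle: "X (Suc n) = X n" if "\<not> \<Delta> n > 0" for n
    using update_nonpos[OF that] by (simp add: X_def vec_eq_iff)
  have X_upto: "\<forall>m\<le>n. X m \<in> saddle_space" for n
  proof (induction n)
    case 0
    show ?case using init by (simp add: X_def mem_saddle_space)
  next
    case (Suc n)
    have "X (Suc n) \<in> saddle_space"
    proof (cases "\<Delta> n > 0")
      case True
      show ?thesis unfolding update[OF True]
        using Suc g_mem by (intro subspace_add subspace_diff subspace_scale subspace_saddle_space) auto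
    next
      case False
      then show ?thesis using idle Suc by simp
    qed
    with Suc show ?case by (simp add: le_Suc_eq)
  qed
  then have X_mem: "X n \<in> saddle_space" for n by blast
  then have comp_mem: "x n $ i \<in> H i" "x n \<in> direct_sum H" "y n $ k \<in> G k" "z n $ k \<in> G k" "vs n $ k \<in> G k" for n i k
    by (auto simp: X_def mem_saddle_space direct_sum_def)
  have a'_mem: "a' n \<in> saddle_space" for n
    using abd_mem es_mem X_mem by (simp add: a'_def mem_saddle_space)
  have X'_mem: "X' n \<in> saddle_space" for n
    using comp_mem by (simp add: X'_def mem_saddle_space)

  \<comment> \<open>The resolvent inclusions, rewritten as one inclusion for the saddle operator.\<close>
  have incl: "g n - lipschitz_part (a' n) - cocoercive_part (X' n) \<in> maximal_part (a' n)" for n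
  proof -
    have 1: "ps n $ i - (Q i (a n $ i) + R i (a n) + (\<Sum>k\<in>UNIV. Ls k i (es n $ k)) - s i) - C i (x (\<pi>' i n) $ i)
        \<in> A i (a n $ i)" for i
    proof -
      have "ps n $ i - (Q i (a n $ i) + R i (a n) + (\<Sum>k\<in>UNIV. Ls k i (es n $ k)) - s i) - C i (x (\<pi>' i n) $ i)
        = inverse (\<gamma> i (\<pi>' i n)) *\<^sub>R (x (\<pi>' i n) $ i - a n $ i) + (s i - l' i n - C i (x (\<pi>' i n) $ i))"
        unfolding ps as_eq by simp
      then show ?thesis by (simp only: a_res)
    qed
    have 2: "qs n $ k - (Bl k (b n $ k) - es n $ k) - Bc k (y (\<omega>' k n) $ k) \<in> Bm k (b n $ k)" for k
      using b_res[where n = n and k = k] unfolding qs_eq by (simp add: algebra_simps)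
    have 3: "ts n $ k - (Dl k (d n $ k) - es n $ k) - Dc k (z (\<omega>' k n) $ k) \<in> Dm k (d n $ k)" for k
      using d_res[where n = n and k = k] unfolding ts_eq by (simp add: algebra_simps)
    have 4: "e n - (\<chi> k. r k + b n $ k + d n $ k - (\<Sum>i\<in>UNIV. L k i (a n $ i))) - 0 = 0"
      by (simp add: vec_eq_iff e)
    have 5: "es n \<in> direct_sum G"
      using a'_mem[of n] by (simp add: a'_def mem_saddle_space direct_sum_def)
    show ?thesis
      unfolding g_def a'_def X'_def lipschitz_part_def cocoercive_part_def maximal_part_def
        pair_operator_def vec_operator_def zero_operator_def prod.case diff_Pair fst_conv snd_conv
        mem_Times_iff mem_Collect_eq vector_minus_component vec_lambda_beta 4
      using 1 2 3 5 by simp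
  qed

  have \<Delta>_eq: "\<Delta> n = inner (X n - a' n) (g n) - 1 / (4 * \<alpha>) * (norm (drop_dual (X' n - a' n)))\<^sup>2" for n
  proof -
    have "(norm (drop_dual (X' n - a' n)))\<^sup>2 = (\<Sum>i\<in>UNIV. \<xi> i n) + (\<Sum>k\<in>UNIV. \<eta> k n)"
      by (simp add: X'_def a'_def drop_dual_def norm_Pair_square norm_vec_square \<xi>_eq \<eta>_eq sum.distrib)
    moreover have "inner (X n - a' n) (g n) = (\<Sum>i\<in>UNIV. inner (x n $ i - a n $ i) (ps n $ i))
      + (\<Sum>k\<in>UNIV. inner (y n $ k - b n $ k) (qs n $ k) + inner (z n $ k - d n $ k) (ts n $ k)
          + inner (e n $ k) (vs n $ k - es n $ k))"
      by (simp add: X_def a'_def g_def inner_vec_def sum.distrib inner_commute[of "e n $ _"])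
    ultimately show ?thesis unfolding \<Delta> by (simp add: inverse_eq_divide)
  qed

  have step: "\<exists>q l. (q, l) = Xi (\<Delta> n) ((norm (g n))\<^sup>2) ((norm (X 0 - X n))\<^sup>2) (inner (X 0 - X n) (g n)) \<and>
        X (Suc n) = (1 - q) *\<^sub>R X 0 + q *\<^sub>R X n - l *\<^sub>R g n" if "\<Delta> n > 0" for n
  proof -
    have "\<tau> n = (norm (g n))\<^sup>2"
      by (simp add: \<tau>[OF that] g_def norm_Pair_square norm_vec_square sum.distrib)
    moreover have "\<zeta> n = (norm (X 0 - X n))\<^sup>2"
      by (simp add: \<zeta>[OF that] X_def norm_Pair_square norm_vec_square sum.distrib)
    moreover have "\<theta> n = inner (X 0 - X n) (g n)"
      by (simp add: \<theta>[OF that] X_def g_def inner_vec_def sum.distrib inner_commute[of "e n $ _"])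
    ultimately show ?thesis using \<kappa>_lam[OF that] update[OF that] by auto
  qed

  have lagged: "(\<lambda>n. x (\<pi>' i n) - x n) \<longlonglongrightarrow> 0" "(\<lambda>n. vs (\<pi>' i n) - vs n) \<longlonglongrightarrow> 0"
    "(\<lambda>n. x (\<omega>' k n) - x n) \<longlonglongrightarrow> 0" "(\<lambda>n. y (\<omega>' k n) - y n) \<longlonglongrightarrow> 0"
    "(\<lambda>n. z (\<omega>' k n) - z n) \<longlonglongrightarrow> 0" "(\<lambda>n. vs (\<omega>' k n) - vs n) \<longlonglongrightarrow> 0"
    if "(\<lambda>n. X (Suc n) - X n) \<longlonglongrightarrow> 0" for i k
  proof -
    note I = delayed_difference_null[of X "\<pi>' i", OF that lag(1,2)]
    note K = delayed_difference_null[of X "\<omega>' k", OF that lag(3,4)]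
    show "(\<lambda>n. x (\<pi>' i n) - x n) \<longlonglongrightarrow> 0" using tendsto_fst[OF I] by (simp add: X_def)
    show "(\<lambda>n. vs (\<pi>' i n) - vs n) \<longlonglongrightarrow> 0"
      using tendsto_snd[OF tendsto_snd[OF tendsto_snd[OF I]]] by (simp add: X_def)
    show "(\<lambda>n. x (\<omega>' k n) - x n) \<longlonglongrightarrow> 0" using tendsto_fst[OF K] by (simp add: X_def)
    show "(\<lambda>n. y (\<omega>' k n) - y n) \<longlonglongrightarrow> 0" using tendsto_fst[OF tendsto_snd[OF K]] by (simp add: X_def)
    show "(\<lambda>n. z (\<omega>' k n) - z n) \<longlonglongrightarrow> 0"
      using tendsto_fst[OF tendsto_snd[OF tendsto_snd[OF K]]] by (simp add: X_def)
    show "(\<lambda>n. vs (\<omega>' k n) - vs n) \<longlonglongrightarrow> 0"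
      using tendsto_snd[OF tendsto_snd[OF tendsto_snd[OF K]]] by (simp add: X_def)
  qed
  have nth_null: "(\<lambda>n. p n $ j - q n $ j) \<longlonglongrightarrow> 0" if "(\<lambda>n. p n - q n) \<longlonglongrightarrow> 0"
    for p q :: "nat \<Rightarrow> 'c::real_normed_vector ^ 'd::finite" and j
    using tendsto_vec_nth[OF that, of j] by simp
  have delay: "(\<lambda>n. X' n - X n) \<longlonglongrightarrow> 0" if "(\<lambda>n. X (Suc n) - X n) \<longlonglongrightarrow> 0"
  proof -
    have "(\<lambda>n. ((\<chi> i. x (\<pi>' i n) $ i - x n $ i), (\<chi> k. y (\<omega>' k n) $ k - y n $ k),
        (\<chi> k. z (\<omega>' k n) $ k - z n $ k), (0::'g^'k))) \<longlonglongrightarrow> (0, 0, 0, 0)"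
      by (intro tendsto_Pair vec_tendstoI tendsto_const)
        (simp_all add: nth_null[OF lagged(1)[OF that]] nth_null[OF lagged(4)[OF that]] nth_null[OF lagged(5)[OF that]])
    moreover have "X' n - X n = ((\<chi> i. x (\<pi>' i n) $ i - x n $ i), (\<chi> k. y (\<omega>' k n) $ k - y n $ k),
        (\<chi> k. z (\<omega>' k n) $ k - z n $ k), 0)" for n
      by (simp add: X'_def X_def vec_eq_iff)
    ultimately show ?thesis by (simp add: zero_prod_def)
  qed
  \<comment> \<open>All terms that contain \<open>a' n\<close> cancel; what remains are differences between delayed and current
    iterates under Lipschitzian maps.\<close>
  have residual: "(\<lambda>n. g n - (N n (X n) - N n (a' n))) \<longlonglongrightarrow> 0" if X0: "(\<lambda>n. X (Suc n) - X n) \<longlonglongrightarrow> 0"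
  proof -
    define r1 where "r1 i n = inverse (\<gamma> i (\<pi>' i n)) *\<^sub>R (x (\<pi>' i n) $ i - x n $ i)
        - (Q i (x (\<pi>' i n) $ i) - Q i (x n $ i)) - (R i (x (\<pi>' i n)) - R i (x n))
        - ((\<Sum>k\<in>UNIV. Ls k i (vs (\<pi>' i n) $ k)) - (\<Sum>k\<in>UNIV. Ls k i (vs n $ k)))" for i n
    define r2 where "r2 k n = inverse (\<mu> k (\<omega>' k n)) *\<^sub>R (y (\<omega>' k n) $ k - y n $ k)
        + (vs (\<omega>' k n) $ k - vs n $ k) - (Bl k (y (\<omega>' k n) $ k) - Bl k (y n $ k))" for k n
    define r3 where "r3 k n = inverse (\<nu> k (\<omega>' k n)) *\<^sub>R (z (\<omega>' k n) $ k - z n $ k)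
        + (vs (\<omega>' k n) $ k - vs n $ k) - (Dl k (z (\<omega>' k n) $ k) - Dl k (z n $ k))" for k n
    define r4 where "r4 k n = inverse (\<sigma>k k (\<omega>' k n)) *\<^sub>R (vs (\<omega>' k n) $ k - vs n $ k)
        + ((\<Sum>i\<in>UNIV. L k i (x (\<omega>' k n) $ i)) - (\<Sum>i\<in>UNIV. L k i (x n $ i)))
        - (y (\<omega>' k n) $ k - y n $ k) - (z (\<omega>' k n) $ k - z n $ k)" for k n
    have "g n - (N n (X n) - N n (a' n)) = ((\<chi> i. r1 i n), (\<chi> k. r2 k n), (\<chi> k. r3 k n), (\<chi> k. r4 k n))" for n
    proof -
      have 1: "ps n $ i - (inverse (\<gamma> i (\<pi>' i n)) *\<^sub>R x n $ i
            - (Q i (x n $ i) + R i (x n) + (\<Sum>k\<in>UNIV. Ls k i (vs n $ k)) - s i)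
          - (inverse (\<gamma> i (\<pi>' i n)) *\<^sub>R a n $ i
            - (Q i (a n $ i) + R i (a n) + (\<Sum>k\<in>UNIV. Ls k i (es n $ k)) - s i))) = r1 i n" for i
        unfolding ps as_eq r1_def l'_def by (simp add: scaleR_diff_right)
      have 2: "qs n $ k - (inverse (\<mu> k (\<omega>' k n)) *\<^sub>R y n $ k - (Bl k (y n $ k) - vs n $ k)
          - (inverse (\<mu> k (\<omega>' k n)) *\<^sub>R b n $ k - (Bl k (b n $ k) - es n $ k))) = r2 k n" for k
        unfolding qs_eq r2_def by (simp add: scaleR_diff_right)
      have 3: "ts n $ k - (inverse (\<nu> k (\<omega>' k n)) *\<^sub>R z n $ k - (Dl k (z n $ k) - vs n $ k)
          - (inverse (\<nu> k (\<omega>' k n)) *\<^sub>R d n $ k - (Dl k (d n $ k) - es n $ k))) = r3 k n" for k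
        unfolding ts_eq r3_def by (simp add: scaleR_diff_right)
      have 4: "e n $ k - (inverse (\<sigma>k k (\<omega>' k n)) *\<^sub>R vs n $ k
            - (r k + y n $ k + z n $ k - (\<Sum>i\<in>UNIV. L k i (x n $ i)))
          - (inverse (\<sigma>k k (\<omega>' k n)) *\<^sub>R es n $ k
            - (r k + b n $ k + d n $ k - (\<Sum>i\<in>UNIV. L k i (a n $ i))))) = r4 k n" for k
      proof -
        \<comment> \<open>Dividing by the step size recovers the delayed constraint defect from \<open>es n\<close>.\<close>
        have "inverse (\<sigma>k k (\<omega>' k n)) *\<^sub>R es n $ k = ((\<Sum>i\<in>UNIV. L k i (x (\<omega>' k n) $ i))
          - y (\<omega>' k n) $ k - z (\<omega>' k n) $ k - r k) + inverse (\<sigma>k k (\<omega>' k n)) *\<^sub>R vs (\<omega>' k n) $ k"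
          using \<sigma>k'(1)[of k "\<omega>' k n"] by (simp add: es_eq scaleR_add_right)
        then show ?thesis unfolding e r4_def by (simp add: scaleR_diff_right)
      qed
      show ?thesis
        unfolding g_def N_def W_def X_def a'_def weight_def lipschitz_part_def prod.case diff_Pair
          prod.inject vec_eq_iff vector_minus_component vec_lambda_beta 1 2 3 4
        by simp
    qed
    moreover have "(\<lambda>n. ((\<chi> i. r1 i n), (\<chi> k. r2 k n), (\<chi> k. r3 k n), (\<chi> k. r4 k n))) \<longlonglongrightarrow> (0, 0, 0, 0)"
    proof (intro tendsto_Pair vec_tendstoI)
      note lags = lagged[OF X0]
      note comp = lags[THEN nth_null]
      fix i
      have R_lip: "lipschitz_map_on (direct_sum H) (R i)"
        using lipschitz_map_on_nth[OF lipschitz_map_onI[OF R(3)], of i] by simp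
      have Ls_lip: "lipschitz_map_on UNIV (\<lambda>v :: 'g ^ 'k. \<Sum>k\<in>UNIV. Ls k i (v $ k))"
        by (intro lipschitz_map_on_sum lipschitz_map_on_compose[OF lipschitz_map_on_adjoint_on[OF H L, where V = UNIV]]
            lipschitz_map_on_nth lipschitz_map_onI[OF lipschitz_on_id] UNIV_I)
      have "(\<lambda>n. r1 i n) \<longlonglongrightarrow> 0 - 0 - 0 - 0"
        unfolding r1_def
        by (intro tendsto_diff
            scaled_difference_null[OF comp(1) \<gamma>'(3)]
            lipschitz_map_on_difference_null[OF lipschitz_map_onI[OF Q(3)] comp_mem(1) comp_mem(1) comp(1)]
            lipschitz_map_on_difference_null[OF R_lip comp_mem(2) comp_mem(2) lags(1)]
            lipschitz_map_on_difference_null[OF Ls_lip UNIV_I UNIV_I lags(2)])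
      then show "(\<lambda>n. (\<chi> i. r1 i n) $ i) \<longlonglongrightarrow> 0 $ i" by simp
    next
      note lags = lagged[OF X0]
      note comp = lags[THEN nth_null]
      fix k
      have L_lip: "lipschitz_map_on (direct_sum H) (\<lambda>p. \<Sum>i\<in>UNIV. L k i (p $ i))"
        by (intro lipschitz_map_on_sum lipschitz_map_on_compose[OF lipschitz_map_on_bounded_linear_between[OF sub_H L]]
            lipschitz_map_on_nth lipschitz_map_onI[OF lipschitz_on_id]) (simp add: direct_sum_def)
      have "(\<lambda>n. r2 k n) \<longlonglongrightarrow> 0 + 0 - 0"
        unfolding r2_def
        by (intro tendsto_diff tendsto_add scaled_difference_null[OF comp(4) \<mu>'(3)] comp(6)
            lipschitz_map_on_difference_null[OF lipschitz_map_onI[OF Bl(3)] comp_mem(3) comp_mem(3) comp(4)])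
      then show "(\<lambda>n. (\<chi> k. r2 k n) $ k) \<longlonglongrightarrow> 0 $ k" by simp
      have "(\<lambda>n. r3 k n) \<longlonglongrightarrow> 0 + 0 - 0"
        unfolding r3_def
        by (intro tendsto_diff tendsto_add scaled_difference_null[OF comp(5) \<nu>'(3)] comp(6)
            lipschitz_map_on_difference_null[OF lipschitz_map_onI[OF Dl(3)] comp_mem(4) comp_mem(4) comp(5)])
      then show "(\<lambda>n. (\<chi> k. r3 k n) $ k) \<longlonglongrightarrow> 0 $ k" by simp
      have "(\<lambda>n. r4 k n) \<longlonglongrightarrow> 0 + 0 - 0 - 0"
        unfolding r4_def
        by (intro tendsto_diff tendsto_add scaled_difference_null[OF comp(6) \<sigma>k'(3)] comp(4) comp(5)
            lipschitz_map_on_difference_null[OF L_lip comp_mem(2) comp_mem(2) lags(3)])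
      then show "(\<lambda>n. (\<chi> k. r4 k n) $ k) \<longlonglongrightarrow> 0 $ k" by simp
    qed
    ultimately show ?thesis by (simp add: zero_prod_def)
  qed

  obtain cB where cB: "cB-lipschitz_on saddle_space lipschitz_part"
    using lipschitz_part_lipschitz by (auto simp: lipschitz_map_on_def)
  interpret outer_approximation saddle_space maximal_part lipschitz_part cocoercive_part drop_dual
    N X a' X' g \<Delta> cB "1 / \<alpha>" "1 / \<epsilon> + cB" "1 / (4 * \<alpha>)" "min (\<sigma> - 1 / (4 * \<alpha>)) \<epsilon>"
  proof (rule outer_approximation.intro)
    show "0 \<le> 1 / (4 * \<alpha>)" using \<alpha>_props(1) by simp
    show "0 < min (\<sigma> - 1 / (4 * \<alpha>)) \<epsilon>" using \<sigma>(2) \<epsilon>(1) by simp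
    show "min (\<sigma> - 1 / (4 * \<alpha>)) \<epsilon> * (norm (u - v))\<^sup>2 + 1 / (4 * \<alpha>) * (norm (drop_dual (u - v)))\<^sup>2
        \<le> inner (u - v) (N n u - N n v)" if "u \<in> saddle_space" "v \<in> saddle_space" for n u v
      unfolding N_def W_def
      by (rule weight_strongly_monotone[OF that \<gamma>'(2) \<mu>'(2) \<nu>'(2) \<sigma>k'(2)]) simp_all
    show "(1 / \<epsilon> + cB)-lipschitz_on saddle_space (N n)" for n
      unfolding N_def[abs_def] W_def
      by (intro lipschitz_on_diff weight_lipschitz cB \<gamma>'(3) \<mu>'(3) \<nu>'(3) \<sigma>k'(3))
    show "inner (v - w) (cocoercive_part u - cocoercive_part v)
        \<le> 1 / (4 * \<alpha>) * (norm (drop_dual (u - w)))\<^sup>2"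
      if "u \<in> saddle_space" "v \<in> saddle_space" for u v w
      using that by (rule cocoercive_part_three_point)
    show "\<exists>h\<in>saddle_space. - (lipschitz_part h + cocoercive_part h) \<in> maximal_part h"
      using dual dual_solution_imp_saddle_zero by blast
  qed (fact saddle_space maximal_part lipschitz_part_mem lipschitz_part_monotone cB cocoercive_part_mem
      cocoercive_part_lipschitz drop_dual X_mem a'_mem X'_mem incl \<Delta>_eq
      step idle delay residual)+

  obtain u where u: "u \<in> saddle_space" "- (lipschitz_part u + cocoercive_part u) \<in> maximal_part u" "X \<longlonglongrightarrow> u"
    using converges_to_zero by blast
  obtain xbar ybar zbar vbar where u_eq: "u = (xbar, ybar, zbar, vbar)" by (cases u) auto
  note sol = saddle_zero_imp_solutions[OF u(1)[unfolded u_eq] u(2)[unfolded u_eq]]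
  have x_lim: "x \<longlonglongrightarrow> xbar" using tendsto_fst[OF u(3)] by (simp add: X_def u_eq)
  have vs_lim: "vs \<longlonglongrightarrow> vbar"
    using tendsto_snd[OF tendsto_snd[OF tendsto_snd[OF u(3)]]] by (simp add: X_def u_eq)
  have gap: "(\<lambda>n. x n - a n) \<longlonglongrightarrow> 0" "(\<lambda>n. y n - b n) \<longlonglongrightarrow> 0" "(\<lambda>n. z n - d n) \<longlonglongrightarrow> 0"
    "(\<lambda>n. vs n - es n) \<longlonglongrightarrow> 0"
    using tendsto_fst[OF gap_null] tendsto_fst[OF tendsto_snd[OF gap_null]]
      tendsto_fst[OF tendsto_snd[OF tendsto_snd[OF gap_null]]]
      tendsto_snd[OF tendsto_snd[OF tendsto_snd[OF gap_null]]]
    by (simp_all add: X_def a'_def)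
  have a_lim: "a \<longlonglongrightarrow> xbar" using tendsto_diff[OF x_lim gap(1)] by simp
  have summable_comp: "summable (\<lambda>n. (norm (c n))\<^sup>2)"
    if "\<And>n. norm (c n) \<le> norm (X (Suc n) - X n)" for c :: "nat \<Rightarrow> 'c::real_normed_vector"
    by (rule summable_comparison_test'[OF summable_steps, of 0]) (simp add: that power_mono)
  have comp_le: "norm (x (Suc n) $ i - x n $ i) \<le> norm (X (Suc n) - X n)"
    "norm (y (Suc n) $ k - y n $ k) \<le> norm (X (Suc n) - X n)"
    "norm (z (Suc n) $ k - z n $ k) \<le> norm (X (Suc n) - X n)"
    "norm (vs (Suc n) $ k - vs n $ k) \<le> norm (X (Suc n) - X n)" for n i k
  proof -
    have nth: "norm (p $ j - q $ j) \<le> norm (p - q)" for p q :: "'c::real_normed_vector ^ 'd::finite" and j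
      using Finite_Cartesian_Product.norm_nth_le[of "p - q" j] by simp
    have eq: "X (Suc n) - X n = (x (Suc n) - x n, y (Suc n) - y n, z (Suc n) - z n, vs (Suc n) - vs n)"
      by (simp add: X_def)
    show "norm (x (Suc n) $ i - x n $ i) \<le> norm (X (Suc n) - X n)"
      unfolding eq by (rule order_trans[OF nth norm_fst_le])
    show "norm (y (Suc n) $ k - y n $ k) \<le> norm (X (Suc n) - X n)"
      unfolding eq by (rule order_trans[OF nth order_trans[OF norm_fst_le norm_snd_le]])
    show "norm (z (Suc n) $ k - z n $ k) \<le> norm (X (Suc n) - X n)"
      unfolding eq by (rule order_trans[OF nth order_trans[OF norm_fst_le order_trans[OF norm_snd_le norm_snd_le]]])
    show "norm (vs (Suc n) $ k - vs n $ k) \<le> norm (X (Suc n) - X n)"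
      unfolding eq by (rule order_trans[OF nth order_trans[OF norm_snd_le order_trans[OF norm_snd_le norm_snd_le]]])
  qed
  show ?thesis
  proof (intro conjI allI)
    show "\<exists>xbar vbar.
       primal_solution H s r A C Q R Bm Bc Bl Dm Dc Dl L xbar \<and>
       dual_solution H G s r A C Q R Bm Bc Bl Dm Dc Dl L vbar \<and>
       (\<forall>i k. (\<lambda>n. x n $ i) \<longlonglongrightarrow> xbar $ i \<and> (\<lambda>n. a n $ i) \<longlonglongrightarrow> xbar $ i \<and>
              (\<lambda>n. vs n $ k) \<longlonglongrightarrow> vbar $ k) \<and>
       (xbar, vbar) \<in> kuhn_tucker_set H G s r A C Q R Bm Bc Bl Dm Dc Dl L"
      using sol tendsto_vec_nth[OF x_lim] tendsto_vec_nth[OF a_lim] tendsto_vec_nth[OF vs_lim] by blast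
  qed (rule summable_comp comp_le nth_null gap)+
qed

end
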